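(* Assume that $K$ is injective with dense range and that $(\delta_{ij})_{i,j\in\mathbb{N}}$ are independent and identically distributed real random variables with zero mean and finite variance. Assume moreover that the discretisation $(l_j)_{j\in\mathbb{N}}$ is complete and well-conditioned. Let $\hat y\in\mathcal{D}(K^+)$, let $(\delta^{disc}_m)_{m\in\mathbb{N}}$ be a sequence of positive numbers converging to $0$ with $\|\hat y-P_m^+P_m\hat y\|\le\delta_m^{disc}$, and let $n(m,\delta_m^{disc})$ and $\alpha_m$ be determined by the discrepancy principle described in the context (Tikhonov regularisation, $\tau>1$, $q\in(0,1)$). Then for all $\varepsilon>0$ $$\lim_{m\to\infty}\mathbb{P}\left(\left\|R_{\alpha_m}Z^{(m)}_{n(m,\delta_m^{disc})}-K^+\hat y\right\|\ge\varepsilon\right)=0 .$$ If moreover there are $0<\nu\le1$ and $\rho>0$ such that $K^+\hat y=(K^*K)^{\nu/2}w$ for some $w\in\mathcal{X}$ with $\|w\|\le\rho$, then $$\lim_{m\to\infty}\mathbb{P}\left(\left\|R_{\alpha_m}Z^{(m)}_{n(m,\delta_m^{disc})}-K^+\hat y\right\|\le L'\rho^{\frac1{\nu+1}}\left(\delta_m^{disc}\right)^{\frac{\nu}{\nu+1}}\right)=1$$ for some constant $L'$ (not depending on $m$).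
   Context: $\mathcal{X},\mathcal{Y}$ are infinite-dimensional real Hilbert spaces, $K:\mathcal{X}\to\mathcal{Y}$ is a compact linear operator, and $K^+$ is its generalised (Moore-Penrose) inverse with domain $\mathcal{D}(K^+)=\mathcal{R}(K)\oplus\mathcal{R}(K)^\perp$. Discretisation: $l_j=(\eta_j,\cdot)$ with $\eta_j\in\mathcal{Y}$, $j\in\mathbb{N}$, and $\|\eta_1\|=\|\eta_2\|=\dots$; $P_m:\mathcal{Y}\to\mathbb{R}^m$, $P_my=(l_1(y),\dots,l_m(y))^T$, with $P_mP_m^*$ bijective; $P_m^+$ is the Moore-Penrose inverse. Complete: for every $y\in\mathcal{Y}\setminus\{0\}$ there is $j$ with $l_j(y)\neq0$. Well-conditioned: $\sup_{j\in\mathbb{N}}\sum_{i\ne j}|(\eta_i,\eta_j)|/\|\eta_1\|^2\le c<1$ for some $c$. Further, $(c_m),(C_m)$ are known sequences with $0<c_m\le\sigma^{(m)}_j\le C_m$ for all $j\le m$ and $\limsup_{m\to\infty} C_m/c_m<\infty$, where $\sigma_1^{(m)},\dots,\sigma_m^{(m)}$ are the singular values of $P_m$. Measurements: $Y_{ij}=l_j(\hat y)+\delta_{ij}$, $\bar Y^{(m)}_n=\frac1n\sum_{i=1}^n(Y_{i1},\dots,Y_{im})^T$, and $Z_n^{(m)}=P_m^+\bar Y_n^{(m)}$ (the minimum-norm minimiser over $y\in\mathcal{Y}$ of $\|P_my-\bar Y^{(m)}_n\|$). Sample variance: $s^2_{m,n}=\frac1m\sum_{j=1}^m\frac1{n-1}\sum_{i=1}^n\big(Y_{ij}-\frac1n\sum_{l=1}^nY_{lj}\big)^2$.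 Number of repetitions: $n(m,\delta):=\min\{n\ge2:\ \frac{m s_{m,n}^2}{n c_m^2}\le\delta^2\}$ (almost surely finite). Tikhonov regularisation: $R_\alpha z=\arg\min_{x\in\mathcal{X}}\|Kx-z\|_{\mathcal{Y}}^2+\alpha\|x\|_{\mathcal{X}}^2$, $z\in\mathcal{Y}$. Discrepancy principle: fix $\tau>1$, $q\in(0,1)$. Then $\alpha_m=q^k$, where $k\in\{0,1,2,\dots\}$ is the smallest index with $\|KR_{q^k}Z^{(m)}_{n(m,\delta^{disc}_m)}-Z^{(m)}_{n(m,\delta^{disc}_m)}\|\le2\tau\delta_m^{disc}$. *)

theory Defs
  imports "HOL-Probability.Probability"
begin

definition compact_operator :: "('a::real_normed_vector \<Rightarrow> 'b::real_normed_vector) \<Rightarrow> bool" where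
  "compact_operator T \<longleftrightarrow> linear T \<and> (\<forall>S. bounded S \<longrightarrow> compact (closure (T ` S)))"

definition mp_domain :: "('a::real_inner \<Rightarrow> 'b::real_inner) \<Rightarrow> 'b set" where
  "mp_domain T = {u + v | u v. u \<in> range T \<and> v \<in> (range T)\<^sup>\<bottom>}"

(* On mp_domain T, this is the linear extension of the inverse of T restricted to the orthogonal
   complement of its kernel, with kernel (range T)^perp: if y = u + v with u in range T and
   v orthogonal to range T, then T x = u. Outside mp_domain T the value is unspecified. *)
definition mp_inverse :: "('a::real_inner \<Rightarrow> 'b::real_inner) \<Rightarrow> 'b \<Rightarrow> 'a" where
  "mp_inverse T y = (THE x. x \<in> (T -` {0})\<^sup>\<bottom> \<and> y - T x \<in> (range T)\<^sup>\<bottom>)"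

definition eigenspace :: "('a::real_vector \<Rightarrow> 'a) \<Rightarrow> real \<Rightarrow> 'a set" where
  "eigenspace A t = {x. A x = t *\<^sub>R x}"

definition orth_proj :: "'a::real_inner set \<Rightarrow> 'a \<Rightarrow> 'a" where
  "orth_proj S x = (THE p. p \<in> S \<and> x - p \<in> S\<^sup>\<bottom>)"

(* A^s for a compact, self-adjoint, positive semidefinite A and s > 0, by the spectral
   decomposition. For A = K* K with singular system (sigma_j, v_j, u_j) of K, grouping
   equal singular values shows that it is w |-> sum_j sigma_j^(2s) (w, v_j) v_j.
   The eigenvalue 0 contributes nothing because s > 0. *)
definition operator_powr :: "('a::real_inner \<Rightarrow> 'a) \<Rightarrow> real \<Rightarrow> 'a \<Rightarrow> 'a" where
  "operator_powr A s w =
     (\<Sum>\<^sub>\<infinity>t\<in>{t. 0 < t \<and> eigenspace A t \<noteq> {0}}. (t powr s) *\<^sub>R orth_proj (eigenspace A t) w)"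

definition tikhonov :: "('a::real_inner \<Rightarrow> 'b::real_inner) \<Rightarrow> real \<Rightarrow> 'b \<Rightarrow> 'a" where
  "tikhonov K \<alpha> z = (ARG_MIN (\<lambda>x. (norm (K x - z))\<^sup>2 + \<alpha> * (norm x)\<^sup>2) x. True)"

(* All indices start from 0: the functionals are l_j = (eta j, .), and the first m of them are
   those with j < m. A vector of R^m is a function nat => real that vanishes from m on. *)
definition euclid :: "nat \<Rightarrow> (nat \<Rightarrow> real) set" where
  "euclid m = {u. \<forall>j\<ge>m. u j = 0}"

definition meas_op :: "(nat \<Rightarrow> 'b::real_inner) \<Rightarrow> nat \<Rightarrow> 'b \<Rightarrow> nat \<Rightarrow> real" where
  "meas_op \<eta> m y = (\<lambda>j. if j < m then \<eta> j \<bullet> y else 0)"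

definition meas_adj :: "(nat \<Rightarrow> 'b::real_inner) \<Rightarrow> nat \<Rightarrow> (nat \<Rightarrow> real) \<Rightarrow> 'b" where
  "meas_adj \<eta> m u = (\<Sum>j<m. u j *\<^sub>R \<eta> j)"

lemma meas_adj_adjoint: "(\<Sum>j<m. meas_op \<eta> m y j * u j) = y \<bullet> meas_adj \<eta> m u"
  by (simp add: meas_op_def meas_adj_def inner_sum_right inner_commute mult.commute)

(* The m singular values of P_m, without multiplicities: the square roots of the eigenvalues of
   P_m P_m* on R^m. *)
definition meas_singular_values :: "(nat \<Rightarrow> 'b::real_inner) \<Rightarrow> nat \<Rightarrow> real set" where
  "meas_singular_values \<eta> m =
     {\<sigma>. 0 \<le> \<sigma> \<and> (\<exists>u\<in>euclid m. u \<noteq> (\<lambda>_. 0) \<and> meas_op \<eta> m (meas_adj \<eta> m u) = (\<lambda>j. \<sigma>\<^sup>2 * u j))}"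

(* The element of minimal norm among the minimisers y of the Euclidean distance from P_m y to the
   first m entries of v. *)
definition meas_pinv :: "(nat \<Rightarrow> 'b::real_inner) \<Rightarrow> nat \<Rightarrow> (nat \<Rightarrow> real) \<Rightarrow> 'b" where
  "meas_pinv \<eta> m v =
     arg_min norm (is_arg_min (\<lambda>y. L2_set (\<lambda>j. meas_op \<eta> m y j - v j) {..<m}) (\<lambda>_. True))"

definition complete_discretisation :: "(nat \<Rightarrow> 'b::real_inner) \<Rightarrow> bool" where
  "complete_discretisation \<eta> \<longleftrightarrow> (\<forall>y. y \<noteq> 0 \<longrightarrow> (\<exists>j. \<eta> j \<bullet> y \<noteq> 0))"

definition well_conditioned :: "(nat \<Rightarrow> 'b::real_inner) \<Rightarrow> bool" where
  "well_conditioned \<eta> \<longleftrightarrow>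
     (\<exists>c<1. \<forall>j. (\<lambda>i. \<bar>\<eta> i \<bullet> \<eta> j\<bar> / (norm (\<eta> 0))\<^sup>2) summable_on (UNIV - {j}) \<and>
                (\<Sum>\<^sub>\<infinity>i\<in>UNIV - {j}. \<bar>\<eta> i \<bullet> \<eta> j\<bar> / (norm (\<eta> 0))\<^sup>2) \<le> c)"

(* Below, Y i j is the i-th repetition of the measurement with the j-th functional. *)
definition sample_mean :: "(nat \<Rightarrow> nat \<Rightarrow> real) \<Rightarrow> nat \<Rightarrow> nat \<Rightarrow> real" where
  "sample_mean Y n j = (\<Sum>i<n. Y i j) / real n"

definition sample_var :: "(nat \<Rightarrow> nat \<Rightarrow> real) \<Rightarrow> nat \<Rightarrow> nat \<Rightarrow> real" where
  "sample_var Y m n =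
     (\<Sum>j<m. (\<Sum>i<n. (Y i j - sample_mean Y n j)\<^sup>2) / (real n - 1)) / real m"

(* Where no such n exists (a null event in the setting of interest), the value is unspecified. *)
definition num_repetitions :: "(nat \<Rightarrow> nat \<Rightarrow> real) \<Rightarrow> nat \<Rightarrow> real \<Rightarrow> real \<Rightarrow> nat" where
  "num_repetitions Y m c d =
     (LEAST n. 2 \<le> n \<and> real m * sample_var Y m n / (real n * c\<^sup>2) \<le> d\<^sup>2)"

definition discrepancy_alpha ::
    "('a::real_inner \<Rightarrow> 'b::real_inner) \<Rightarrow> real \<Rightarrow> real \<Rightarrow> real \<Rightarrow> 'b \<Rightarrow> real" where
  "discrepancy_alpha K \<tau> q d z = q ^ (LEAST k. norm (K (tikhonov K (q ^ k) z) - z) \<le> 2 * \<tau> * d)"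

end

(*
  By independence the average of n repetitions has squared error close to m * var / n, and the
  stopping rule compares exactly this quantity, with var estimated by the pooled sample variance,
  to (c_m * delta_m)^2. The estimate is uniformly accurate: truncation bounds it from below for all n
  at once. So the random number N of repetitions lies either in a bounded range or in a window whose
  endpoints have a ratio close to 1. On such a window the sums of the errors hardly move, because N is
  a stopping time and the stopped increments are orthogonal. Hence |Z_m - yhat| <= (1 + tau) * delta_m
  with probability tending to 1.

  On this event everything is deterministic. With the bias e = x - R_a K x, which solves K*K e = a (x - e), the
  discrepancy principle bounds |K e| by a multiple of delta_m at the chosen a, and from below at a / q.
  The former controls the bias, since the range of K* is dense (or by interpolation, under the source
  condition); the latter controls the propagated data error, which is at most |Z_m - yhat| / sqrt a.
*)

theory Submission
  imports Defs
begin

section \<open>Hilbert spaces and Tikhonov regularisation\<close>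

text \<open>The strict inequality \<tau> > 1 is spent twice. The data error is allowed delta_m for
  the discretisation and \<tau> * delta_m for the noise, whose size is at most about delta_m; the
  surplus absorbs its random fluctuation. And the threshold 2 * \<tau> * delta_m exceeds (1 +
  \<tau>) * delta_m by (\<tau> - 1) * delta_m, which is the lower bound for |K e| at every rejected
  parameter.

  N is computed from the very noise that is averaged, so its value cannot be conditioned on. A union
  bound over its values is affordable only while their number is bounded independently of m. Beyond
  that, the sums are estimated at the left end of the window, and what follows up to N is a sum of
  orthogonal increments. Nothing is known about the growth of N with m, so the tail estimates are
  uniform in the sample size and in the tolerance.

  The noise has only two moments. Whatever asks for four is done for truncated noise; the remainder
  is handled by Markov's inequality in upper bounds, and in lower bounds it disappears because
  truncation is a contraction.\<close>

lemma norm_power2_add: "(norm (x + y))\<^sup>2 = (norm x)\<^sup>2 + 2 * (x \<bullet> y) + (norm (y::'a::real_inner))\<^sup>2"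
  by (simp add: power2_norm_eq_inner inner_add_left inner_add_right inner_commute)

lemma subspace_closure:
  fixes S :: "'a::real_normed_vector set"
  assumes S: "subspace S"
  shows "subspace (closure S)"
proof (rule subspaceI)
  show "0 \<in> closure S" by (rule subsetD[OF closure_subset subspace_0[OF S]])
next
  fix x y assume "x \<in> closure S" "y \<in> closure S"
  then obtain f g where f: "\<forall>n. f n \<in> S" "f \<longlonglongrightarrow> x"
    and g: "\<forall>n. g n \<in> S" "g \<longlonglongrightarrow> y"
    unfolding closure_sequential by blast
  have "(\<lambda>n. f n + g n) \<longlonglongrightarrow> x + y" by (rule tendsto_add[OF f(2) g(2)])
  moreover have "\<forall>n. f n + g n \<in> S" using f(1) g(1) subspace_add[OF S] by simp
  ultimately show "x + y \<in> closure S" unfolding closure_sequential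
    by (intro exI[of _ "\<lambda>n. f n + g n"] conjI)
next
  fix r :: real and x assume "x \<in> closure S"
  then obtain f where f: "\<forall>n. f n \<in> S" "f \<longlonglongrightarrow> x"
    unfolding closure_sequential by blast
  have "(\<lambda>n. r *\<^sub>R f n) \<longlonglongrightarrow> r *\<^sub>R x" by (rule tendsto_scaleR[OF tendsto_const f(2)])
  moreover have "\<forall>n. r *\<^sub>R f n \<in> S" using f(1) subspace_scale[OF S] by simp
  ultimately show "r *\<^sub>R x \<in> closure S" unfolding closure_sequential
    by (intro exI[of _ "\<lambda>n. r *\<^sub>R f n"] conjI)
qed

text \<open>The parallelogram law makes a minimising sequence Cauchy, since midpoints stay in
  \<open>S\<close>; the limit lies in \<open>S\<close> by closedness, and minimality along each
  direction \<open>s\<close> gives orthogonality. Riesz representation, solvability of the normal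
  equation and density of the range of the adjoint are all read off from this lemma.\<close>

lemma orthogonal_projection_exists:
  fixes S :: "'a::{real_inner, complete_space} set"
  assumes "closed S" and S: "subspace S"
  shows "\<exists>p\<in>S. x - p \<in> S\<^sup>\<bottom>"
proof -
  define d where "d = Inf ((\<lambda>q. (norm (x - q))\<^sup>2) ` S)"
  have bdd: "bdd_below ((\<lambda>q. (norm (x - q))\<^sup>2) ` S)"
    by (rule bdd_belowI[of _ 0]) auto
  have d_le: "d \<le> (norm (x - q))\<^sup>2" if "q \<in> S" for q
    unfolding d_def using that by (intro cInf_lower bdd) auto
  have "\<exists>q\<in>S. (norm (x - q))\<^sup>2 < d + inverse (real (Suc n))" for n
  proof -
    have "\<exists>y\<in>(\<lambda>q. (norm (x - q))\<^sup>2) ` S. y < d + inverse (real (Suc n))"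
      using subspace_0[OF S] unfolding d_def
      by (intro cInf_lessD) auto
    thus ?thesis by auto
  qed
  then obtain p where pS: "\<And>n. p n \<in> S"
    and p_less: "\<And>n. (norm (x - p n))\<^sup>2 < d + inverse (real (Suc n))"
    by metis
  have parallelogram: "(norm (p m - p n))\<^sup>2 \<le> 2 * inverse (real (Suc m)) + 2 * inverse (real (Suc n))" for m n
  proof -
    define a b where "a = x - p m" and "b = x - p n"
    have "(1 / 2) *\<^sub>R (p m + p n) \<in> S"
      using S pS by (simp add: subspace_add subspace_scale)
    from d_le[OF this] have "d \<le> (norm ((1 / 2) *\<^sub>R (a + b)))\<^sup>2"
      by (simp add: a_def b_def algebra_simps flip: scaleR_add_left)
    hence "4 * d \<le> (norm (a + b))\<^sup>2" by (simp add: power_mult_distrib power_divide)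
    moreover have "(norm (a - b))\<^sup>2 + (norm (a + b))\<^sup>2 = 2 * (norm a)\<^sup>2 + 2 * (norm b)\<^sup>2"
      by (simp add: power2_norm_eq_inner algebra_simps inner_commute)
    moreover have "norm (p m - p n) = norm (a - b)"
      by (simp add: a_def b_def norm_minus_commute)
    ultimately show ?thesis using p_less[of m] p_less[of n] by (simp add: a_def b_def)
  qed
  have "Cauchy p"
  proof (rule metric_CauchyI)
    fix e :: real assume "e > 0"
    hence "e\<^sup>2 / 4 > 0" by simp
    then obtain N where N: "inverse (real (Suc N)) < e\<^sup>2 / 4"
      using reals_Archimedean by blast
    show "\<exists>N. \<forall>m\<ge>N. \<forall>n\<ge>N. dist (p m) (p n) < e"
    proof (intro exI allI impI)
      fix m n assume "m \<ge> N" "n \<ge> N"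
      hence "inverse (real (Suc m)) \<le> inverse (real (Suc N))" "inverse (real (Suc n)) \<le> inverse (real (Suc N))"
        by auto
      hence "(norm (p m - p n))\<^sup>2 < e\<^sup>2" using parallelogram[of m n] N by linarith
      thus "dist (p m) (p n) < e" using \<open>e > 0\<close> by (simp add: dist_norm power2_less_imp_less)
    qed
  qed
  then obtain P where P: "p \<longlonglongrightarrow> P" using Cauchy_convergent convergent_def by blast
  have PS: "P \<in> S" using closed_sequentially[OF \<open>closed S\<close> _ P] pS by blast
  have "(\<lambda>n. (norm (x - p n))\<^sup>2) \<longlonglongrightarrow> (norm (x - P))\<^sup>2"
    by (intro tendsto_intros P)
  moreover have "(\<lambda>n. d + inverse (real (Suc n))) \<longlonglongrightarrow> d + 0"
    by (intro tendsto_intros LIMSEQ_inverse_real_of_nat)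
  ultimately have le_d: "(norm (x - P))\<^sup>2 \<le> d"
    using p_less by (intro LIMSEQ_le[where Y = "\<lambda>n. d + inverse (real (Suc n))"]) (auto intro: less_imp_le)
  have "x - P \<in> S\<^sup>\<bottom>"
  proof -
    have "s \<bullet> (x - P) = 0" if "s \<in> S" for s
    proof (cases "s = 0")
      case False
      \<comment> \<open>The minimiser of the distance from \<open>x - P\<close> to the line spanned
        by \<open>s\<close>.\<close>
      define t where "t = (s \<bullet> (x - P)) / (s \<bullet> s)"
      have "P + t *\<^sub>R s \<in> S" using S PS that by (simp add: subspace_add subspace_scale)
      from d_le[OF this] le_d have "(norm (x - P))\<^sup>2 \<le> (norm (x - (P + t *\<^sub>R s)))\<^sup>2"
        by linarith
      also have "x - (P + t *\<^sub>R s) = (x - P) + (- t) *\<^sub>R s" by simp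
      also have "(norm ((x - P) + (- t) *\<^sub>R s))\<^sup>2 = (norm (x - P))\<^sup>2 - 2 * t * (s \<bullet> (x - P)) + t\<^sup>2 * (s \<bullet> s)"
        unfolding norm_power2_add
        by (simp add: power_mult_distrib power2_norm_eq_inner inner_commute)
      also have "\<dots> = (norm (x - P))\<^sup>2 - (s \<bullet> (x - P))\<^sup>2 / (s \<bullet> s)"
        using False by (simp add: t_def power2_eq_square)
      finally have "(s \<bullet> (x - P))\<^sup>2 / (s \<bullet> s) \<le> 0" by simp
      moreover have "s \<bullet> s > 0" using False by simp
      ultimately show ?thesis by (simp add: divide_le_0_iff)
    qed simp
    thus ?thesis by (simp add: orthogonal_comp_def orthogonal_def)
  qed
  thus ?thesis using PS by blast
qed

lemma orth_proj_works:
  fixes S :: "'a::{real_inner, complete_space} set"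
  assumes "closed S" and S: "subspace S"
  shows "orth_proj S x \<in> S" and "\<And>s. s \<in> S \<Longrightarrow> s \<bullet> (x - orth_proj S x) = 0"
proof -
  have "\<exists>!p. p \<in> S \<and> x - p \<in> S\<^sup>\<bottom>"
  proof (rule ex_ex1I)
    show "\<exists>p. p \<in> S \<and> x - p \<in> S\<^sup>\<bottom>"
      using orthogonal_projection_exists[OF assms, of x] by blast
    fix p p' assume *: "p \<in> S \<and> x - p \<in> S\<^sup>\<bottom>" "p' \<in> S \<and> x - p' \<in> S\<^sup>\<bottom>"
    hence "p - p' \<in> S" using S by (simp add: subspace_diff)
    with * have "(p - p') \<bullet> (x - p) = 0" "(p - p') \<bullet> (x - p') = 0"
      by (auto simp: orthogonal_comp_def orthogonal_def)
    hence "(p - p') \<bullet> (p - p') = 0" by (simp add: inner_diff_right)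
    thus "p = p'" by simp
  qed
  from theI'[OF this] have "orth_proj S x \<in> S \<and> x - orth_proj S x \<in> S\<^sup>\<bottom>"
    unfolding orth_proj_def .
  thus "orth_proj S x \<in> S" and "\<And>s. s \<in> S \<Longrightarrow> s \<bullet> (x - orth_proj S x) = 0"
    by (auto simp: orthogonal_comp_def orthogonal_def)
qed

text \<open>\<open>adjoint\<close> is a choice operator, so an adjoint has to be exhibited first.
  This is Riesz representation: the functional \<open>K x \<bullet> y\<close> vanishes on the closed
  subspace \<open>S\<close>, and a vector \<open>u\<close> orthogonal to \<open>S\<close> represents
  it after scaling.\<close>

lemma adjoint_inner:
  fixes K :: "'a::{real_inner, complete_space} \<Rightarrow> 'b::real_inner"
  assumes K: "bounded_linear K"
  shows "K x \<bullet> y = x \<bullet> adjoint K y"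
proof -
  interpret K: bounded_linear K by fact
  have "\<exists>v. \<forall>x. K x \<bullet> y = x \<bullet> v" for y
  proof (cases "\<forall>x. K x \<bullet> y = 0")
    case False
    then obtain x0 where x0: "K x0 \<bullet> y \<noteq> 0" by blast
    define S where "S = {x. K x \<bullet> y = 0}"
    have S: "subspace S" unfolding S_def subspace_def
      by (auto simp: K.add K.scaleR K.zero inner_add_left)
    have "closed S" unfolding S_def
      by (intro closed_Collect_eq continuous_intros K.continuous_on)
    from orthogonal_projection_exists[OF this S, of x0] obtain p
      where p: "p \<in> S" "x0 - p \<in> S\<^sup>\<bottom>" by blast
    define u where "u = x0 - p"
    have Ku: "K u \<bullet> y \<noteq> 0" using x0 p by (simp add: u_def S_def K.diff inner_diff_left)
    hence "u \<bullet> u \<noteq> 0" using K.zero by auto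
    have orth: "s \<bullet> u = 0" if "s \<in> S" for s
      using p that by (simp add: u_def orthogonal_comp_def orthogonal_def)
    have "K x \<bullet> y = x \<bullet> ((K u \<bullet> y / (u \<bullet> u)) *\<^sub>R u)" for x
    proof -
      define t where "t = (K x \<bullet> y) / (K u \<bullet> y)"
      have "x - t *\<^sub>R u \<in> S"
        using Ku by (simp add: S_def K.diff K.scaleR inner_diff_left t_def)
      from orth[OF this] have "x \<bullet> u = t * (u \<bullet> u)" by (simp add: inner_diff_left)
      thus ?thesis using Ku \<open>u \<bullet> u \<noteq> 0\<close> by (simp add: t_def)
    qed
    thus ?thesis by blast
  qed (auto intro: exI[of _ 0])
  then obtain g where "\<forall>x y. K x \<bullet> y = x \<bullet> g y" by metis
  with adjoint_unique[OF this] show ?thesis by simp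
qed

lemma compact_operator_bounded_linear:
  assumes "compact_operator K"
  shows "bounded_linear K"
proof -
  from assms have lin: "linear K" and "compact (closure (K ` cball 0 1))"
    by (auto simp: compact_operator_def)
  hence "bounded (K ` cball 0 1)"
    using bounded_subset closure_subset compact_imp_bounded by metis
  then obtain B where B: "\<And>x. norm x \<le> 1 \<Longrightarrow> norm (K x) \<le> B"
    unfolding bounded_iff by (metis image_eqI mem_cball_0)
  show ?thesis
  proof (rule bounded_linear_intro)
    show "K (x + y) = K x + K y" for x y using lin by (simp add: linear_add)
    show "K (r *\<^sub>R x) = r *\<^sub>R K x" for r x using lin by (simp add: linear_scale)
    show "norm (K x) \<le> norm x * B" for x
    proof (cases "x = 0")
      case False
      hence "norm (K (inverse (norm x) *\<^sub>R x)) \<le> B" by (intro B) simp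
      thus ?thesis using False lin by (simp add: linear_scale field_simps)
    qed (use lin in \<open>simp add: linear_0\<close>)
  qed
qed

section \<open>Tikhonov regularisation through its normal equation\<close>

context
  fixes K :: "'x::{real_inner, complete_space} \<Rightarrow> 'y::{real_inner, complete_space}"
  assumes K: "bounded_linear K"
begin

interpretation K: bounded_linear K by (rule K)

text \<open>The Tikhonov functional is the squared distance of (z, 0) to the point (K x, sqrt
  \<alpha> x) of the product space. These points form a closed subspace, and orthogonality of the
  projection residual to it is the normal equation.\<close>

lemma normal_equation_solvable:
  assumes "\<alpha> > 0"
  shows "\<exists>x. \<forall>h. (K x - z) \<bullet> K h + \<alpha> * (x \<bullet> h) = 0"
proof -
  \<comment> \<open>Written as the solution set of a continuous linear equation instead of as an
    image, \<open>S\<close> is closed at once.\<close>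
  define S where "S = {p :: 'y \<times> 'x. sqrt \<alpha> *\<^sub>R fst p = K (snd p)}"
  have S: "subspace S"
    unfolding S_def subspace_def
    by (auto simp: K.zero K.add K.scaleR scaleR_add_right simp del: scaleR_scaleR)
      (metis scaleR_left_commute)
  have "closed S" unfolding S_def
    by (intro closed_Collect_eq continuous_intros K.continuous_on)
  from orthogonal_projection_exists[OF this S, of "(z, 0)"] obtain p
    where p: "p \<in> S" "(z, 0) - p \<in> S\<^sup>\<bottom>" by blast
  obtain a b where ab: "p = (a, b)" by (cases p)
  define x where "x = inverse (sqrt \<alpha>) *\<^sub>R b"
  have b: "b = sqrt \<alpha> *\<^sub>R x" using assms by (simp add: x_def)
  have a: "a = K x" using p assms by (simp add: S_def ab b K.scaleR)
  have "(K x - z) \<bullet> K h + \<alpha> * (x \<bullet> h) = 0" for h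
  proof -
    have "(K h, sqrt \<alpha> *\<^sub>R h) \<in> S" by (simp add: S_def K.scaleR)
    with p have "(K h, sqrt \<alpha> *\<^sub>R h) \<bullet> ((z, 0) - p) = 0"
      by (auto simp: orthogonal_comp_def orthogonal_def)
    thus ?thesis using assms
      by (simp add: ab a b inner_Pair inner_diff_left inner_diff_right inner_commute
          flip: mult.assoc)
  qed
  thus ?thesis by blast
qed

text \<open>The cross terms are twice the normal equation at h = y - x. The excess over the value at
  \<open>x\<close> is positive definite in y - x, so the minimiser is unique and the choice in
  \<open>tikhonov\<close> is determined.\<close>

lemma tikhonov_functional_split:
  assumes "\<forall>h. (K x - z) \<bullet> K h + \<alpha> * (x \<bullet> h) = 0"
  shows "(norm (K y - z))\<^sup>2 + \<alpha> * (norm y)\<^sup>2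
    = (norm (K x - z))\<^sup>2 + \<alpha> * (norm x)\<^sup>2 + (norm (K (y - x)))\<^sup>2 + \<alpha> * (norm (y - x))\<^sup>2"
proof -
  have "(norm (K y - z))\<^sup>2 = (norm (K x - z))\<^sup>2 + 2 * ((K x - z) \<bullet> K (y - x)) + (norm (K (y - x)))\<^sup>2"
    using norm_power2_add[of "K x - z" "K (y - x)"] by (simp add: K.diff)
  moreover have "(norm y)\<^sup>2 = (norm x)\<^sup>2 + 2 * (x \<bullet> (y - x)) + (norm (y - x))\<^sup>2"
    using norm_power2_add[of x "y - x"] by simp
  hence "\<alpha> * (norm y)\<^sup>2 = \<alpha> * (norm x)\<^sup>2 + 2 * (\<alpha> * (x \<bullet> (y - x))) + \<alpha> * (norm (y - x))\<^sup>2"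
    by (simp add: distrib_left)
  ultimately show ?thesis
    using assms[rule_format, of "y - x"] by linarith
qed

lemma tikhonov_eqI:
  assumes "\<alpha> > 0" and x: "\<And>h. (K x - z) \<bullet> K h + \<alpha> * (x \<bullet> h) = 0"
  shows "tikhonov K \<alpha> z = x"
proof -
  let ?J = "\<lambda>x. (norm (K x - z))\<^sup>2 + \<alpha> * (norm x)\<^sup>2"
  have split: "?J y = ?J x + (norm (K (y - x)))\<^sup>2 + \<alpha> * (norm (y - x))\<^sup>2" for y
    by (rule tikhonov_functional_split) (use x in blast)
  have min: "?J x \<le> ?J y" for y using split[of y] assms(1) by simp
  have "is_arg_min ?J (\<lambda>_. True) (tikhonov K \<alpha> z)"
    unfolding tikhonov_def arg_min_def
    by (rule someI[of _ x]) (use min in \<open>auto simp: is_arg_min_def not_less\<close>)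
  hence "?J (tikhonov K \<alpha> z) \<le> ?J x" by (auto simp: is_arg_min_def not_less)
  with split[of "tikhonov K \<alpha> z"] have "\<alpha> * (norm (tikhonov K \<alpha> z - x))\<^sup>2 \<le> 0"
    by (smt (verit) zero_le_power2)
  thus ?thesis using assms(1) by (simp add: mult_le_0_iff)
qed

lemma tikhonov_normal_equation:
  assumes "\<alpha> > 0"
  shows "(K (tikhonov K \<alpha> z) - z) \<bullet> K h + \<alpha> * (tikhonov K \<alpha> z \<bullet> h) = 0"
  using normal_equation_solvable[OF assms, of z] tikhonov_eqI[OF assms] by metis

lemma tikhonov_linear:
  assumes "\<alpha> > 0"
  shows "linear (tikhonov K \<alpha>)"
proof
  note eq = tikhonov_normal_equation[OF assms]
  show "tikhonov K \<alpha> (y + z) = tikhonov K \<alpha> y + tikhonov K \<alpha> z" for y z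
    using eq[of y] eq[of z]
    by (intro tikhonov_eqI assms) (smt (verit) K.add inner_add_left inner_diff_left distrib_left)
  show "tikhonov K \<alpha> (r *\<^sub>R z) = r *\<^sub>R tikhonov K \<alpha> z" for r z
  proof (rule tikhonov_eqI[OF assms])
    fix h
    have "(K (r *\<^sub>R tikhonov K \<alpha> z) - r *\<^sub>R z) \<bullet> K h + \<alpha> * ((r *\<^sub>R tikhonov K \<alpha> z) \<bullet> h)
       = r * ((K (tikhonov K \<alpha> z) - z) \<bullet> K h + \<alpha> * (tikhonov K \<alpha> z \<bullet> h))"
      by (simp add: K.scaleR algebra_simps)
    thus "(K (r *\<^sub>R tikhonov K \<alpha> z) - r *\<^sub>R z) \<bullet> K h + \<alpha> * ((r *\<^sub>R tikhonov K \<alpha> z) \<bullet> h) = 0"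
      by (simp add: eq)
  qed
qed

text \<open>The normal equation is tested with its own solution, and Young's inequality absorbs the
  term |K x|^2.\<close>

lemma norm_tikhonov_le:
  assumes "\<alpha> > 0"
  shows "norm (tikhonov K \<alpha> z) \<le> norm z / sqrt \<alpha>"
proof -
  let ?x = "tikhonov K \<alpha> z"
  have "(norm (K ?x))\<^sup>2 + \<alpha> * (norm ?x)\<^sup>2 = z \<bullet> K ?x"
    using tikhonov_normal_equation[OF assms, of z ?x]
    by (simp add: power2_norm_eq_inner inner_diff_left)
  also have "\<dots> \<le> norm z * norm (K ?x)" by (rule norm_cauchy_schwarz)
  also have "\<dots> \<le> (norm z)\<^sup>2 + (norm (K ?x))\<^sup>2"
    using zero_le_power2[of "norm z - norm (K ?x)"] zero_le_power2[of "norm z"] zero_le_power2[of "norm (K ?x)"]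
    unfolding power2_diff by linarith
  finally have "(sqrt \<alpha> * norm ?x)\<^sup>2 \<le> (norm z)\<^sup>2" using assms by (simp add: power_mult_distrib)
  hence "sqrt \<alpha> * norm ?x \<le> norm z" by (rule power2_le_imp_le) simp
  thus ?thesis using assms by (simp add: field_simps)
qed

text \<open>Tested with its solution, the normal equation makes (K x - z) \<bullet> K x equal to -
  \<alpha> |x|^2, which is nonpositive; so |K x - z|^2 is at most (z - K x) \<bullet> z.\<close>

lemma norm_tikhonov_residual_le:
  assumes "\<alpha> > 0"
  shows "norm (K (tikhonov K \<alpha> z) - z) \<le> norm z"
proof -
  let ?x = "tikhonov K \<alpha> z"
  have "(K ?x - z) \<bullet> K ?x \<le> 0"
    using tikhonov_normal_equation[OF assms, of z ?x] assms
    by (smt (verit) inner_ge_zero mult_nonneg_nonneg)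
  hence "(norm (K ?x - z))\<^sup>2 \<le> (z - K ?x) \<bullet> z"
    by (simp add: power2_norm_eq_inner algebra_simps inner_commute)
  also have "\<dots> \<le> norm (K ?x - z) * norm z" using norm_cauchy_schwarz norm_minus_commute by metis
  finally show ?thesis
    by (cases "norm (K ?x - z) = 0") (auto simp: power2_eq_square)
qed

text \<open>The reconstruction error for exact data, that is \<alpha> times the inverse of
  \<open>adjoint K \<circ> K\<close> + \<alpha>, applied to \<open>x\<close>.\<close>

definition tikhonov_bias :: "real \<Rightarrow> 'x \<Rightarrow> 'x" where
  "tikhonov_bias \<alpha> x = x - tikhonov K \<alpha> (K x)"

lemma tikhonov_bias_equation:
  assumes "\<alpha> > 0"
  shows "K (tikhonov_bias \<alpha> x) \<bullet> K h = \<alpha> * ((x - tikhonov_bias \<alpha> x) \<bullet> h)"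
  using tikhonov_normal_equation[OF assms, of "K x" h]
  by (simp add: tikhonov_bias_def K.diff algebra_simps)

lemma norm_tikhonov_bias_power2_le:
  assumes "\<alpha> > 0"
  shows "(norm (tikhonov_bias \<alpha> x))\<^sup>2 \<le> x \<bullet> tikhonov_bias \<alpha> x"
proof -
  have "0 \<le> \<alpha> * ((x - tikhonov_bias \<alpha> x) \<bullet> tikhonov_bias \<alpha> x)"
    by (simp flip: tikhonov_bias_equation[OF assms])
  hence "0 \<le> (x - tikhonov_bias \<alpha> x) \<bullet> tikhonov_bias \<alpha> x"
    using assms by (simp add: zero_le_mult_iff)
  thus ?thesis by (simp add: power2_norm_eq_inner inner_diff_left)
qed

lemma norm_tikhonov_bias_le:
  assumes "\<alpha> > 0"
  shows "norm (tikhonov_bias \<alpha> x) \<le> norm x"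
proof -
  have "norm (tikhonov_bias \<alpha> x) * norm (tikhonov_bias \<alpha> x) \<le> norm x * norm (tikhonov_bias \<alpha> x)"
    using norm_tikhonov_bias_power2_le[OF assms] norm_cauchy_schwarz order_trans
    unfolding power2_eq_square by blast
  thus ?thesis by (cases "tikhonov_bias \<alpha> x = 0") auto
qed

text \<open>The factor \<open>norm (tikhonov_bias \<alpha> x)\<close> is kept on purpose: where the
  bias is small, |K e| is small compared with sqrt \<alpha>. Convergence needs exactly this to make
  the propagated data error vanish and not merely stay bounded.\<close>

lemma norm_K_tikhonov_bias_power2_le:
  assumes "\<alpha> > 0"
  shows "(norm (K (tikhonov_bias \<alpha> x)))\<^sup>2 \<le> \<alpha> * (norm x * norm (tikhonov_bias \<alpha> x))"
proof -
  let ?e = "tikhonov_bias \<alpha> x"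
  have "(norm (K ?e))\<^sup>2 = \<alpha> * (x \<bullet> ?e - ?e \<bullet> ?e)"
    by (simp add: power2_norm_eq_inner tikhonov_bias_equation[OF assms] inner_diff_left)
  also have "\<dots> \<le> \<alpha> * (norm x * norm ?e)"
    using assms norm_cauchy_schwarz[of x ?e] inner_ge_zero[of ?e] by (intro mult_left_mono) linarith+
  finally show ?thesis .
qed

lemma norm_K_tikhonov_bias_le:
  assumes "\<alpha> > 0"
  shows "norm (K (tikhonov_bias \<alpha> x)) \<le> sqrt \<alpha> * norm x"
proof (rule power2_le_imp_le)
  have "(norm (K (tikhonov_bias \<alpha> x)))\<^sup>2 \<le> \<alpha> * (norm x * norm x)"
    using assms norm_K_tikhonov_bias_power2_le[OF assms, of x] norm_tikhonov_bias_le[OF assms, of x]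
    by (smt (verit) mult_left_mono norm_ge_zero)
  thus "(norm (K (tikhonov_bias \<alpha> x)))\<^sup>2 \<le> (sqrt \<alpha> * norm x)\<^sup>2"
    using assms by (simp add: power_mult_distrib power2_eq_square[of "norm x"])
qed (use assms in simp)

lemma tikhonov_bias_bounded_linear:
  assumes "\<alpha> > 0"
  shows "bounded_linear (tikhonov_bias \<alpha>)"
proof (rule bounded_linear_intro)
  note lin = tikhonov_linear[OF assms]
  show "tikhonov_bias \<alpha> (x + y) = tikhonov_bias \<alpha> x + tikhonov_bias \<alpha> y" for x y
    by (simp add: tikhonov_bias_def K.add linear_add[OF lin])
  show "tikhonov_bias \<alpha> (r *\<^sub>R x) = r *\<^sub>R tikhonov_bias \<alpha> x" for r x
    by (simp add: tikhonov_bias_def K.scaleR linear_scale[OF lin] scaleR_diff_right)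
  show "norm (tikhonov_bias \<alpha> x) \<le> norm x * 1" for x
    using norm_tikhonov_bias_le[OF assms] by simp
qed

text \<open>A vector orthogonal to the range of the adjoint is annihilated by \<open>K\<close>,
  hence zero by injectivity; this is applied to the residual of the projection of \<open>x\<close>
  onto the closure of that range.\<close>

lemma range_adjoint_dense:
  assumes "inj K" "\<epsilon> > 0"
  shows "\<exists>w. norm (x - adjoint K w) < \<epsilon>"
proof -
  let ?S = "closure (range (adjoint K))"
  have adj: "K x \<bullet> y = x \<bullet> adjoint K y" for x y by (rule adjoint_inner[OF K])
  have "linear (adjoint K)"
  proof
    show "adjoint K (x + y) = adjoint K x + adjoint K y" for x y
      by (rule vector_eq_ldot[THEN iffD1]) (simp add: inner_add_right flip: adj)
    show "adjoint K (r *\<^sub>R x) = r *\<^sub>R adjoint K x" for r x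
      by (rule vector_eq_ldot[THEN iffD1]) (simp flip: adj)
  qed
  hence R: "subspace (range (adjoint K))" by (rule linear_subspace_image) (rule subspace_UNIV)
  from orthogonal_projection_exists[OF closed_closure subspace_closure[OF R], of x] obtain p
    where p: "p \<in> ?S" "x - p \<in> ?S\<^sup>\<bottom>" by blast
  have "adjoint K y \<in> ?S" for y by (rule subsetD[OF closure_subset rangeI])
  with p(2) have "adjoint K y \<bullet> (x - p) = 0" for y
    by (auto simp: orthogonal_comp_def orthogonal_def)
  hence "K (x - p) \<bullet> y = 0" for y by (subst adj, subst inner_commute) simp
  hence "K (x - p) = 0" by (metis inner_eq_zero_iff)
  hence "x = p" using assms(1) K.zero by (metis eq_iff_diff_eq_0 injD)
  with p(1) assms(2) show ?thesis
    unfolding closure_approachable by (auto simp: dist_norm norm_minus_commute)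
qed

end

section \<open>Discrepancy principle and source conditions\<close>

context
  fixes K :: "'x::{real_inner, complete_space} \<Rightarrow> 'y::{real_inner, complete_space}"
  assumes K: "bounded_linear K"
begin

interpretation K: bounded_linear K by (rule K)

text \<open>By linearity the residual at \<beta> is the residual of the data error minus K applied
  to the bias at \<beta>, and the former is at most (1 + \<tau>) d. So the residual and |K e| differ
  by at most (1 + \<tau>) d: acceptance gives the upper bound, rejection of the preceding parameter
  the lower one. If \<alpha> = 1, there is no preceding parameter.\<close>

lemma discrepancy_alpha_cases:
  assumes "1 < \<tau>" "0 < q" "q < 1" "0 < d" and z: "norm (z - K x) \<le> (1 + \<tau>) * d"
  defines "\<alpha> \<equiv> discrepancy_alpha K \<tau> q d z"
  shows "0 < \<alpha>" "\<alpha> \<le> 1" "norm (K (tikhonov_bias K \<alpha> x)) \<le> (1 + 3 * \<tau>) * d"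
    "\<alpha> = 1 \<or> (\<exists>\<beta>. \<alpha> = q * \<beta> \<and> 0 < \<beta> \<and> (\<tau> - 1) * d < norm (K (tikhonov_bias K \<beta> x)))"
proof -
  have res: "K (tikhonov K \<beta> z) - z
      = (K (tikhonov K \<beta> (z - K x)) - (z - K x)) - K (tikhonov_bias K \<beta> x)" if "\<beta> > 0" for \<beta>
    using linear_diff[OF tikhonov_linear[OF K that], of z "K x"]
    by (simp add: tikhonov_bias_def[OF K] K.diff)
  have noise: "norm (K (tikhonov K \<beta> (z - K x)) - (z - K x)) \<le> (1 + \<tau>) * d" if "\<beta> > 0" for \<beta>
    using norm_tikhonov_residual_le[OF K that] z by (rule order_trans)
  let ?P = "\<lambda>k. norm (K (tikhonov K (q ^ k) z) - z) \<le> 2 * \<tau> * d"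
  \<comment> \<open>The search ends, so \<open>LEAST\<close> is meaningful: |K e| is at most
    sqrt(q^k) |x|, which falls below the slack (\<tau> - 1) d.\<close>
  have ex: "\<exists>k. ?P k"
  proof -
    have "(\<lambda>k. sqrt (q ^ k) * norm x) \<longlonglongrightarrow> sqrt 0 * norm x"
      using assms by (intro tendsto_intros LIMSEQ_power_zero) auto
    hence "\<forall>\<^sub>F k in sequentially. sqrt (q ^ k) * norm x < (\<tau> - 1) * d"
      using assms by (intro order_tendstoD(2)[where y = "sqrt 0 * norm x"]) auto
    then obtain k where k: "sqrt (q ^ k) * norm x < (\<tau> - 1) * d"
      using eventually_happens by fastforce
    have "q ^ k > 0" using assms by simp
    have "norm (K (tikhonov K (q ^ k) z) - z) \<le> (1 + \<tau>) * d + sqrt (q ^ k) * norm x"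
      unfolding res[OF \<open>q ^ k > 0\<close>]
      using noise[OF \<open>q ^ k > 0\<close>] norm_K_tikhonov_bias_le[OF K \<open>q ^ k > 0\<close>, of x]
        norm_triangle_ineq4 by (smt (verit))
    also have "\<dots> \<le> 2 * \<tau> * d" using k by (simp add: algebra_simps)
    finally show ?thesis by blast
  qed
  define k where "k = (LEAST k. ?P k)"
  have \<alpha>: "\<alpha> = q ^ k" by (simp add: \<alpha>_def discrepancy_alpha_def k_def)
  have k: "?P k" unfolding k_def by (rule LeastI_ex[OF ex])
  show "0 < \<alpha>" "\<alpha> \<le> 1" using assms(1-4) by (auto simp: \<alpha> power_le_one)
  have "norm (K (tikhonov_bias K \<alpha> x))
      = norm ((K (tikhonov K \<alpha> (z - K x)) - (z - K x)) - (K (tikhonov K \<alpha> z) - z))"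
    unfolding res[OF \<open>0 < \<alpha>\<close>] by simp
  also have "\<dots> \<le> (1 + \<tau>) * d + 2 * \<tau> * d"
    using noise[OF \<open>0 < \<alpha>\<close>] k unfolding \<alpha>
    by (intro order_trans[OF norm_triangle_ineq4 add_mono]) auto
  finally show "norm (K (tikhonov_bias K \<alpha> x)) \<le> (1 + 3 * \<tau>) * d"
    by (simp add: algebra_simps)
  show "\<alpha> = 1 \<or> (\<exists>\<beta>. \<alpha> = q * \<beta> \<and> 0 < \<beta> \<and> (\<tau> - 1) * d < norm (K (tikhonov_bias K \<beta> x)))"
  proof (cases k)
    case (Suc j)
    have "q ^ j > 0" using assms by simp
    have "\<not> ?P j" using not_less_Least[of j ?P] Suc by (simp add: k_def)
    hence "2 * \<tau> * d < norm (K (tikhonov K (q ^ j) z) - z)" by simp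
    also have "\<dots> \<le> (1 + \<tau>) * d + norm (K (tikhonov_bias K (q ^ j) x))"
      unfolding res[OF \<open>q ^ j > 0\<close>]
      using noise[OF \<open>q ^ j > 0\<close>] norm_triangle_ineq4 by (smt (verit))
    finally have "(\<tau> - 1) * d < norm (K (tikhonov_bias K (q ^ j) x))" by (simp add: algebra_simps)
    with \<open>q ^ j > 0\<close> show ?thesis by (auto simp: \<alpha> Suc)
  qed (simp add: \<alpha>)
qed

lemma norm_tikhonov_error_le:
  assumes "\<alpha> > 0"
  shows "norm (tikhonov K \<alpha> z - x) \<le> norm (tikhonov_bias K \<alpha> x) + norm (z - K x) / sqrt \<alpha>"
proof -
  have "tikhonov K \<alpha> z - x = tikhonov K \<alpha> (z - K x) - tikhonov_bias K \<alpha> x"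
    using linear_diff[OF tikhonov_linear[OF K assms], of z "K x"]
    by (simp add: tikhonov_bias_def[OF K])
  thus ?thesis using norm_tikhonov_le[OF K assms, of "z - K x"] norm_triangle_ineq4
    by (smt (verit))
qed

text \<open>The bias is controlled through its image under \<open>K\<close> alone, uniformly in \<open>\<alpha>\<close>; this is what
  makes the argument work also when the discrepancy principle stops at an \<open>\<alpha>\<close> that does not tend to
  \<open>0\<close>.\<close>

lemma tikhonov_bias_small:
  assumes "inj K" "\<theta> > 0"
  shows "\<exists>d>0. \<forall>\<alpha>>0. norm (K (tikhonov_bias K \<alpha> x)) \<le> d \<longrightarrow> norm (tikhonov_bias K \<alpha> x) \<le> \<theta>"
proof -
  have "\<theta>\<^sup>2 / 2 / (norm x + 1) > 0" using assms(2) by (simp add: add_nonneg_pos)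
  from range_adjoint_dense[OF K assms(1) this] obtain w
    where w: "norm (x - adjoint K w) < \<theta>\<^sup>2 / 2 / (norm x + 1)" by blast
  \<comment> \<open>Each of the two terms below gets half of \<theta>^2. Adding 1 to the norms keeps
    the denominators positive.\<close>
  define d where "d = \<theta>\<^sup>2 / 2 / (norm w + 1)"
  have "norm (tikhonov_bias K \<alpha> x) \<le> \<theta>" if "\<alpha> > 0" "norm (K (tikhonov_bias K \<alpha> x)) \<le> d" for \<alpha>
  proof (rule power2_le_imp_le)
    let ?e = "tikhonov_bias K \<alpha> x"
    have "(norm ?e)\<^sup>2 \<le> x \<bullet> ?e" by (rule norm_tikhonov_bias_power2_le[OF K that(1)])
    \<comment> \<open>The part \<open>adjoint K w\<close> of \<open>x\<close> sees the bias only
      through \<open>K\<close>; the rest is small by density.\<close>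
    also have "\<dots> = K ?e \<bullet> w + (x - adjoint K w) \<bullet> ?e"
      unfolding adjoint_inner[OF K] inner_diff_left by (simp add: inner_commute[of _ "adjoint K w"])
    also have "\<dots> \<le> norm (K ?e) * norm w + norm (x - adjoint K w) * norm ?e"
      by (intro add_mono norm_cauchy_schwarz)
    also have "\<dots> \<le> d * (norm w + 1) + \<theta>\<^sup>2 / 2 / (norm x + 1) * (norm x + 1)"
      using that(2) w norm_tikhonov_bias_le[OF K that(1), of x]
      by (intro add_mono mult_mono) (auto simp: d_def)
    also have "\<dots> = \<theta>\<^sup>2 / 2 + \<theta>\<^sup>2 / 2"
    proof -
      have "norm w + 1 \<noteq> 0" "norm x + 1 \<noteq> 0"
        using norm_ge_zero[of w] norm_ge_zero[of x] by linarith+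
      moreover have "v / u * u = v" if "u \<noteq> 0" for u v :: real using that by simp
      ultimately show ?thesis by (simp only: d_def not_False_eq_True)
    qed
    finally show "(norm ?e)\<^sup>2 \<le> \<theta>\<^sup>2" by simp
  qed (use assms in simp)
  moreover have "d > 0" using assms(2) by (simp add: d_def add_nonneg_pos)
  ultimately show ?thesis by blast
qed

text \<open>The bias takes one half of \<epsilon>. For the other half, d / sqrt \<alpha> has to be
  small, which is shown at the rejected \<beta> = \<alpha> / q by distinguishing the size of |K e|
  there. If it is small, so is the bias, and the sharp bound on |K e| makes d small relative to sqrt
  \<beta>. Otherwise sqrt \<beta> is bounded below and d itself is small.\<close>

theorem tikhonov_discrepancy_converges:
  assumes "inj K" "1 < \<tau>" "0 < q" "q < 1" "\<epsilon> > 0"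
  shows "\<exists>d0>0. \<forall>d z. 0 < d \<longrightarrow> d < d0 \<longrightarrow> norm (z - K x) \<le> (1 + \<tau>) * d \<longrightarrow>
    norm (tikhonov K (discrepancy_alpha K \<tau> q d z) z - x) < \<epsilon>"
proof -
  \<comment> \<open>The propagated error (1 + \<tau>) d / sqrt \<alpha> is below \<epsilon> / 2
    exactly if d / sqrt \<beta> is below \<open>g\<close>, where \<alpha> = q \<beta>.\<close>
  define g where "g = \<epsilon> / (2 * (1 + \<tau>)) * sqrt q"
  have "g > 0" using assms by (simp add: g_def)
  obtain d1 where d1: "d1 > 0"
    "\<And>\<alpha>. \<alpha> > 0 \<Longrightarrow> norm (K (tikhonov_bias K \<alpha> x)) \<le> d1 \<Longrightarrow> norm (tikhonov_bias K \<alpha> x) \<le> \<epsilon> / 2"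
    using tikhonov_bias_small[OF assms(1), of "\<epsilon> / 2" x] assms(5) by auto
  have nx: "norm x + 1 > 0" by (simp add: add_nonneg_pos)
  \<comment> \<open>Chosen so that |K e|^2 \<le> \<beta> (|x| + 1) \<theta> together with (\<tau> -
    1) d < |K e| gives d < g sqrt \<beta>.\<close>
  define \<theta> where "\<theta> = (\<tau> - 1)\<^sup>2 * g\<^sup>2 / (norm x + 1)"
  have "\<theta> > 0" using assms nx \<open>g > 0\<close> by (simp add: \<theta>_def)
  obtain d2 where d2: "d2 > 0"
    "\<And>\<alpha>. \<alpha> > 0 \<Longrightarrow> norm (K (tikhonov_bias K \<alpha> x)) \<le> d2 \<Longrightarrow> norm (tikhonov_bias K \<alpha> x) \<le> \<theta>"
    using tikhonov_bias_small[OF assms(1) \<open>\<theta> > 0\<close>, of x] by auto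
  define d0 where "d0 = min (d1 / (1 + 3 * \<tau>)) (min g (g * d2 / (norm x + 1)))"
  have "d0 > 0" using assms d1 d2 \<open>g > 0\<close> nx by (simp add: d0_def)
  moreover have "norm (tikhonov K (discrepancy_alpha K \<tau> q d z) z - x) < \<epsilon>"
    if "0 < d" "d < d0" and z: "norm (z - K x) \<le> (1 + \<tau>) * d" for d z
  proof -
    define \<alpha> where "\<alpha> = discrepancy_alpha K \<tau> q d z"
    note * = discrepancy_alpha_cases[OF assms(2-4) that(1) z, folded \<alpha>_def]
    have "(1 + 3 * \<tau>) * d \<le> d1"
      using that(2) assms(2) by (simp add: d0_def field_simps)
    hence bias: "norm (tikhonov_bias K \<alpha> x) \<le> \<epsilon> / 2" using d1(2)[OF *(1)] *(3) by linarith
    have "d * sqrt q < g * sqrt \<alpha>"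
      using *(4)
    proof (elim disjE exE conjE)
      assume "\<alpha> = 1"
      have "d * sqrt q \<le> d * 1" using assms that by (intro mult_left_mono) auto
      thus ?thesis using that(2) \<open>\<alpha> = 1\<close> by (simp add: d0_def)
    next
      fix \<beta> assume \<beta>: "\<alpha> = q * \<beta>" "0 < \<beta>" "(\<tau> - 1) * d < norm (K (tikhonov_bias K \<beta> x))"
      let ?e = "tikhonov_bias K \<beta> x"
      have "d < g * sqrt \<beta>"
      proof (cases "norm (K ?e) \<le> d2")
        case True
        have "((\<tau> - 1) * d)\<^sup>2 < (norm (K ?e))\<^sup>2"
          using \<beta>(3) assms(2) that(1) by (intro power_strict_mono) auto
        also have "\<dots> \<le> \<beta> * (norm x * norm ?e)"
          by (rule norm_K_tikhonov_bias_power2_le[OF K \<beta>(2)])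
        also have "\<dots> \<le> \<beta> * ((norm x + 1) * \<theta>)"
          using d2(2)[OF \<beta>(2) True] \<beta>(2) by (intro mult_left_mono mult_mono) auto
        also have "\<dots> = (\<tau> - 1)\<^sup>2 * (g * sqrt \<beta>)\<^sup>2"
          using nx \<beta>(2) by (simp add: \<theta>_def power_mult_distrib)
        finally have "d\<^sup>2 < (g * sqrt \<beta>)\<^sup>2"
          using assms(2) by (simp add: power_mult_distrib)
        thus ?thesis by (rule power2_less_imp_less) (use \<open>g > 0\<close> \<beta>(2) in simp)
      next
        case False
        with norm_K_tikhonov_bias_le[OF K \<beta>(2), of x] have "d2 \<le> sqrt \<beta> * norm x" by linarith
        also have "\<dots> \<le> sqrt \<beta> * (norm x + 1)" using \<beta>(2) by (intro mult_left_mono) auto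
        finally have "d2 / (norm x + 1) \<le> sqrt \<beta>" using nx by (simp add: field_simps)
        hence "g * (d2 / (norm x + 1)) \<le> g * sqrt \<beta>" using \<open>g > 0\<close> by (intro mult_left_mono) auto
        moreover have "d < g * (d2 / (norm x + 1))" using that(2) by (simp add: d0_def)
        ultimately show ?thesis by linarith
      qed
      thus ?thesis using assms(3) by (simp add: \<beta>(1) real_sqrt_mult)
    qed
    hence "d * sqrt q < (\<epsilon> / (2 * (1 + \<tau>)) * sqrt \<alpha>) * sqrt q" by (simp add: g_def mult_ac)
    hence "d < \<epsilon> / (2 * (1 + \<tau>)) * sqrt \<alpha>"
      using assms(3) by (subst (asm) mult_less_cancel_right_pos) auto
    hence "(1 + \<tau>) * d / sqrt \<alpha> < \<epsilon> / 2"
      using assms(2) *(1) by (simp add: field_simps)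
    moreover have "norm (z - K x) / sqrt \<alpha> \<le> (1 + \<tau>) * d / sqrt \<alpha>"
      using z *(1) by (intro divide_right_mono) auto
    ultimately show ?thesis
      using norm_tikhonov_error_le[OF *(1), of z x] bias unfolding \<alpha>_def[symmetric] by linarith
  qed
  ultimately show ?thesis by blast
qed

section \<open>Spectral projections and source conditions\<close>

abbreviation spectral_proj :: "real \<Rightarrow> 'x \<Rightarrow> 'x" where
  "spectral_proj t \<equiv> orth_proj (eigenspace (adjoint K \<circ> K) t)"

lemma inner_K_eq: "K u \<bullet> K h = (adjoint K \<circ> K) u \<bullet> h"
  using adjoint_inner[OF K, of h "K u"] by (simp add: inner_commute)

text \<open>Tested against all vectors \<open>h\<close>, the eigenvalue equation involves only
  \<open>K\<close>, whose continuity and linearity then give both claims.\<close>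

lemma eigenspace_closed_subspace:
  "closed (eigenspace (adjoint K \<circ> K) t)" "subspace (eigenspace (adjoint K \<circ> K) t)"
proof -
  have eq: "eigenspace (adjoint K \<circ> K) t = (\<Inter>h. {x. K x \<bullet> K h = t * (x \<bullet> h)})"
  proof (intro set_eqI iffI)
    fix x assume "x \<in> (\<Inter>h. {x. K x \<bullet> K h = t * (x \<bullet> h)})"
    hence "\<forall>h. (adjoint K \<circ> K) x \<bullet> h = (t *\<^sub>R x) \<bullet> h"
      by (simp del: o_apply flip: inner_K_eq)
    thus "x \<in> eigenspace (adjoint K \<circ> K) t"
      unfolding vector_eq_rdot by (simp add: eigenspace_def)
  next
    fix x assume "x \<in> eigenspace (adjoint K \<circ> K) t"
    thus "x \<in> (\<Inter>h. {x. K x \<bullet> K h = t * (x \<bullet> h)})"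
      by (simp add: inner_K_eq eigenspace_def)
  qed
  show "closed (eigenspace (adjoint K \<circ> K) t)" unfolding eq
    by (intro closed_INT ballI closed_Collect_eq continuous_intros K.continuous_on)
  show "subspace (eigenspace (adjoint K \<circ> K) t)" unfolding eq
    by (auto simp: subspace_def K.zero K.add K.scaleR inner_add_left distrib_left)
qed

lemma spectral_proj:
  shows "(adjoint K \<circ> K) (spectral_proj t w) = t *\<^sub>R spectral_proj t w"
    and "spectral_proj t w \<bullet> w = (norm (spectral_proj t w))\<^sup>2"
proof -
  note * = orth_proj_works[OF eigenspace_closed_subspace(1)[of t] eigenspace_closed_subspace(2), where x = w]
  from *(1) show "(adjoint K \<circ> K) (spectral_proj t w) = t *\<^sub>R spectral_proj t w"
    by (simp add: eigenspace_def)
  from *(2)[OF *(1)] show "spectral_proj t w \<bullet> w = (norm (spectral_proj t w))\<^sup>2"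
    by (simp add: inner_diff_right power2_norm_eq_inner)
qed

lemma spectral_proj_orthogonal:
  assumes "s \<noteq> t"
  shows "spectral_proj s w \<bullet> spectral_proj t w = 0"
proof -
  let ?P = "\<lambda>t. spectral_proj t w"
  have "s * (?P s \<bullet> ?P t) = K (?P s) \<bullet> K (?P t)"
    by (subst inner_K_eq, subst spectral_proj) simp
  also have "\<dots> = K (?P t) \<bullet> K (?P s)" by (rule inner_commute)
  also have "\<dots> = t * (?P s \<bullet> ?P t)"
    by (subst inner_K_eq, subst spectral_proj) (simp add: inner_commute)
  finally show ?thesis using assms by simp
qed

text \<open>The square of the norm of the sum \<open>?s\<close> of the projections equals both the
  left-hand side, by orthogonality, and \<open>?s \<bullet> w\<close>.\<close>

lemma spectral_bessel:
  assumes "finite F"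
  shows "(\<Sum>t\<in>F. (norm (spectral_proj t w))\<^sup>2) \<le> (norm w)\<^sup>2"
proof -
  let ?P = "\<lambda>t. spectral_proj t w"
  let ?s = "\<Sum>t\<in>F. ?P t"
  have "(norm ?s)\<^sup>2 = (\<Sum>t\<in>F. (norm (?P t))\<^sup>2)"
    using assms by (intro norm_sum_Pythagorean) (auto simp: pairwise_def orthogonal_def spectral_proj_orthogonal)
  also have "\<dots> = ?s \<bullet> w" by (simp add: inner_sum_left spectral_proj(2))
  finally have eq: "(norm ?s)\<^sup>2 = (\<Sum>t\<in>F. (norm (?P t))\<^sup>2)" "(norm ?s)\<^sup>2 = ?s \<bullet> w"
    by (simp_all add: inner_sum_left spectral_proj(2))
  have "norm ?s * norm ?s \<le> norm ?s * norm w"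
    using norm_cauchy_schwarz[of ?s w] eq(2) by (simp add: power2_eq_square)
  hence "norm ?s \<le> norm w" by (cases "?s = 0") auto
  thus ?thesis using eq(1) by (metis norm_ge_zero power_mono)
qed

text \<open>For a finite spectral sum the bias is explicit: its component at t carries the factor
  \<alpha> / (t + \<alpha>) * t powr (\<nu> / 2), as the normal equation confirms. Both claims
  become scalar inequalities in t, summed with Bessel's inequality. The second is an interpolation
  inequality obtained by splitting the spectrum at \<open>l\<close>: below it t powr \<nu> is at
  most l powr \<nu>, above it the factor t / l exceeds 1 and turns the square of e into that of K
  e.\<close>

lemma source_condition_finite:
  fixes w :: 'x
  assumes F: "finite F" "\<And>t. t \<in> F \<Longrightarrow> 0 < t" and \<nu>: "0 < \<nu>" "\<nu> \<le> 1" and \<alpha>: "0 < \<alpha>"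
  defines "x \<equiv> \<Sum>t\<in>F. (t powr (\<nu> / 2)) *\<^sub>R spectral_proj t w"
  shows "(norm (K (tikhonov_bias K \<alpha> x)))\<^sup>2 \<le> \<alpha> powr (\<nu> + 1) * (norm w)\<^sup>2"
    and "0 < l \<Longrightarrow>
      (norm (tikhonov_bias K \<alpha> x))\<^sup>2 \<le> l powr \<nu> * (norm w)\<^sup>2 + (norm (K (tikhonov_bias K \<alpha> x)))\<^sup>2 / l"
proof -
  let ?P = "\<lambda>t. spectral_proj t w"
  define c where "c t = \<alpha> / (t + \<alpha>) * t powr (\<nu> / 2)" for t
  define e where "e = (\<Sum>t\<in>F. c t *\<^sub>R ?P t)"
  have Ke: "K e \<bullet> K h = (\<Sum>t\<in>F. c t * (t * (?P t \<bullet> h)))" for h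
    unfolding e_def K.sum K.scaleR inner_sum_left inner_scaleR_left inner_K_eq spectral_proj ..
  have "tikhonov K \<alpha> (K x) = x - e"
  proof (rule tikhonov_eqI[OF K \<alpha>])
    fix h
    have "\<alpha> * (t powr (\<nu> / 2) - c t) = c t * t" if "t \<in> F" for t
      using F(2)[OF that] \<alpha> by (simp add: c_def field_simps)
    hence "\<alpha> * (t powr (\<nu> / 2) * (?P t \<bullet> h) - c t * (?P t \<bullet> h)) = c t * (t * (?P t \<bullet> h))" if "t \<in> F" for t
      using that by (simp flip: left_diff_distrib mult.assoc)
    hence "\<alpha> * ((x - e) \<bullet> h) = K e \<bullet> K h"
      unfolding Ke by (simp add: x_def e_def inner_diff_left inner_sum_left sum_distrib_left
          flip: sum_subtractf)
    thus "(K (x - e) - K x) \<bullet> K h + \<alpha> * ((x - e) \<bullet> h) = 0"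
      by (simp add: K.diff)
  qed
  hence bias: "tikhonov_bias K \<alpha> x = e" by (simp add: tikhonov_bias_def[OF K])
  have Pe: "?P t \<bullet> e = c t * (norm (?P t))\<^sup>2" if "t \<in> F" for t
  proof -
    have "?P t \<bullet> e = (\<Sum>s\<in>F. if s = t then c t * (norm (?P t))\<^sup>2 else 0)"
      unfolding e_def inner_sum_right
      by (intro sum.cong refl) (auto simp: spectral_proj_orthogonal power2_norm_eq_inner)
    thus ?thesis using F(1) that by simp
  qed
  have nKe: "(norm (K e))\<^sup>2 = (\<Sum>t\<in>F. t * (c t)\<^sup>2 * (norm (?P t))\<^sup>2)"
    unfolding power2_norm_eq_inner[of "K e"] Ke
    by (intro sum.cong refl) (simp add: Pe power2_eq_square)
  have ne: "(norm e)\<^sup>2 = (\<Sum>t\<in>F. (c t)\<^sup>2 * (norm (?P t))\<^sup>2)"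
  proof -
    have "(norm e)\<^sup>2 = (\<Sum>t\<in>F. c t * (?P t \<bullet> e))"
      unfolding power2_norm_eq_inner by (subst (1) e_def) (simp add: inner_sum_left)
    also have "\<dots> = (\<Sum>t\<in>F. (c t)\<^sup>2 * (norm (?P t))\<^sup>2)"
      by (intro sum.cong refl) (simp add: Pe power2_eq_square)
    finally show ?thesis .
  qed
  have c2: "(c t)\<^sup>2 = (\<alpha> / (t + \<alpha>))\<^sup>2 * t powr \<nu>" if "t \<in> F" for t
  proof -
    have "(t powr (\<nu> / 2))\<^sup>2 = t powr \<nu>"
      using F(2)[OF that] by (simp add: power2_eq_square flip: powr_add)
    thus ?thesis by (simp add: c_def power_mult_distrib power_divide)
  qed
  have quot: "(\<alpha> / (t + \<alpha>))\<^sup>2 \<le> 1" if "t \<in> F" for t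
    using F(2)[OF that] \<alpha> by (intro power_le_one) auto
  have "t * (c t)\<^sup>2 \<le> \<alpha> powr (\<nu> + 1)" if "t \<in> F" for t
  proof -
    have t: "t > 0" using F(2)[OF that] .
    \<comment> \<open>The bound \<nu> \<le> 1 enters here: for large t / \<alpha> the exponent \<nu>
      + 1 must not exceed 2. This is the saturation of Tikhonov regularisation.\<close>
    have "(t / \<alpha>) powr (\<nu> + 1) \<le> (1 + t / \<alpha>)\<^sup>2"
    proof (cases "t \<le> \<alpha>")
      case True
      hence "(t / \<alpha>) powr (\<nu> + 1) \<le> 1" using t \<alpha> \<nu> by (intro powr_le1) auto
      also have "\<dots> \<le> (1 + t / \<alpha>)\<^sup>2" using t \<alpha> by (intro one_le_power) auto
      finally show ?thesis .
    next
      case False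
      hence "(t / \<alpha>) powr (\<nu> + 1) \<le> (t / \<alpha>) powr 2" using t \<alpha> \<nu> by (intro powr_mono) auto
      also have "\<dots> = (t / \<alpha>)\<^sup>2" using t \<alpha> by simp
      also have "\<dots> \<le> (1 + t / \<alpha>)\<^sup>2" using t \<alpha> by (intro power_mono) auto
      finally show ?thesis .
    qed
    hence "\<alpha> powr (\<nu> + 1) * (t / \<alpha>) powr (\<nu> + 1) / (1 + t / \<alpha>)\<^sup>2 \<le> \<alpha> powr (\<nu> + 1)"
      using t \<alpha> by (simp add: divide_le_eq add_pos_pos)
    also have "\<alpha> powr (\<nu> + 1) * (t / \<alpha>) powr (\<nu> + 1) = t * t powr \<nu>"
      using t \<alpha> by (simp add: powr_divide powr_add)
    also have "t * t powr \<nu> / (1 + t / \<alpha>)\<^sup>2 = t * ((\<alpha> / (t + \<alpha>))\<^sup>2 * t powr \<nu>)"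
    proof -
      have "1 + t / \<alpha> = (t + \<alpha>) / \<alpha>" using \<alpha> by (simp add: field_simps)
      thus ?thesis by (simp add: power_divide)
    qed
    finally show ?thesis by (simp add: c2[OF that])
  qed
  hence "(norm (K e))\<^sup>2 \<le> (\<Sum>t\<in>F. \<alpha> powr (\<nu> + 1) * (norm (?P t))\<^sup>2)"
    unfolding nKe by (intro sum_mono mult_right_mono) auto
  also have "\<dots> \<le> \<alpha> powr (\<nu> + 1) * (norm w)\<^sup>2"
    unfolding sum_distrib_left[symmetric] by (intro mult_left_mono spectral_bessel F) auto
  finally show "(norm (K (tikhonov_bias K \<alpha> x)))\<^sup>2 \<le> \<alpha> powr (\<nu> + 1) * (norm w)\<^sup>2"
    unfolding bias .
  assume l: "0 < l"
  have "(c t)\<^sup>2 \<le> l powr \<nu> + t * (c t)\<^sup>2 / l" if "t \<in> F" for t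
  proof (cases "t \<le> l")
    case True
    have "(c t)\<^sup>2 \<le> 1 * l powr \<nu>" unfolding c2[OF that]
      using quot[OF that] True F(2)[OF that] \<nu> by (intro mult_mono powr_mono2) auto
    moreover have "0 \<le> t * (c t)\<^sup>2 / l" using F(2)[OF that] l by simp
    ultimately show ?thesis by linarith
  next
    case False
    hence "1 * (c t)\<^sup>2 \<le> (t / l) * (c t)\<^sup>2" using l by (intro mult_right_mono) auto
    thus ?thesis by (simp add: add_increasing)
  qed
  hence "(norm e)\<^sup>2 \<le> (\<Sum>t\<in>F. (l powr \<nu> + t * (c t)\<^sup>2 / l) * (norm (?P t))\<^sup>2)"
    unfolding ne by (intro sum_mono mult_right_mono) auto
  also have "\<dots> = l powr \<nu> * (\<Sum>t\<in>F. (norm (?P t))\<^sup>2) + (norm (K e))\<^sup>2 / l"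
    unfolding nKe by (simp add: distrib_right sum.distrib sum_distrib_left sum_divide_distrib)
  also have "\<dots> \<le> l powr \<nu> * (norm w)\<^sup>2 + (norm (K e))\<^sup>2 / l"
    using spectral_bessel[OF F(1), of w] by (intro add_right_mono mult_left_mono) auto
  finally show "(norm (tikhonov_bias K \<alpha> x))\<^sup>2
      \<le> l powr \<nu> * (norm w)\<^sup>2 + (norm (K (tikhonov_bias K \<alpha> x)))\<^sup>2 / l"
    unfolding bias .
qed

text \<open>Since the bias is a bounded linear function of \<open>x\<close>, both bounds are closed
  conditions on \<open>x\<close> and pass from the finite partial sums to the limit.\<close>

lemma source_condition:
  fixes w :: 'x
  assumes \<nu>: "0 < \<nu>" "\<nu> \<le> 1" and \<alpha>: "0 < \<alpha>"
  defines "x \<equiv> operator_powr (adjoint K \<circ> K) (\<nu> / 2) w"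
  shows "(norm (K (tikhonov_bias K \<alpha> x)))\<^sup>2 \<le> \<alpha> powr (\<nu> + 1) * (norm w)\<^sup>2"
    and "0 < l \<Longrightarrow>
      (norm (tikhonov_bias K \<alpha> x))\<^sup>2 \<le> l powr \<nu> * (norm w)\<^sup>2 + (norm (K (tikhonov_bias K \<alpha> x)))\<^sup>2 / l"
proof -
  let ?T = "{t. 0 < t \<and> eigenspace (adjoint K \<circ> K) t \<noteq> {0}}"
  let ?f = "\<lambda>t. (t powr (\<nu> / 2)) *\<^sub>R spectral_proj t w"
  interpret B: bounded_linear "tikhonov_bias K \<alpha>" by (rule tikhonov_bias_bounded_linear[OF K \<alpha>])
  have x: "x = infsum ?f ?T" by (simp add: x_def operator_powr_def)
  let ?G = "finite_subsets_at_top ?T"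
  have "(norm (K (tikhonov_bias K \<alpha> x)))\<^sup>2 \<le> \<alpha> powr (\<nu> + 1) * (norm w)\<^sup>2 \<and>
    (0 < l \<longrightarrow> (norm (tikhonov_bias K \<alpha> x))\<^sup>2 \<le> l powr \<nu> * (norm w)\<^sup>2 + (norm (K (tikhonov_bias K \<alpha> x)))\<^sup>2 / l)"
  proof (cases "?f summable_on ?T")
    case True
    hence "(?f has_sum x) ?T" unfolding x by (rule has_sum_infsum)
    hence lim: "(sum ?f \<longlongrightarrow> x) ?G" by (simp add: has_sum_def)
    have limB: "((\<lambda>F. (norm (tikhonov_bias K \<alpha> (sum ?f F)))\<^sup>2) \<longlongrightarrow> (norm (tikhonov_bias K \<alpha> x))\<^sup>2) ?G"
      by (intro tendsto_intros B.tendsto lim)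
    have limK: "((\<lambda>F. (norm (K (tikhonov_bias K \<alpha> (sum ?f F))))\<^sup>2) \<longlongrightarrow> (norm (K (tikhonov_bias K \<alpha> x)))\<^sup>2) ?G"
      by (intro tendsto_intros B.tendsto K.tendsto lim)
    have ev: "\<forall>\<^sub>F F in ?G. finite F \<and> F \<subseteq> ?T"
      by (rule eventually_finite_subsets_at_top_weakI) auto
    have 1: "(norm (K (tikhonov_bias K \<alpha> x)))\<^sup>2 \<le> \<alpha> powr (\<nu> + 1) * (norm w)\<^sup>2"
    proof (rule tendsto_upperbound[OF limK])
      show "\<forall>\<^sub>F F in ?G. (norm (K (tikhonov_bias K \<alpha> (sum ?f F))))\<^sup>2 \<le> \<alpha> powr (\<nu> + 1) * (norm w)\<^sup>2"
        using ev by (rule eventually_mono) (intro source_condition_finite \<nu> \<alpha>, auto)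
    qed simp
    have 2: "(norm (tikhonov_bias K \<alpha> x))\<^sup>2 \<le> l powr \<nu> * (norm w)\<^sup>2 + (norm (K (tikhonov_bias K \<alpha> x)))\<^sup>2 / l"
      if l: "0 < l"
    proof (rule tendsto_le[OF _ _ limB])
      show "((\<lambda>F. l powr \<nu> * (norm w)\<^sup>2 + (norm (K (tikhonov_bias K \<alpha> (sum ?f F))))\<^sup>2 / l)
        \<longlongrightarrow> l powr \<nu> * (norm w)\<^sup>2 + (norm (K (tikhonov_bias K \<alpha> x)))\<^sup>2 / l) ?G"
        using l by (intro tendsto_intros limK) auto
      show "\<forall>\<^sub>F F in ?G. (norm (tikhonov_bias K \<alpha> (sum ?f F)))\<^sup>2
          \<le> l powr \<nu> * (norm w)\<^sup>2 + (norm (K (tikhonov_bias K \<alpha> (sum ?f F))))\<^sup>2 / l"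
        using ev by (rule eventually_mono) (intro source_condition_finite \<nu> \<alpha> l, auto)
    qed simp
    show ?thesis using 1 2 by blast
  next
    \<comment> \<open>\<open>infsum\<close> of a family that is not summable is 0 by convention, and
      for x = 0 the bounds are trivial.\<close>
    case False
    hence "x = 0" unfolding x by (rule infsum_not_exists)
    thus ?thesis using \<nu> \<alpha> by (auto simp: B.zero K.zero)
  qed
  thus "(norm (K (tikhonov_bias K \<alpha> x)))\<^sup>2 \<le> \<alpha> powr (\<nu> + 1) * (norm w)\<^sup>2"
    and "0 < l \<Longrightarrow>
      (norm (tikhonov_bias K \<alpha> x))\<^sup>2 \<le> l powr \<nu> * (norm w)\<^sup>2 + (norm (K (tikhonov_bias K \<alpha> x)))\<^sup>2 / l"
    by auto
qed

text \<open>The bias is bounded by interpolating between the source condition and |K e| \<le> (1 + 3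
  \<tau>) d. For the data error, the lower bound on |K e| at \<beta> = \<alpha> / q and the first
  claim of \<open>source_condition\<close> bound sqrt \<alpha> below by a multiple of (d / \<rho>)
  powr p, where p = 1 / (\<nu> + 1). Both contributions are multiples of B, with factors that depend
  on \<tau>, q and \<nu> only.\<close>

theorem tikhonov_discrepancy_rate:
  assumes \<tau>: "1 < \<tau>" and q: "0 < q" "q < 1" and \<nu>: "0 < \<nu>" "\<nu> \<le> 1"
  shows "\<exists>L. \<forall>\<rho>>0. \<forall>w x. norm w \<le> \<rho> \<longrightarrow> x = operator_powr (adjoint K \<circ> K) (\<nu> / 2) w \<longrightarrow>
    (\<forall>d z. 0 < d \<longrightarrow> d \<le> \<rho> \<longrightarrow> norm (z - K x) \<le> (1 + \<tau>) * d \<longrightarrow>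
      norm (tikhonov K (discrepancy_alpha K \<tau> q d z) z - x)
        \<le> L * \<rho> powr (1 / (\<nu> + 1)) * d powr (\<nu> / (\<nu> + 1)))"
proof -
  define p where "p = 1 / (\<nu> + 1)"
  have p: "0 < p" "p < 1" "\<nu> / (\<nu> + 1) = 1 - p" "(\<nu> + 1) * p = 1"
    using \<nu> by (auto simp: p_def field_simps)
  \<comment> \<open>The factor sqrt q comes from \<alpha> = q \<beta>; the minimum with 1 covers
    \<alpha> = 1, where d \<le> \<rho> is used.\<close>
  define g where "g = sqrt q * min 1 ((\<tau> - 1) powr p)"
  have "g > 0" using \<tau> q by (simp add: g_def)
  define L where "L = sqrt (1 + (1 + 3 * \<tau>)\<^sup>2) + (1 + \<tau>) / g"
  have "norm (tikhonov K (discrepancy_alpha K \<tau> q d z) z - x) \<le> L * \<rho> powr p * d powr (1 - p)"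
    if "\<rho> > 0" and w: "norm w \<le> \<rho>" and x: "x = operator_powr (adjoint K \<circ> K) (\<nu> / 2) w"
      and d: "0 < d" "d \<le> \<rho>" and z: "norm (z - K x) \<le> (1 + \<tau>) * d" for \<rho> w x d z
  proof -
    define \<alpha> where "\<alpha> = discrepancy_alpha K \<tau> q d z"
    note * = discrepancy_alpha_cases[OF \<tau> q d(1) z, folded \<alpha>_def]
    have w2: "(norm w)\<^sup>2 \<le> \<rho>\<^sup>2" using w by (intro power_mono) auto
    define B where "B = \<rho> powr p * d powr (1 - p)"
    have "B > 0" using d \<open>\<rho> > 0\<close> by (simp add: B_def)
    \<comment> \<open>The choice of \<open>l\<close> balances the two terms of the interpolation inequality.\<close>
    have bias: "norm (tikhonov_bias K \<alpha> x) \<le> sqrt (1 + (1 + 3 * \<tau>)\<^sup>2) * B"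
    proof (rule power2_le_imp_le)
      define l where "l = (d / \<rho>) powr (2 * p)"
      have "l > 0" using d \<open>\<rho> > 0\<close> by (simp add: l_def)
      have l1: "l powr \<nu> * \<rho>\<^sup>2 = B\<^sup>2"
      proof -
        have "2 * p * \<nu> = 2 - 2 * p" using p(4) by (simp add: algebra_simps)
        hence "l powr \<nu> * \<rho>\<^sup>2 = d powr (2 - 2 * p) / \<rho> powr (2 - 2 * p) * \<rho> powr 2"
          using d \<open>\<rho> > 0\<close> by (simp add: l_def powr_powr powr_divide)
        also have "\<dots> = d powr (2 - 2 * p) * \<rho> powr (2 * p)"
          using \<open>\<rho> > 0\<close> by (simp add: powr_diff)
        also have "\<dots> = B\<^sup>2" by (simp add: B_def power2_eq_square algebra_simps flip: powr_add)
        finally show ?thesis .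
      qed
      have l2: "d\<^sup>2 / l = B\<^sup>2"
      proof -
        have "d\<^sup>2 / l = d powr 2 * \<rho> powr (2 * p) / d powr (2 * p)"
          using d \<open>\<rho> > 0\<close> by (simp add: l_def powr_divide)
        also have "\<dots> = d powr (2 - 2 * p) * \<rho> powr (2 * p)"
          by (simp add: powr_diff)
        also have "\<dots> = B\<^sup>2" by (simp add: B_def power2_eq_square algebra_simps flip: powr_add)
        finally show ?thesis .
      qed
      have "(norm (tikhonov_bias K \<alpha> x))\<^sup>2
          \<le> l powr \<nu> * (norm w)\<^sup>2 + (norm (K (tikhonov_bias K \<alpha> x)))\<^sup>2 / l"
        unfolding x by (rule source_condition(2)[OF \<nu> *(1) \<open>l > 0\<close>])
      also have "\<dots> \<le> l powr \<nu> * \<rho>\<^sup>2 + ((1 + 3 * \<tau>) * d)\<^sup>2 / l"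
        using *(3) w \<open>l > 0\<close> by (intro add_mono mult_left_mono divide_right_mono power_mono) auto
      also have "\<dots> = (1 + (1 + 3 * \<tau>)\<^sup>2) * B\<^sup>2"
        unfolding l1 power_mult_distrib times_divide_eq_right[symmetric] l2 by (simp add: algebra_simps)
      also have "\<dots> = (sqrt (1 + (1 + 3 * \<tau>)\<^sup>2) * B)\<^sup>2" by (simp add: power_mult_distrib)
      finally show "(norm (tikhonov_bias K \<alpha> x))\<^sup>2 \<le> (sqrt (1 + (1 + 3 * \<tau>)\<^sup>2) * B)\<^sup>2" .
    qed (use \<open>B > 0\<close> in simp)
    have "g * (d / \<rho>) powr p \<le> sqrt \<alpha>"
      using *(4)
    proof (elim disjE exE conjE)
      assume "\<alpha> = 1"
      have "(d / \<rho>) powr p \<le> 1" using d \<open>\<rho> > 0\<close> p by (intro powr_le1) auto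
      moreover have "g \<le> 1 * 1" unfolding g_def using q by (intro mult_mono) auto
      ultimately have "g * (d / \<rho>) powr p \<le> 1 * 1" using \<open>g > 0\<close> by (intro mult_mono) auto
      thus ?thesis using \<open>\<alpha> = 1\<close> by simp
    next
      fix \<beta> assume \<beta>: "\<alpha> = q * \<beta>" "0 < \<beta>" "(\<tau> - 1) * d < norm (K (tikhonov_bias K \<beta> x))"
      have "((\<tau> - 1) * d)\<^sup>2 \<le> (norm (K (tikhonov_bias K \<beta> x)))\<^sup>2"
        using \<beta>(3) \<tau> d by (intro power_mono) auto
      also have "\<dots> \<le> \<beta> powr (\<nu> + 1) * (norm w)\<^sup>2"
        unfolding x by (rule source_condition(1)[OF \<nu> \<beta>(2)])
      also have "\<dots> \<le> \<beta> powr (\<nu> + 1) * \<rho>\<^sup>2" by (intro mult_left_mono w2) auto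
      finally have "((\<tau> - 1) * (d / \<rho>))\<^sup>2 \<le> \<beta> powr (\<nu> + 1)"
        using \<open>\<rho> > 0\<close> by (simp add: power_mult_distrib power_divide field_simps)
      \<comment> \<open>Because (\<nu> + 1) p = 1, the power p / 2 turns the right-hand side into
        sqrt \<beta>.\<close>
      hence "(((\<tau> - 1) * (d / \<rho>)) powr 2) powr (p / 2) \<le> (\<beta> powr (\<nu> + 1)) powr (p / 2)"
        using p \<tau> d \<open>\<rho> > 0\<close> by (intro powr_mono2) auto
      hence "((\<tau> - 1) * (d / \<rho>)) powr p \<le> \<beta> powr ((\<nu> + 1) * p / 2)"
        by (simp add: powr_powr)
      also have "\<dots> = sqrt \<beta>" using \<beta>(2) by (simp add: p(4) powr_half_sqrt)
      finally have "sqrt q * (((\<tau> - 1) * (d / \<rho>)) powr p) \<le> sqrt q * sqrt \<beta>"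
        using q by (intro mult_left_mono) auto
      moreover have "g * (d / \<rho>) powr p \<le> sqrt q * (\<tau> - 1) powr p * (d / \<rho>) powr p"
        unfolding g_def using q by (intro mult_right_mono mult_left_mono) auto
      moreover have "((\<tau> - 1) * (d / \<rho>)) powr p = (\<tau> - 1) powr p * (d / \<rho>) powr p"
        by (rule powr_mult)
      ultimately have "g * (d / \<rho>) powr p \<le> sqrt q * sqrt \<beta>" by (simp only: mult.assoc)
      thus ?thesis by (simp add: \<beta>(1) real_sqrt_mult)
    qed
    moreover have pos: "(d / \<rho>) powr p > 0" using d \<open>\<rho> > 0\<close> by simp
    ultimately have "d / sqrt \<alpha> \<le> d / (g * (d / \<rho>) powr p)"
      using \<open>g > 0\<close> d *(1) by (intro divide_left_mono) auto
    also have "d / (g * (d / \<rho>) powr p) = (d powr 1 / (d / \<rho>) powr p) / g" using d by simp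
    also have "d powr 1 / (d / \<rho>) powr p = B"
      using d \<open>\<rho> > 0\<close> by (simp only: powr_divide) (simp add: B_def powr_diff)
    finally have "d / sqrt \<alpha> \<le> B / g" .
    hence "(1 + \<tau>) * (d / sqrt \<alpha>) \<le> (1 + \<tau>) * (B / g)" using \<tau> by (intro mult_left_mono) auto
    moreover have "norm (z - K x) / sqrt \<alpha> \<le> (1 + \<tau>) * d / sqrt \<alpha>"
      using z *(1) by (intro divide_right_mono) auto
    ultimately have "norm (tikhonov K \<alpha> z - x) \<le> sqrt (1 + (1 + 3 * \<tau>)\<^sup>2) * B + (1 + \<tau>) * (B / g)"
      using norm_tikhonov_error_le[OF *(1), of z x] bias by simp
    also have "\<dots> = L * B" by (simp add: L_def algebra_simps)
    finally show ?thesis by (simp add: \<alpha>_def B_def mult.assoc)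
  qed
  thus ?thesis unfolding p(3) p_def[symmetric] by blast
qed

end

section \<open>Sums of independent and identically distributed variables\<close>

definition clip :: "real \<Rightarrow> real \<Rightarrow> real" where
  "clip B u = max (- B) (min B u)"

lemma clip_lipschitz: "\<bar>clip B u - clip B v\<bar> \<le> \<bar>u - v\<bar>"
  by (auto simp: clip_def max_def min_def)

lemma abs_clip_le: "0 \<le> B \<Longrightarrow> \<bar>clip B u\<bar> \<le> B"
  by (auto simp: clip_def)

lemma abs_clip_le_abs: "0 \<le> B \<Longrightarrow> \<bar>clip B u\<bar> \<le> \<bar>u\<bar>"
  by (auto simp: clip_def)

lemma clip_measurable [measurable]: "clip B \<in> borel_measurable borel"
  unfolding clip_def by measurable

lemma clip_tendsto: "(\<lambda>n. clip (real n) u) \<longlonglongrightarrow> u"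
proof (rule tendsto_eventually)
  obtain N where "\<bar>u\<bar> \<le> real N" using real_arch_simple by blast
  thus "\<forall>\<^sub>F n in sequentially. clip (real n) u = u"
    by (auto simp: eventually_sequentially clip_def intro!: exI[of _ N])
qed

text \<open>Young's inequality with a weight: a small \<open>k\<close> keeps the coefficient of the
  main term \<open>a\<close> close to 1, at the price of a large one for the perturbation
  \<open>b\<close>.\<close>

lemma square_add_le:
  fixes a b k :: real
  assumes "k > 0"
  shows "(a + b)\<^sup>2 \<le> (1 + k) * a\<^sup>2 + (1 + 1 / k) * b\<^sup>2"
proof -
  have "0 \<le> (k * a - b)\<^sup>2 / k" using assms by simp
  also have "\<dots> = k * a\<^sup>2 - 2 * a * b + b\<^sup>2 / k"
    using assms by (simp add: power2_eq_square field_simps)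
  finally show ?thesis by (simp add: power2_sum algebra_simps)
qed

section \<open>Moments of sums of independent variables\<close>

context prob_space
begin

lemma bounded_integrable:
  fixes X :: "'a \<Rightarrow> real"
  assumes "X \<in> borel_measurable M" "\<And>\<omega>. \<bar>X \<omega>\<bar> \<le> b"
  shows "integrable M X"
  using assms by (intro integrable_const_bound[where B = b]) auto

lemma expectation_square_sum:
  fixes X :: "'i \<Rightarrow> 'a \<Rightarrow> real"
  assumes "finite I" "\<And>i j. i \<in> I \<Longrightarrow> j \<in> I \<Longrightarrow> integrable M (\<lambda>\<omega>. X i \<omega> * X j \<omega>)"
    and "\<And>i j. i \<in> I \<Longrightarrow> j \<in> I \<Longrightarrow> i \<noteq> j \<Longrightarrow> expectation (\<lambda>\<omega>. X i \<omega> * X j \<omega>) = 0"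
  shows "integrable M (\<lambda>\<omega>. (\<Sum>i\<in>I. X i \<omega>)\<^sup>2)"
    and "expectation (\<lambda>\<omega>. (\<Sum>i\<in>I. X i \<omega>)\<^sup>2) = (\<Sum>i\<in>I. expectation (\<lambda>\<omega>. (X i \<omega>)\<^sup>2))"
proof -
  have eq: "(\<Sum>i\<in>I. X i \<omega>)\<^sup>2 = (\<Sum>i\<in>I. \<Sum>j\<in>I. X i \<omega> * X j \<omega>)" for \<omega>
    by (simp add: power2_eq_square sum_product)
  show "integrable M (\<lambda>\<omega>. (\<Sum>i\<in>I. X i \<omega>)\<^sup>2)"
    unfolding eq using assms(2) by (intro Bochner_Integration.integrable_sum) auto
  have "expectation (\<lambda>\<omega>. (\<Sum>i\<in>I. X i \<omega>)\<^sup>2) = (\<Sum>i\<in>I. \<Sum>j\<in>I. expectation (\<lambda>\<omega>. X i \<omega> * X j \<omega>))"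
    unfolding eq using assms(2)
    by (subst Bochner_Integration.integral_sum; intro sum.cong refl Bochner_Integration.integrable_sum Bochner_Integration.integral_sum) auto
  also have "\<dots> = (\<Sum>i\<in>I. expectation (\<lambda>\<omega>. (X i \<omega>)\<^sup>2))"
  proof (rule sum.cong[OF refl])
    fix i assume i: "i \<in> I"
    have "(\<Sum>j\<in>I. expectation (\<lambda>\<omega>. X i \<omega> * X j \<omega>))
        = (\<Sum>j\<in>I. if j = i then expectation (\<lambda>\<omega>. (X i \<omega>)\<^sup>2) else 0)"
      using assms(3) i by (intro sum.cong refl) (auto simp: power2_eq_square)
    also have "\<dots> = expectation (\<lambda>\<omega>. (X i \<omega>)\<^sup>2)"
      using i assms(1) by simp
    finally show "(\<Sum>j\<in>I. expectation (\<lambda>\<omega>. X i \<omega> * X j \<omega>)) = expectation (\<lambda>\<omega>. (X i \<omega>)\<^sup>2)" .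
  qed
  finally show "expectation (\<lambda>\<omega>. (\<Sum>i\<in>I. X i \<omega>)\<^sup>2) = (\<Sum>i\<in>I. expectation (\<lambda>\<omega>. (X i \<omega>)\<^sup>2))" .
qed

text \<open>When one variable is added, all terms with a first power vanish by independence and zero
  mean. The fourth moment grows by at most 6 n b^4 + b^4, and 3 n^2 + 6 n + 1 \<le> 3 (n + 1)^2. The
  second moment is needed for this step, so both bounds are proved in one induction. The point is
  the growth n^2 instead of n^4.\<close>

lemma expectation_sum_powers_le:
  fixes X :: "'i \<Rightarrow> 'a \<Rightarrow> real"
  assumes "finite I" and "indep_vars (\<lambda>_. borel) X I"
    and bound: "\<And>i \<omega>. i \<in> I \<Longrightarrow> \<bar>X i \<omega>\<bar> \<le> b" and mean: "\<And>i. i \<in> I \<Longrightarrow> expectation (X i) = 0"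
  shows "expectation (\<lambda>\<omega>. (\<Sum>i\<in>I. X i \<omega>)\<^sup>2) \<le> real (card I) * b\<^sup>2
    \<and> expectation (\<lambda>\<omega>. (\<Sum>i\<in>I. X i \<omega>) ^ 4) \<le> 3 * (real (card I))\<^sup>2 * b ^ 4"
  using assms
proof (induction I rule: finite_induct)
  case (insert i I)
  let ?S = "\<lambda>\<omega>. \<Sum>i\<in>I. X i \<omega>"
  let ?n = "real (card I)"
  have IH: "expectation (\<lambda>\<omega>. (?S \<omega>)\<^sup>2) \<le> ?n * b\<^sup>2" "expectation (\<lambda>\<omega>. (?S \<omega>) ^ 4) \<le> 3 * ?n\<^sup>2 * b ^ 4"
    using insert.IH insert.prems indep_vars_subset[OF insert.prems(1), of I] by auto
  have X [measurable]: "X j \<in> borel_measurable M" if "j \<in> insert i I" for j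
    using insert.prems(1) that by (auto simp: indep_vars_def)
  have [measurable]: "X i \<in> borel_measurable M" by (rule X) simp
  have [measurable]: "?S \<in> borel_measurable M" by (intro borel_measurable_sum X) simp
  have Xb: "\<bar>X i \<omega>\<bar> \<le> b" for \<omega> using insert.prems by simp
  hence b0: "b \<ge> 0" by (meson abs_ge_zero order_trans)
  have Sb: "\<bar>?S \<omega>\<bar> \<le> ?n * b" for \<omega>
    using insert.prems(2) by (intro order_trans[OF sum_abs] sum_bounded_above) auto
  have prod_int: "integrable M (\<lambda>\<omega>. ?S \<omega> ^ k * X i \<omega> ^ l)" for k l
  proof (rule bounded_integrable)
    show "\<bar>?S \<omega> ^ k * X i \<omega> ^ l\<bar> \<le> (?n * b) ^ k * b ^ l" for \<omega>
      unfolding abs_mult power_abs using Xb Sb b0 by (intro mult_mono power_mono) auto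
  qed measurable
  have S_int: "integrable M (\<lambda>\<omega>. ?S \<omega> ^ k)" for k using prod_int[of k 0] by simp
  have X_int: "integrable M (\<lambda>\<omega>. X i \<omega> ^ k)" for k using prod_int[of 0 k] by simp
  have indep: "indep_var borel (X i) borel ?S"
    by (rule indep_vars_sum[OF insert.hyps insert.prems(1)])
  have prod_exp: "expectation (\<lambda>\<omega>. ?S \<omega> ^ k * X i \<omega> ^ l)
      = expectation (\<lambda>\<omega>. ?S \<omega> ^ k) * expectation (\<lambda>\<omega>. X i \<omega> ^ l)" for k l
  proof -
    have "indep_var borel ((\<lambda>u. u ^ l) \<circ> X i) borel ((\<lambda>u. u ^ k) \<circ> ?S)"
      by (rule indep_var_compose[OF indep]) auto
    from indep_var_lebesgue_integral[OF this] X_int S_int show ?thesis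
      by (simp add: comp_def mult.commute)
  qed
  have EX: "expectation (\<lambda>\<omega>. X i \<omega> ^ 1) = 0" using insert.prems(3) by simp
  have ES: "expectation (\<lambda>\<omega>. ?S \<omega> ^ 1) = 0"
  proof -
    have "expectation ?S = (\<Sum>j\<in>I. expectation (X j))"
      using insert.prems(2) by (intro Bochner_Integration.integral_sum bounded_integrable[OF X, where b = b]) auto
    thus ?thesis using insert.prems(3) by simp
  qed
  have EXk: "expectation (\<lambda>\<omega>. X i \<omega> ^ k) \<le> b ^ k" if "even k" for k
  proof -
    have "expectation (\<lambda>\<omega>. X i \<omega> ^ k) \<le> expectation (\<lambda>\<omega>. b ^ k)"
      using that by (intro integral_mono X_int power_mono_even order_trans[OF Xb abs_ge_self]) auto
    thus ?thesis by (simp add: prob_space)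
  qed
  have sum_eq: "(\<Sum>j\<in>insert i I. X j \<omega>) = ?S \<omega> + X i \<omega>" for \<omega>
    using insert.hyps by simp
  have card: "real (card (insert i I)) = ?n + 1" using insert.hyps by simp
  have "expectation (\<lambda>\<omega>. (?S \<omega> + X i \<omega>)\<^sup>2)
      = expectation (\<lambda>\<omega>. ?S \<omega> ^ 2 + 2 * (?S \<omega> ^ 1 * X i \<omega> ^ 1) + X i \<omega> ^ 2)"
    by (intro Bochner_Integration.integral_cong refl) (simp add: power2_sum)
  also have "\<dots> = expectation (\<lambda>\<omega>. ?S \<omega> ^ 2) + expectation (\<lambda>\<omega>. X i \<omega> ^ 2)"
    using S_int[of 2] X_int[of 2] prod_int[of 1 1] prod_exp[of 1 1] EX by simp
  also have "\<dots> \<le> (?n + 1) * b\<^sup>2" using IH(1) EXk[of 2] by (simp add: distrib_right)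
  finally have 2: "expectation (\<lambda>\<omega>. (?S \<omega> + X i \<omega>)\<^sup>2) \<le> (?n + 1) * b\<^sup>2" .
  have "expectation (\<lambda>\<omega>. (?S \<omega> + X i \<omega>) ^ 4)
      = expectation (\<lambda>\<omega>. ?S \<omega> ^ 4 + 4 * (?S \<omega> ^ 3 * X i \<omega> ^ 1) + 6 * (?S \<omega> ^ 2 * X i \<omega> ^ 2)
          + 4 * (?S \<omega> ^ 1 * X i \<omega> ^ 3) + X i \<omega> ^ 4)"
    by (intro Bochner_Integration.integral_cong refl) (simp add: power4_eq_xxxx power2_eq_square power3_eq_cube algebra_simps)
  also have "\<dots> = expectation (\<lambda>\<omega>. ?S \<omega> ^ 4)
      + 6 * (expectation (\<lambda>\<omega>. ?S \<omega> ^ 2) * expectation (\<lambda>\<omega>. X i \<omega> ^ 2)) + expectation (\<lambda>\<omega>. X i \<omega> ^ 4)"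
    using S_int[of 4] X_int[of 4] prod_int[of 3 1] prod_exp[of 3 1] prod_int[of 2 2] prod_exp[of 2 2]
      prod_int[of 1 3] prod_exp[of 1 3] EX ES by simp
  also have "\<dots> \<le> 3 * ?n\<^sup>2 * b ^ 4 + 6 * ((?n * b\<^sup>2) * b\<^sup>2) + b ^ 4"
    using IH EXk[of 2] EXk[of 4] b0 by (intro add_mono mult_left_mono mult_mono) auto
  also have "\<dots> = (3 * ?n\<^sup>2 + 6 * ?n + 1) * b ^ 4"
    by (simp add: algebra_simps power2_eq_square power4_eq_xxxx)
  also have "\<dots> \<le> (3 * (?n + 1)\<^sup>2) * b ^ 4"
    by (intro mult_right_mono) (auto simp: power2_eq_square algebra_simps)
  finally show ?case using 2 unfolding sum_eq card by simp
qed simp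

end

text \<open>The index (i, j) stands for repetition i of functional j. With a single family over
  pairs, the independence of columns, of single entries and of the past from the present are
  instances of one assumption.\<close>

locale centred_iid = prob_space +
  fixes x :: "nat \<times> nat \<Rightarrow> 'a \<Rightarrow> real"
  assumes indep: "indep_vars (\<lambda>_. borel) x UNIV"
    and ident: "distr M borel (x i) = distr M borel (x (0, 0))"
    and square_integrable: "integrable M (\<lambda>\<omega>. (x i \<omega>)\<^sup>2)"
    and mean: "expectation (x i) = 0"
begin

abbreviation v :: real where "v \<equiv> expectation (\<lambda>\<omega>. (x (0, 0) \<omega>)\<^sup>2)"

lemma x_measurable [measurable]: "x i \<in> borel_measurable M"
  using indep unfolding indep_vars_def by blast

lemma x_integrable: "integrable M (x i)"
  by (rule square_integrable_imp_integrable[OF _ square_integrable]) simp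

lemma expectation_ident:
  fixes g :: "real \<Rightarrow> real"
  assumes [measurable]: "g \<in> borel_measurable borel"
  shows "expectation (\<lambda>\<omega>. g (x i \<omega>)) = expectation (\<lambda>\<omega>. g (x (0, 0) \<omega>))"
proof -
  have "expectation (\<lambda>\<omega>. g (x i \<omega>)) = integral\<^sup>L (distr M borel (x i)) g" for i
    by (subst integral_distr) auto
  thus ?thesis using ident by metis
qed

lemma indep_block_sums:
  fixes g h :: "real \<Rightarrow> real" and B :: "'j \<Rightarrow> (nat \<times> nat) set"
  assumes "disjoint_family_on B J" and [measurable]: "g \<in> borel_measurable borel" "h \<in> borel_measurable borel"
  shows "indep_vars (\<lambda>_. borel) (\<lambda>j \<omega>. h (\<Sum>i\<in>B j. g (x i \<omega>))) J"
proof -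
  have "indep_vars (\<lambda>j. PiM (B j) (\<lambda>_. borel)) (\<lambda>j \<omega>. restrict (\<lambda>i. x i \<omega>) (B j)) J"
    using assms(1) by (intro indep_vars_restrict[OF indep]) auto
  from indep_vars_compose2[OF this, where Y = "\<lambda>j y. h (\<Sum>i\<in>B j. g (y i))" and N = "\<lambda>_. borel"]
  show ?thesis by (simp cong: sum.cong)
qed

lemma indep_fun:
  fixes g :: "real \<Rightarrow> real"
  assumes "g \<in> borel_measurable borel"
  shows "indep_vars (\<lambda>_. borel) (\<lambda>i \<omega>. g (x i \<omega>)) I"
  by (rule indep_vars_subset[OF indep_vars_compose2[OF indep]]) (use assms in auto)

text \<open>Since \<open>x\<close> is only square integrable, moments of fourth order are available only for a bounded
  function \<open>f\<close> of \<open>x\<close>. Being a contraction, \<open>f\<close> does not increase sample variances.\<close>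

lemma truncation:
  assumes "\<theta> > 0"
  obtains f :: "real \<Rightarrow> real" and b where "f \<in> borel_measurable borel" "b > 0" "\<And>u. \<bar>f u\<bar> \<le> b"
    "\<And>u u'. \<bar>f u - f u'\<bar> \<le> \<bar>u - u'\<bar>" "\<And>i. expectation (\<lambda>\<omega>. f (x i \<omega>)) = 0"
    "expectation (\<lambda>\<omega>. (f (x (0, 0) \<omega>))\<^sup>2) \<le> v" "v - \<theta> \<le> expectation (\<lambda>\<omega>. (f (x (0, 0) \<omega>))\<^sup>2)"
    "expectation (\<lambda>\<omega>. (x (0, 0) \<omega> - f (x (0, 0) \<omega>))\<^sup>2) \<le> \<theta>"
proof -
  let ?x = "x (0, 0)"
  define \<mu> where "\<mu> n = expectation (\<lambda>\<omega>. clip (real n) (?x \<omega>))" for n :: nat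
  have "\<mu> \<longlonglongrightarrow> expectation ?x" unfolding \<mu>_def
    by (rule integral_dominated_convergence[where w = "\<lambda>\<omega>. \<bar>?x \<omega>\<bar>"])
       (auto intro!: clip_tendsto abs_clip_le_abs integrable_abs x_integrable)
  hence \<mu>0: "(\<lambda>n. (\<mu> n)\<^sup>2) \<longlonglongrightarrow> 0\<^sup>2" unfolding mean by (intro tendsto_intros)
  have sq_le: "(clip (real n) u)\<^sup>2 \<le> u\<^sup>2" for n u
    using abs_clip_le_abs[of "real n" u] by (simp add: abs_le_square_iff)
  have c2: "(\<lambda>n. expectation (\<lambda>\<omega>. (clip (real n) (?x \<omega>))\<^sup>2)) \<longlonglongrightarrow> v"
    by (rule integral_dominated_convergence[where w = "\<lambda>\<omega>. (?x \<omega>)\<^sup>2"])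
       (auto intro!: tendsto_intros clip_tendsto square_integrable sq_le)
  have diff_le: "(u - clip (real n) u)\<^sup>2 \<le> u\<^sup>2" for n u
    unfolding abs_le_square_iff[symmetric] by (auto simp: clip_def)
  have r2: "(\<lambda>n. expectation (\<lambda>\<omega>. (?x \<omega> - clip (real n) (?x \<omega>))\<^sup>2)) \<longlonglongrightarrow> expectation (\<lambda>\<omega>. 0)"
  proof (rule integral_dominated_convergence[where w = "\<lambda>\<omega>. (?x \<omega>)\<^sup>2"])
    have "(\<lambda>n. (?x \<omega> - clip (real n) (?x \<omega>))\<^sup>2) \<longlonglongrightarrow> (?x \<omega> - ?x \<omega>)\<^sup>2" for \<omega>
      by (intro tendsto_intros clip_tendsto)
    thus "AE \<omega> in M. (\<lambda>n. (?x \<omega> - clip (real n) (?x \<omega>))\<^sup>2) \<longlonglongrightarrow> 0" by simp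
  qed (auto intro!: square_integrable diff_le)
  \<comment> \<open>The variance of the clipped and centred variable falls short of \<open>v\<close>
    for two reasons, the clipping and the subtracted squared mean; each may cost \<theta> /
    2.\<close>
  have "\<forall>\<^sub>F n in sequentially. (\<mu> n)\<^sup>2 < \<theta> / 2"
    using \<mu>0 assms by (intro order_tendstoD(2)[where y = "0\<^sup>2"]) auto
  moreover have "\<forall>\<^sub>F n in sequentially. v - \<theta> / 2 < expectation (\<lambda>\<omega>. (clip (real n) (?x \<omega>))\<^sup>2)"
    using c2 assms by (intro order_tendstoD(1)) auto
  moreover have "\<forall>\<^sub>F n in sequentially. expectation (\<lambda>\<omega>. (?x \<omega> - clip (real n) (?x \<omega>))\<^sup>2) < \<theta>"
    using r2 assms by (intro order_tendstoD(2)) auto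
  ultimately have "\<forall>\<^sub>F n in sequentially. (\<mu> n)\<^sup>2 < \<theta> / 2
      \<and> v - \<theta> / 2 < expectation (\<lambda>\<omega>. (clip (real n) (?x \<omega>))\<^sup>2)
      \<and> expectation (\<lambda>\<omega>. (?x \<omega> - clip (real n) (?x \<omega>))\<^sup>2) < \<theta>"
    by eventually_elim blast
  then obtain n where n: "(\<mu> n)\<^sup>2 < \<theta> / 2"
      "v - \<theta> / 2 < expectation (\<lambda>\<omega>. (clip (real n) (?x \<omega>))\<^sup>2)"
      "expectation (\<lambda>\<omega>. (?x \<omega> - clip (real n) (?x \<omega>))\<^sup>2) < \<theta>"
    using eventually_happens by fastforce
  define f where "f u = clip (real n) u - \<mu> n" for u
  have fm: "f \<in> borel_measurable borel" unfolding f_def by measurable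
  have clip_int: "integrable M (\<lambda>\<omega>. clip (real n) (x i \<omega>))" for i
    by (rule bounded_integrable[where b = "real n"]) (auto intro!: abs_clip_le)
  have clip2_int: "integrable M (\<lambda>\<omega>. (clip (real n) (?x \<omega>))\<^sup>2)"
    by (rule Bochner_Integration.integrable_bound[OF square_integrable]) (auto intro!: sq_le)
  have diff2_int: "integrable M (\<lambda>\<omega>. (?x \<omega> - clip (real n) (?x \<omega>))\<^sup>2)"
    by (rule Bochner_Integration.integrable_bound[OF square_integrable]) (auto intro!: diff_le)
  have Ef: "expectation (\<lambda>\<omega>. f (x i \<omega>)) = 0" for i
    by (subst expectation_ident[OF fm])
       (use clip_int in \<open>simp add: f_def \<mu>_def[symmetric] prob_space\<close>)
  have "expectation (\<lambda>\<omega>. (f (?x \<omega>))\<^sup>2)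
     = expectation (\<lambda>\<omega>. (clip (real n) (?x \<omega>))\<^sup>2 - 2 * \<mu> n * clip (real n) (?x \<omega>) + (\<mu> n)\<^sup>2)"
    by (simp add: f_def power2_diff algebra_simps)
  also have "\<dots> = expectation (\<lambda>\<omega>. (clip (real n) (?x \<omega>))\<^sup>2) - (\<mu> n)\<^sup>2"
    using clip_int clip2_int by (simp add: \<mu>_def[symmetric] prob_space power2_eq_square)
  finally have f2: "expectation (\<lambda>\<omega>. (f (?x \<omega>))\<^sup>2) = expectation (\<lambda>\<omega>. (clip (real n) (?x \<omega>))\<^sup>2) - (\<mu> n)\<^sup>2" .
  have "expectation (\<lambda>\<omega>. (?x \<omega> - f (?x \<omega>))\<^sup>2)
     = expectation (\<lambda>\<omega>. (?x \<omega> - clip (real n) (?x \<omega>))\<^sup>2 + 2 * \<mu> n * (?x \<omega> - clip (real n) (?x \<omega>)) + (\<mu> n)\<^sup>2)"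
    by (rule Bochner_Integration.integral_cong) (auto simp: f_def power2_eq_square algebra_simps)
  also have "\<dots> = expectation (\<lambda>\<omega>. (?x \<omega> - clip (real n) (?x \<omega>))\<^sup>2) - (\<mu> n)\<^sup>2"
    using clip_int diff2_int x_integrable
    by (simp add: \<mu>_def[symmetric] prob_space power2_eq_square mean)
  finally have fr: "expectation (\<lambda>\<omega>. (?x \<omega> - f (?x \<omega>))\<^sup>2) \<le> \<theta>"
    using n(3) zero_le_power2[of "\<mu> n"] by linarith
  have "expectation (\<lambda>\<omega>. (clip (real n) (?x \<omega>))\<^sup>2) \<le> v"
    by (intro integral_mono clip2_int square_integrable sq_le)
  hence "expectation (\<lambda>\<omega>. (f (?x \<omega>))\<^sup>2) \<le> v" using f2 zero_le_power2[of "\<mu> n"] by linarith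
  \<comment> \<open>The summand 1 makes the bound positive even if n = 0.\<close>
  moreover have "\<bar>f u\<bar> \<le> real n + \<bar>\<mu> n\<bar> + 1" for u
    using abs_clip_le[of "real n" u] by (simp add: f_def)
  moreover have "\<bar>f u - f u'\<bar> \<le> \<bar>u - u'\<bar>" for u u' using clip_lipschitz by (simp add: f_def)
  ultimately show ?thesis
    using that[of f "real n + \<bar>\<mu> n\<bar> + 1"] fm Ef f2 fr n(1,2) by simp
qed

text \<open>The centred squares of the block sums are independent, so their variances add; each
  variance is at most the fourth moment of a block sum, of order n^2. Chebyshev's inequality with
  \<open>t\<close> proportional to \<open>card J * n\<close> then gives a probability of order 1 /
  card J, whatever n is.\<close>

lemma block_sum_squares_upper:
  fixes b t :: real
  assumes f [measurable]: "f \<in> borel_measurable borel" and "b > 0" and fb: "\<And>u. \<bar>f u\<bar> \<le> b"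
    and mean_f: "\<And>i. expectation (\<lambda>\<omega>. f (x i \<omega>)) = 0"
    and J: "finite J" "J \<noteq> {}" and B: "\<And>j. j \<in> J \<Longrightarrow> finite (B j) \<and> card (B j) = n" "disjoint_family_on B J"
    and "n > 0" "t > 0"
  shows "prob {\<omega> \<in> space M. (\<Sum>j\<in>J. (\<Sum>i\<in>B j. f (x i \<omega>))\<^sup>2)
    \<ge> real (card J) * real n * expectation (\<lambda>\<omega>. (f (x (0, 0) \<omega>))\<^sup>2) + t}
    \<le> 3 * b ^ 4 * real (card J) * (real n)\<^sup>2 / t\<^sup>2"
proof -
  let ?s = "expectation (\<lambda>\<omega>. (f (x (0, 0) \<omega>))\<^sup>2)"
  define a where "a j \<omega> = (\<Sum>i\<in>B j. f (x i \<omega>))" for j \<omega>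
  have a_m [measurable]: "a j \<in> borel_measurable M" for j unfolding a_def by measurable
  have a_bound: "\<bar>a j \<omega>\<bar> \<le> n * b" if "j \<in> J" for j \<omega>
  proof -
    have "(\<Sum>i\<in>B j. \<bar>f (x i \<omega>)\<bar>) \<le> real (card (B j)) * b"
      by (rule sum_bounded_above) (rule fb)
    thus ?thesis unfolding a_def using B(1)[OF that] by (intro order_trans[OF sum_abs]) simp
  qed
  have a2_bound: "(a j \<omega>)\<^sup>2 \<le> (n * b)\<^sup>2" if "j \<in> J" for j \<omega>
    using a_bound[OF that, of \<omega>] \<open>b > 0\<close> by (simp add: abs_le_square_iff[symmetric] del: power_mult_distrib)
  have f_int: "integrable M (\<lambda>\<omega>. f (x i \<omega>) * f (x k \<omega>))" for i k
    by (rule bounded_integrable[where b = "b * b"])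
       (use fb \<open>b > 0\<close> in \<open>auto simp: abs_mult intro!: mult_mono\<close>)
  have f_int1: "integrable M (\<lambda>\<omega>. f (x i \<omega>))" for i
    by (rule bounded_integrable[where b = b]) (use fb in auto)
  have f_pair: "expectation (\<lambda>\<omega>. f (x i \<omega>) * f (x k \<omega>)) = 0" if "i \<noteq> k" for i k
  proof -
    have "indep_vars (\<lambda>_. borel) (\<lambda>i \<omega>. f (x i \<omega>)) {i, k}" by (rule indep_fun) measurable
    from indep_vars_lebesgue_integral[OF _ this] show ?thesis using that mean_f f_int1 by simp
  qed
  have a2_int: "integrable M (\<lambda>\<omega>. (a j \<omega>)\<^sup>2)" if "j \<in> J" for j
    by (rule bounded_integrable[where b = "(n * b)\<^sup>2"]) (use a2_bound[OF that] in auto)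
  have Ea2: "expectation (\<lambda>\<omega>. (a j \<omega>)\<^sup>2) = n * ?s" if "j \<in> J" for j
  proof -
    have "expectation (\<lambda>\<omega>. (a j \<omega>)\<^sup>2) = (\<Sum>i\<in>B j. expectation (\<lambda>\<omega>. (f (x i \<omega>))\<^sup>2))"
      unfolding a_def using B(1)[OF that] f_int f_pair by (intro expectation_square_sum) auto
    also have "\<dots> = (\<Sum>i\<in>B j. ?s)"
      by (intro sum.cong refl expectation_ident[where g = "\<lambda>u. (f u)\<^sup>2"]) measurable
    finally show ?thesis using B(1)[OF that] by simp
  qed
  have Ea4: "expectation (\<lambda>\<omega>. a j \<omega> ^ 4) \<le> 3 * (real n)\<^sup>2 * b ^ 4" if "j \<in> J" for j
  proof -
    have "indep_vars (\<lambda>_. borel) (\<lambda>i \<omega>. f (x i \<omega>)) (B j)" by (rule indep_fun) measurable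
    from expectation_sum_powers_le[OF _ this, of b] show ?thesis
      unfolding a_def using B(1)[OF that] fb mean_f by simp
  qed
  define c where "c j \<omega> = (a j \<omega>)\<^sup>2 - n * ?s" for j \<omega>
  have c_m [measurable]: "c j \<in> borel_measurable M" for j unfolding c_def by measurable
  have c_int: "integrable M (c j)" if "j \<in> J" for j unfolding c_def using a2_int[OF that] by simp
  have c_bound: "\<bar>c j \<omega>\<bar> \<le> (n * b)\<^sup>2 + n * \<bar>?s\<bar>" if "j \<in> J" for j \<omega>
    unfolding c_def using a2_bound[OF that] zero_le_power2[of "a j \<omega>"]
    by (intro order_trans[OF abs_triangle_ineq4] add_mono) (auto simp: abs_mult)
  have c_prod_int: "integrable M (\<lambda>\<omega>. c j \<omega> * c k \<omega>)" if "j \<in> J" "k \<in> J" for j k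
  proof (rule bounded_integrable[where b = "((n * b)\<^sup>2 + n * \<bar>?s\<bar>) * ((n * b)\<^sup>2 + n * \<bar>?s\<bar>)"])
    show "\<bar>c j \<omega> * c k \<omega>\<bar> \<le> ((n * b)\<^sup>2 + n * \<bar>?s\<bar>) * ((n * b)\<^sup>2 + n * \<bar>?s\<bar>)" for \<omega>
      unfolding abs_mult
      by (intro mult_mono c_bound that add_nonneg_nonneg mult_nonneg_nonneg) simp_all
  qed measurable
  have Ec: "expectation (c j) = 0" if "j \<in> J" for j
    unfolding c_def using a2_int[OF that] Ea2[OF that] by (simp add: prob_space)
  have c_pair: "expectation (\<lambda>\<omega>. c j \<omega> * c k \<omega>) = 0" if "j \<in> J" "k \<in> J" "j \<noteq> k" for j k
  proof -
    have "indep_vars (\<lambda>_. borel) (\<lambda>j \<omega>. (\<lambda>u. u\<^sup>2 - n * ?s) (\<Sum>i\<in>B j. f (x i \<omega>))) J"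
      by (rule indep_block_sums[OF B(2)]) measurable
    hence "indep_vars (\<lambda>_. borel) c {j, k}"
      unfolding c_def a_def by (rule indep_vars_subset) (use that in auto)
    from indep_vars_lebesgue_integral[OF _ this] show ?thesis using that Ec c_int by auto
  qed
  let ?C = "\<lambda>\<omega>. \<Sum>j\<in>J. c j \<omega>"
  have C2: "integrable M (\<lambda>\<omega>. (?C \<omega>)\<^sup>2)"
    "expectation (\<lambda>\<omega>. (?C \<omega>)\<^sup>2) = (\<Sum>j\<in>J. expectation (\<lambda>\<omega>. (c j \<omega>)\<^sup>2))"
    by (intro expectation_square_sum J c_prod_int c_pair; assumption)+
  have "expectation (\<lambda>\<omega>. (c j \<omega>)\<^sup>2) \<le> 3 * (real n)\<^sup>2 * b ^ 4" if "j \<in> J" for j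
  proof -
    have a4_int: "integrable M (\<lambda>\<omega>. a j \<omega> ^ 4)"
    proof (rule bounded_integrable[where b = "(n * b) ^ 4"])
      show "\<bar>a j \<omega> ^ 4\<bar> \<le> (n * b) ^ 4" for \<omega>
        unfolding power_abs by (intro power_mono a_bound that) auto
    qed measurable
    have "expectation (\<lambda>\<omega>. (c j \<omega>)\<^sup>2) = expectation (\<lambda>\<omega>. a j \<omega> ^ 4 - 2 * (n * ?s) * (a j \<omega>)\<^sup>2 + (n * ?s)\<^sup>2)"
      by (intro Bochner_Integration.integral_cong refl)
         (simp add: c_def power4_eq_xxxx power2_eq_square algebra_simps)
    also have "\<dots> = expectation (\<lambda>\<omega>. a j \<omega> ^ 4) - 2 * (n * ?s) * (n * ?s) + (n * ?s)\<^sup>2"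
      using a4_int a2_int[OF that] Ea2[OF that] by (simp add: prob_space)
    also have "\<dots> \<le> expectation (\<lambda>\<omega>. a j \<omega> ^ 4)"
      using zero_le_power2[of "n * ?s"] unfolding power2_eq_square by linarith
    finally show ?thesis using Ea4[OF that] by linarith
  qed
  hence "(\<Sum>j\<in>J. expectation (\<lambda>\<omega>. (c j \<omega>)\<^sup>2)) \<le> real (card J) * (3 * (real n)\<^sup>2 * b ^ 4)"
    by (rule sum_bounded_above)
  with C2(2) have var: "expectation (\<lambda>\<omega>. (?C \<omega>)\<^sup>2) \<le> 3 * b ^ 4 * real (card J) * (real n)\<^sup>2"
    by (simp add: mult_ac)
  have sum_eq: "(\<Sum>j\<in>J. (\<Sum>i\<in>B j. f (x i \<omega>))\<^sup>2) = ?C \<omega> + real (card J) * real n * ?s" for \<omega>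
    unfolding c_def a_def by (simp add: sum_subtractf)
  have "prob {\<omega> \<in> space M. (\<Sum>j\<in>J. (\<Sum>i\<in>B j. f (x i \<omega>))\<^sup>2) \<ge> real (card J) * real n * ?s + t}
      \<le> prob {\<omega> \<in> space M. (?C \<omega>)\<^sup>2 \<ge> t\<^sup>2}"
  proof (rule finite_measure_mono)
    show "{\<omega> \<in> space M. (\<Sum>j\<in>J. (\<Sum>i\<in>B j. f (x i \<omega>))\<^sup>2) \<ge> real (card J) * real n * ?s + t}
      \<subseteq> {\<omega> \<in> space M. (?C \<omega>)\<^sup>2 \<ge> t\<^sup>2}"
      unfolding sum_eq using \<open>t > 0\<close> by (auto intro!: power_mono)
  qed measurable
  also have "\<dots> \<le> expectation (\<lambda>\<omega>. (?C \<omega>)\<^sup>2) / t\<^sup>2"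
    using \<open>t > 0\<close> by (intro integral_Markov_inequality_measure[OF C2(1)]) auto
  also have "\<dots> \<le> 3 * b ^ 4 * real (card J) * (real n)\<^sup>2 / t\<^sup>2"
    by (intro divide_right_mono var) auto
  finally show ?thesis .
qed

text \<open>Markov's inequality for the fourth power of the centred sum of the bounded variables
  f(x)^2. For \<open>t\<close> proportional to \<open>card I\<close> the probability decays like the
  inverse square of \<open>card I\<close>, fast enough to be summed over the sample size.\<close>

lemma sum_squares_lower:
  fixes b t :: real
  assumes f [measurable]: "f \<in> borel_measurable borel" and "b > 0" and fb: "\<And>u. \<bar>f u\<bar> \<le> b"
    and I: "finite I" and "t > 0"
  shows "prob {\<omega> \<in> space M. (\<Sum>i\<in>I. (f (x i \<omega>))\<^sup>2)
    \<le> card I * expectation (\<lambda>\<omega>. (f (x (0, 0) \<omega>))\<^sup>2) - t} \<le> 3 * (card I)\<^sup>2 * (b\<^sup>2) ^ 4 / t ^ 4"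
proof -
  let ?s = "expectation (\<lambda>\<omega>. (f (x (0, 0) \<omega>))\<^sup>2)"
  define g where "g u = (f u)\<^sup>2 - ?s" for u
  have g [measurable]: "g \<in> borel_measurable borel" unfolding g_def by measurable
  have f2: "(f u)\<^sup>2 \<le> b\<^sup>2" for u
    using fb[of u] \<open>b > 0\<close> by (simp add: abs_le_square_iff[symmetric])
  have f2_int: "integrable M (\<lambda>\<omega>. (f (x i \<omega>))\<^sup>2)" for i
    by (rule bounded_integrable[where b = "b\<^sup>2"]) (use f2 in auto)
  have "?s \<le> expectation (\<lambda>\<omega>. b\<^sup>2)" by (intro integral_mono f2_int f2) auto
  hence "?s \<le> b\<^sup>2" "0 \<le> ?s" by (auto simp: prob_space)
  hence gb: "\<bar>g u\<bar> \<le> b\<^sup>2" for u using f2[of u] zero_le_power2[of "f u"] unfolding g_def by linarith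
  have Eg: "expectation (\<lambda>\<omega>. g (x i \<omega>)) = 0" for i
    by (subst expectation_ident[OF g]) (use f2_int in \<open>simp add: g_def prob_space\<close>)
  let ?S = "\<lambda>\<omega>. \<Sum>i\<in>I. g (x i \<omega>)"
  have S4: "expectation (\<lambda>\<omega>. ?S \<omega> ^ 4) \<le> 3 * (real (card I))\<^sup>2 * (b\<^sup>2) ^ 4"
    using expectation_sum_powers_le[OF I indep_fun[OF g], of "b\<^sup>2"] gb Eg by blast
  have S_bound: "\<bar>?S \<omega>\<bar> \<le> card I * b\<^sup>2" for \<omega>
    using gb by (intro order_trans[OF sum_abs] sum_bounded_above) auto
  have S4_int: "integrable M (\<lambda>\<omega>. ?S \<omega> ^ 4)"
  proof (rule bounded_integrable[where b = "(card I * b\<^sup>2) ^ 4"])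
    show "\<bar>?S \<omega> ^ 4\<bar> \<le> (card I * b\<^sup>2) ^ 4" for \<omega>
      unfolding power_abs by (intro power_mono S_bound) auto
  qed measurable
  have sum_eq: "(\<Sum>i\<in>I. (f (x i \<omega>))\<^sup>2) = ?S \<omega> + card I * ?s" for \<omega>
    by (simp add: g_def sum_subtractf)
  have "prob {\<omega> \<in> space M. (\<Sum>i\<in>I. (f (x i \<omega>))\<^sup>2) \<le> card I * ?s - t}
      \<le> prob {\<omega> \<in> space M. ?S \<omega> ^ 4 \<ge> t ^ 4}"
  proof (rule finite_measure_mono)
    show "{\<omega> \<in> space M. (\<Sum>i\<in>I. (f (x i \<omega>))\<^sup>2) \<le> card I * ?s - t}
      \<subseteq> {\<omega> \<in> space M. ?S \<omega> ^ 4 \<ge> t ^ 4}"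
    proof safe
      fix \<omega> assume "(\<Sum>i\<in>I. (f (x i \<omega>))\<^sup>2) \<le> card I * ?s - t"
      hence "\<bar>t\<bar> \<le> \<bar>?S \<omega>\<bar>" unfolding sum_eq using \<open>t > 0\<close> by linarith
      thus "t ^ 4 \<le> ?S \<omega> ^ 4" by (rule power_mono_even[rotated]) simp
    qed
  qed measurable
  also have "\<dots> \<le> expectation (\<lambda>\<omega>. ?S \<omega> ^ 4) / t ^ 4"
    using \<open>t > 0\<close> by (intro integral_Markov_inequality_measure[OF S4_int]) auto
  also have "\<dots> \<le> 3 * (card I)\<^sup>2 * (b\<^sup>2) ^ 4 / t ^ 4"
    using S4 \<open>t > 0\<close> by (intro divide_right_mono) auto
  finally show ?thesis .
qed

text \<open>Split x = f(x) + r(x) by truncation. The bounded part is covered by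
  \<open>block_sum_squares_upper\<close>; the remainder has small variance and orthogonal entries,
  so Markov's inequality suffices for it. The threshold \<open>m0\<close> precedes \<open>n\<close>.
  Blocks that are columns serve the averages, and singleton blocks serve the sample
  variance.\<close>

lemma block_sum_squares_tail:
  assumes "v > 0" "\<kappa> > 0" "\<eta> > 0"
  shows "\<exists>m0. \<forall>J (B :: 'j \<Rightarrow> (nat \<times> nat) set) n. finite J \<longrightarrow> m0 \<le> card J \<longrightarrow> 0 < n \<longrightarrow> disjoint_family_on B J \<longrightarrow>
    (\<forall>j\<in>J. finite (B j) \<and> card (B j) = n) \<longrightarrow>
    prob {\<omega> \<in> space M. (\<Sum>j\<in>J. (\<Sum>i\<in>B j. x i \<omega>)\<^sup>2) > (1 + \<kappa>) * v * card J * n} \<le> \<eta>"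
proof -
  \<comment> \<open>With this choice (1 + k)^2 + \<kappa> / 3 \<le> 1 + \<kappa>, where \<kappa> / 3
    is the share of the remainder.\<close>
  define k where "k = min 1 (\<kappa> / 6)"
  have k: "0 < k" "k \<le> 1" "k \<le> \<kappa> / 6" using assms by (auto simp: k_def)
  \<comment> \<open>The value for which Markov's bound m n \<theta> / u for the remainder equals
    \<eta> / 2.\<close>
  define \<theta> where "\<theta> = \<eta> / 2 * (\<kappa> / 3 * v) / (1 + 1 / k)"
  have "\<theta> > 0" using assms k by (simp add: \<theta>_def add_pos_pos)
  then obtain f b where f [measurable]: "f \<in> borel_measurable borel"
    and b: "b > 0" "\<And>u. \<bar>f u\<bar> \<le> b" and f0: "\<And>i. expectation (\<lambda>\<omega>. f (x i \<omega>)) = 0"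
    and f2: "expectation (\<lambda>\<omega>. (f (x (0, 0) \<omega>))\<^sup>2) \<le> v"
    and fr: "expectation (\<lambda>\<omega>. (x (0, 0) \<omega> - f (x (0, 0) \<omega>))\<^sup>2) \<le> \<theta>"
    by (rule truncation) blast
  obtain m0 :: nat where m0: "3 * b ^ 4 / (k * v)\<^sup>2 / (\<eta> / 2) < real m0"
    using reals_Archimedean2 by blast
  define r where "r u = u - f u" for u
  have r [measurable]: "r \<in> borel_measurable borel" unfolding r_def by measurable
  have f_int: "integrable M (\<lambda>\<omega>. f (x i \<omega>))" for i
    by (rule bounded_integrable[where b = b]) (use b in auto)
  have r_int: "integrable M (\<lambda>\<omega>. r (x i \<omega>))" for i
    unfolding r_def using f_int x_integrable by simp
  have r0: "expectation (\<lambda>\<omega>. r (x i \<omega>)) = 0" for i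
    unfolding r_def using f_int x_integrable f0 mean by simp
  have r2_int: "integrable M (\<lambda>\<omega>. (r (x i \<omega>))\<^sup>2)" for i
  proof (rule Bochner_Integration.integrable_bound)
    show "integrable M (\<lambda>\<omega>. 2 * (x i \<omega>)\<^sup>2 + 2 * b\<^sup>2)" using square_integrable by simp
    have "(r u)\<^sup>2 \<le> 2 * u\<^sup>2 + 2 * b\<^sup>2" for u
    proof -
      have "(f u)\<^sup>2 \<le> b\<^sup>2" using b by (simp add: abs_le_square_iff[symmetric])
      moreover have "(u + - f u)\<^sup>2 \<le> (1 + 1) * u\<^sup>2 + (1 + 1 / 1) * (- f u)\<^sup>2"
        by (rule square_add_le) simp
      ultimately show ?thesis by (simp add: r_def)
    qed
    thus "AE \<omega> in M. norm ((r (x i \<omega>))\<^sup>2) \<le> norm (2 * (x i \<omega>)\<^sup>2 + 2 * b\<^sup>2)"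
      by (intro AE_I2) (auto intro: order_trans[OF _ abs_ge_self])
  qed measurable
  have r_pair: "integrable M (\<lambda>\<omega>. r (x i \<omega>) * r (x j \<omega>))
      \<and> (i \<noteq> j \<longrightarrow> expectation (\<lambda>\<omega>. r (x i \<omega>) * r (x j \<omega>)) = 0)" for i j
  proof (cases "i = j")
    case False
    have "indep_vars (\<lambda>_. borel) (\<lambda>i \<omega>. r (x i \<omega>)) {i, j}" by (rule indep_fun[OF r])
    from indep_vars_lebesgue_integral[OF _ this] indep_vars_integrable[OF _ this]
    show ?thesis using False r_int r0 by simp
  qed (use r2_int in \<open>simp add: power2_eq_square\<close>)
  have "prob {\<omega> \<in> space M. (\<Sum>j\<in>J. (\<Sum>i\<in>B j. x i \<omega>)\<^sup>2) > (1 + \<kappa>) * v * card J * n} \<le> \<eta>"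
    if J: "finite J" "Suc m0 \<le> card J" and n: "0 < n" and B: "disjoint_family_on B J"
      "\<forall>j\<in>J. finite (B j) \<and> card (B j) = n" for J and B :: "'j \<Rightarrow> (nat \<times> nat) set" and n
  proof -
    define m where "m = card J"
    have m: "m > 0" "m0 \<le> m" using J by (auto simp: m_def)
    hence "J \<noteq> {}" by (auto simp: m_def)
    define t where "t = k * v * m * n"
    have "t > 0" using k assms m n by (simp add: t_def)
    let ?A = "\<lambda>\<omega>. \<Sum>j\<in>J. (\<Sum>i\<in>B j. f (x i \<omega>))\<^sup>2"
    let ?R = "\<lambda>\<omega>. \<Sum>j\<in>J. (\<Sum>i\<in>B j. r (x i \<omega>))\<^sup>2"
    let ?s = "expectation (\<lambda>\<omega>. (f (x (0, 0) \<omega>))\<^sup>2)"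
    let ?E1 = "{\<omega> \<in> space M. ?A \<omega> \<ge> real m * real n * ?s + t}"
    define u where "u = \<kappa> / 3 * v * m * n / (1 + 1 / k)"
    have "u > 0" using k assms m n by (simp add: u_def add_pos_pos)
    let ?E2 = "{\<omega> \<in> space M. ?R \<omega> \<ge> u}"
    have "{\<omega> \<in> space M. (\<Sum>j\<in>J. (\<Sum>i\<in>B j. x i \<omega>)\<^sup>2) > (1 + \<kappa>) * v * m * n} \<subseteq> ?E1 \<union> ?E2"
    proof (rule subsetI, rule ccontr)
      fix \<omega> assume *: "\<omega> \<in> {\<omega> \<in> space M. (\<Sum>j\<in>J. (\<Sum>i\<in>B j. x i \<omega>)\<^sup>2) > (1 + \<kappa>) * v * m * n}"
        and "\<omega> \<notin> ?E1 \<union> ?E2"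
      hence A: "?A \<omega> < real m * real n * ?s + t" and R: "?R \<omega> < u" by auto
      have "real m * real n * ?s \<le> real m * real n * v" using f2 by (intro mult_left_mono) auto
      hence A': "?A \<omega> \<le> (1 + k) * (v * m * n)" using A by (simp add: t_def algebra_simps)
      have "(\<Sum>j\<in>J. (\<Sum>i\<in>B j. x i \<omega>)\<^sup>2)
          \<le> (\<Sum>j\<in>J. (1 + k) * (\<Sum>i\<in>B j. f (x i \<omega>))\<^sup>2 + (1 + 1 / k) * (\<Sum>i\<in>B j. r (x i \<omega>))\<^sup>2)"
      proof (rule sum_mono)
        fix j
        have "(\<Sum>i\<in>B j. x i \<omega>) = (\<Sum>i\<in>B j. f (x i \<omega>)) + (\<Sum>i\<in>B j. r (x i \<omega>))"
          by (simp add: r_def flip: sum.distrib)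
        thus "(\<Sum>i\<in>B j. x i \<omega>)\<^sup>2
            \<le> (1 + k) * (\<Sum>i\<in>B j. f (x i \<omega>))\<^sup>2 + (1 + 1 / k) * (\<Sum>i\<in>B j. r (x i \<omega>))\<^sup>2"
          using square_add_le[OF k(1)] by simp
      qed
      also have "\<dots> = (1 + k) * ?A \<omega> + (1 + 1 / k) * ?R \<omega>"
        by (simp add: sum.distrib sum_distrib_left)
      also have "\<dots> \<le> (1 + k) * ((1 + k) * (v * m * n)) + (1 + 1 / k) * u"
        using A' R k by (intro add_mono mult_left_mono) auto
      also have "(1 + 1 / k) * u = \<kappa> / 3 * (v * m * n)"
      proof -
        have "1 + 1 / k \<noteq> 0" using k by (smt (verit) divide_pos_pos)
        moreover have "c * (a / c) = a" if "c \<noteq> 0" for a c :: real using that by simp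
        ultimately show ?thesis by (simp only: u_def mult.assoc not_False_eq_True)
      qed
      also have "(1 + k) * ((1 + k) * (v * m * n)) + \<kappa> / 3 * (v * m * n)
          = (1 + (2 * k + k * k + \<kappa> / 3)) * (v * m * n)" by (simp add: algebra_simps)
      also have "\<dots> \<le> (1 + \<kappa>) * (v * m * n)"
      proof (rule mult_right_mono)
        have "k * k \<le> 1 * k" using k by (intro mult_right_mono) auto
        thus "1 + (2 * k + k * k + \<kappa> / 3) \<le> 1 + \<kappa>" using k assms by linarith
      qed (use assms in auto)
      finally show False using * by (simp add: mult.assoc)
    qed
    hence "prob {\<omega> \<in> space M. (\<Sum>j\<in>J. (\<Sum>i\<in>B j. x i \<omega>)\<^sup>2) > (1 + \<kappa>) * v * m * n} \<le> prob (?E1 \<union> ?E2)"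
      by (rule finite_measure_mono) measurable
    also have "\<dots> \<le> prob ?E1 + prob ?E2" by (rule measure_Un_le) measurable
    also have "\<dots> \<le> \<eta> / 2 + \<eta> / 2"
    proof (rule add_mono)
      have "prob ?E1 \<le> 3 * b ^ 4 * real (card J) * (real n)\<^sup>2 / t\<^sup>2"
        unfolding m_def using B by (intro block_sum_squares_upper f b f0 J \<open>J \<noteq> {}\<close> n \<open>t > 0\<close>) auto
      also have "\<dots> = 3 * b ^ 4 / (k * v)\<^sup>2 / m"
        using m n unfolding t_def m_def[symmetric] by (simp add: power2_eq_square)
      also have "\<dots> \<le> \<eta> / 2"
      proof -
        have swap: "a / c \<le> h" if "a / h < c" "0 < h" "0 < c" for a c h :: real
          using that by (simp add: field_simps)
        have "3 * b ^ 4 / (k * v)\<^sup>2 / (\<eta> / 2) < real m" using m0 m by linarith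
        thus ?thesis by (rule swap) (use assms m in auto)
      qed
      finally show "prob ?E1 \<le> \<eta> / 2" .
    next
      have int: "integrable M (\<lambda>\<omega>. (\<Sum>i\<in>B j. r (x i \<omega>))\<^sup>2)"
        and ex: "expectation (\<lambda>\<omega>. (\<Sum>i\<in>B j. r (x i \<omega>))\<^sup>2) \<le> n * \<theta>" if "j \<in> J" for j
      proof -
        have fin: "finite (B j)" "card (B j) = n" using B that by auto
        show "integrable M (\<lambda>\<omega>. (\<Sum>i\<in>B j. r (x i \<omega>))\<^sup>2)"
          using r_pair fin by (intro expectation_square_sum) auto
        have "expectation (\<lambda>\<omega>. (\<Sum>i\<in>B j. r (x i \<omega>))\<^sup>2) = (\<Sum>i\<in>B j. expectation (\<lambda>\<omega>. (r (x i \<omega>))\<^sup>2))"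
          using r_pair fin by (intro expectation_square_sum) auto
        also have "\<dots> = (\<Sum>i\<in>B j. expectation (\<lambda>\<omega>. (r (x (0, 0) \<omega>))\<^sup>2))"
          by (intro sum.cong refl expectation_ident[where g = "\<lambda>u. (r u)\<^sup>2"]) measurable
        also have "\<dots> \<le> n * \<theta>" using fr fin by (simp add: r_def mult_left_mono)
        finally show "expectation (\<lambda>\<omega>. (\<Sum>i\<in>B j. r (x i \<omega>))\<^sup>2) \<le> n * \<theta>" .
      qed
      have R_int: "integrable M ?R" using int by (intro Bochner_Integration.integrable_sum)
      have "expectation ?R = (\<Sum>j\<in>J. expectation (\<lambda>\<omega>. (\<Sum>i\<in>B j. r (x i \<omega>))\<^sup>2))"
        using int by (intro Bochner_Integration.integral_sum)
      also have "\<dots> \<le> m * (n * \<theta>)" unfolding m_def by (intro sum_bounded_above ex)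
      finally have ER: "expectation ?R \<le> m * (n * \<theta>)" .
      have "prob ?E2 \<le> expectation ?R / u"
        using \<open>u > 0\<close> by (intro integral_Markov_inequality_measure[OF R_int]) (auto intro!: AE_I2 sum_nonneg)
      also have "\<dots> \<le> m * (n * \<theta>) / u" using ER \<open>u > 0\<close> by (intro divide_right_mono) auto
      also have "\<dots> = \<eta> / 2"
      proof -
        have "1 + 1 / k \<noteq> 0" using k by (smt (verit) divide_pos_pos)
        moreover have "m * (n * (\<eta> / 2 * (\<kappa> / 3 * v) / c)) / (\<kappa> / 3 * v * m * n / c) = \<eta> / 2"
          if "c \<noteq> 0" for c :: real using assms m n that by simp
        ultimately show ?thesis unfolding u_def \<theta>_def by blast
      qed
      finally show "prob ?E2 \<le> \<eta> / 2" .
    qed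
    finally show ?thesis by (simp add: m_def)
  qed
  thus ?thesis by blast
qed

end

section \<open>The number of repetitions\<close>

lemma sum_column: "sum g ({..<n} \<times> {j}) = (\<Sum>i<n. g (i, j))"
  for g :: "nat \<times> nat \<Rightarrow> real"
  by (rule sum.reindex_bij_witness[where i = "\<lambda>i. (i, j)" and j = fst]) auto

text \<open>The second form contains only pairwise differences. It shows that the sample variance
  does not grow under a contraction and is invariant under shifts.\<close>

lemma sum_squared_deviations:
  fixes u :: "nat \<Rightarrow> real"
  assumes "n > 0"
  shows "(\<Sum>i<n. (u i - (\<Sum>k<n. u k) / n)\<^sup>2) = (\<Sum>i<n. (u i)\<^sup>2) - (\<Sum>i<n. u i)\<^sup>2 / n"
    and "(\<Sum>i<n. (u i - (\<Sum>k<n. u k) / n)\<^sup>2) = (\<Sum>i<n. \<Sum>k<n. (u i - u k)\<^sup>2) / (2 * n)"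
proof -
  define S where "S = (\<Sum>k<n. u k)"
  have "(\<Sum>i<n. (u i - S / n)\<^sup>2) = (\<Sum>i<n. (u i)\<^sup>2 - 2 * (S / n) * u i + (S / n)\<^sup>2)"
    by (intro sum.cong refl) (simp add: power2_diff algebra_simps)
  also have "\<dots> = (\<Sum>i<n. (u i)\<^sup>2) - 2 * (S / n) * S + n * (S / n)\<^sup>2"
    unfolding sum.distrib sum_subtractf sum_distrib_left[symmetric] S_def[symmetric] by simp
  also have "\<dots> = (\<Sum>i<n. (u i)\<^sup>2) - S\<^sup>2 / n"
    using assms by (simp add: power2_eq_square)
  finally show 1: "(\<Sum>i<n. (u i - (\<Sum>k<n. u k) / n)\<^sup>2) = (\<Sum>i<n. (u i)\<^sup>2) - (\<Sum>i<n. u i)\<^sup>2 / n"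
    by (simp add: S_def)
  have "(\<Sum>i<n. \<Sum>k<n. (u i - u k)\<^sup>2) = (\<Sum>i<n. \<Sum>k<n. (u i)\<^sup>2 - 2 * (u i * u k) + (u k)\<^sup>2)"
    by (intro sum.cong refl) (simp add: power2_diff)
  also have "\<dots> = (\<Sum>i<n. n * (u i)\<^sup>2 - 2 * (u i * S) + (\<Sum>k<n. (u k)\<^sup>2))"
    by (simp add: sum.distrib sum_subtractf S_def flip: sum_distrib_left)
  also have "\<dots> = n * (\<Sum>i<n. (u i)\<^sup>2) - 2 * (S * S) + n * (\<Sum>k<n. (u k)\<^sup>2)"
    by (simp add: sum.distrib sum_subtractf S_def flip: sum_distrib_left sum_distrib_right)
  finally have "(\<Sum>i<n. \<Sum>k<n. (u i - u k)\<^sup>2) / (2 * n) = (\<Sum>i<n. (u i)\<^sup>2) - S\<^sup>2 / n"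
    using assms by (simp add: field_simps power2_eq_square)
  with 1 show "(\<Sum>i<n. (u i - (\<Sum>k<n. u k) / n)\<^sup>2) = (\<Sum>i<n. \<Sum>k<n. (u i - u k)\<^sup>2) / (2 * n)"
    by (simp add: S_def)
qed

lemma sample_var_eq:
  assumes "n > 0"
  shows "sample_var Y m n
    = ((\<Sum>j<m. \<Sum>i<n. (Y i j)\<^sup>2) - (\<Sum>j<m. (\<Sum>i<n. Y i j)\<^sup>2) / n) / (real n - 1) / m"
  using assms
  by (simp add: sample_var_def sample_mean_def sum_squared_deviations(1) sum_subtractf
      flip: sum_divide_distrib)

lemma sample_var_mono:
  assumes "n \<ge> 2" "\<And>i k j. \<bar>U i j - U k j\<bar> \<le> \<bar>Y i j - Y k j\<bar>"
  shows "sample_var U m n \<le> sample_var Y m n"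
proof -
  have *: "(\<Sum>i<n. (U i j - sample_mean U n j)\<^sup>2) \<le> (\<Sum>i<n. (Y i j - sample_mean Y n j)\<^sup>2)" for j
    unfolding sample_mean_def using assms
    by (simp add: sum_squared_deviations(2) divide_right_mono sum_mono abs_le_square_iff)
  thus ?thesis unfolding sample_var_def using assms(1)
    by (intro divide_right_mono[OF sum_mono[OF divide_right_mono[OF *]]]) auto
qed

lemma sample_var_shift:
  assumes "n \<ge> 2"
  shows "sample_var (\<lambda>i j. a j + Y i j) m n = sample_var Y m n"
  by (intro antisym sample_var_mono assms) auto

lemma sample_var_cong:
  assumes "\<And>i j. i < n \<Longrightarrow> j < m \<Longrightarrow> Y i j = U i j"
  shows "sample_var Y m n = sample_var U m n"
proof -
  have "sample_mean Y n j = sample_mean U n j" if "j < m" for j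
    using assms that by (simp add: sample_mean_def)
  thus ?thesis unfolding sample_var_def using assms
    by (intro arg_cong2[where f = "(/)"] sum.cong refl) auto
qed

text \<open>Indicator that the stopping rule has not been met by any sample size from 2 to i;
  \<open>b\<close> is the tolerance of the rule in the form s^2 \<le> n b. Repetitions are counted
  from 0, so the sample of size i consists of those with index below i: the value at i is determined
  before repetition i takes place. With stopping time N it is 1 exactly for i < N, the indices that
  enter the average.\<close>

definition running :: "(nat \<Rightarrow> nat \<Rightarrow> real) \<Rightarrow> nat \<Rightarrow> real \<Rightarrow> nat \<Rightarrow> real" where
  "running Y m b i = (\<Prod>n\<in>{2..i}. if sample_var Y m n \<le> n * b then 0 else 1)"

lemma running_bounds: "0 \<le> running Y m b i" "running Y m b i \<le> 1"
  unfolding running_def by (auto intro!: prod_nonneg prod_le_1)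

lemma running_eq:
  fixes b :: real
  assumes N: "2 \<le> N" "sample_var Y m N \<le> N * b"
    and min: "\<And>n. 2 \<le> n \<Longrightarrow> n < N \<Longrightarrow> \<not> sample_var Y m n \<le> n * b"
  shows "running Y m b i = (if i < N then 1 else 0)"
proof (cases "i < N")
  case False
  hence "N \<in> {2..i}" using N by auto
  hence "running Y m b i = 0"
    unfolding running_def using N(2) by (intro prod_zero) auto
  thus ?thesis using False by simp
qed (use min in \<open>auto simp: running_def intro!: prod.neutral\<close>)

section \<open>Sample variances and the stopping time\<close>

context centred_iid
begin

abbreviation noise_array :: "'a \<Rightarrow> nat \<Rightarrow> nat \<Rightarrow> real" where
  "noise_array \<omega> i j \<equiv> x (i, j) \<omega>"

lemma sample_var_measurable [measurable]:
  "(\<lambda>\<omega>. sample_var (noise_array \<omega>) m n) \<in> borel_measurable M"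
  unfolding sample_var_def sample_mean_def by measurable

text \<open>The blocks are the columns \<open>{..<n} \<times> {j}\<close>, all repetitions of one
  functional.\<close>

lemma sum_squares_tail:
  assumes "v > 0" "\<kappa> > 0" "\<eta> > 0"
  shows "\<exists>m0. \<forall>m\<ge>m0. \<forall>n>0.
    prob {\<omega> \<in> space M. (\<Sum>j<m. (\<Sum>i<n. x (i, j) \<omega>)\<^sup>2) > (1 + \<kappa>) * v * m * n} \<le> \<eta>"
proof -
  from block_sum_squares_tail[OF assms, where 'j = nat] obtain m0 where
    m0: "\<forall>J (B :: nat \<Rightarrow> (nat \<times> nat) set) n. finite J \<longrightarrow> m0 \<le> card J \<longrightarrow> 0 < n \<longrightarrow> disjoint_family_on B J \<longrightarrow>
    (\<forall>j\<in>J. finite (B j) \<and> card (B j) = n) \<longrightarrow>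
    prob {\<omega> \<in> space M. (\<Sum>j\<in>J. (\<Sum>i\<in>B j. x i \<omega>)\<^sup>2) > (1 + \<kappa>) * v * card J * n} \<le> \<eta>" ..
  show ?thesis
  proof (intro exI allI impI)
    fix m n :: nat assume mn: "m0 \<le> m" "0 < n"
    show "prob {\<omega> \<in> space M. (\<Sum>j<m. (\<Sum>i<n. x (i, j) \<omega>)\<^sup>2) > (1 + \<kappa>) * v * m * n} \<le> \<eta>"
      using m0[rule_format, of "{..<m}" n "\<lambda>j. {..<n} \<times> {j}"] mn
      by (auto simp: disjoint_family_on_def sum_column)
  qed
qed

text \<open>Dropping the squared means only increases the sample variance and leaves the factor n /
  (n - 1). The blocks are the m * n single entries. A bound for one n at a time is enough, because a
  single n that meets the rule bounds the stopping time from above.\<close>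

lemma sample_var_upper:
  assumes "v > 0" "\<epsilon> > 0" "\<eta> > 0"
  shows "\<exists>m0. \<forall>m\<ge>m0. \<forall>n\<ge>2.
    prob {\<omega> \<in> space M. sample_var (noise_array \<omega>) m n > n / (real n - 1) * ((1 + \<epsilon>) * v)} \<le> \<eta>"
proof -
  from block_sum_squares_tail[OF assms, where 'j = "nat \<times> nat"] obtain m0 where
    m0: "\<forall>J (B :: nat \<times> nat \<Rightarrow> (nat \<times> nat) set) n. finite J \<longrightarrow> m0 \<le> card J \<longrightarrow> 0 < n \<longrightarrow> disjoint_family_on B J \<longrightarrow>
    (\<forall>j\<in>J. finite (B j) \<and> card (B j) = n) \<longrightarrow>
    prob {\<omega> \<in> space M. (\<Sum>j\<in>J. (\<Sum>i\<in>B j. x i \<omega>)\<^sup>2) > (1 + \<epsilon>) * v * card J * n} \<le> \<eta>" ..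
  show ?thesis
  proof (intro exI allI impI)
    fix m n :: nat assume mn: "Suc m0 \<le> m" "2 \<le> n"
    have "m * 1 \<le> m * n" using mn by (intro mult_le_mono) auto
    hence "m0 \<le> m * n" using mn by linarith
    hence card: "m0 \<le> card ({..<m} \<times> {..<n})" by (simp add: card_cartesian_product)
    let ?Q = "\<lambda>\<omega>. \<Sum>j<m. \<Sum>i<n. (x (i, j) \<omega>)\<^sup>2"
    have "{\<omega> \<in> space M. sample_var (noise_array \<omega>) m n > n / (real n - 1) * ((1 + \<epsilon>) * v)}
        \<subseteq> {\<omega> \<in> space M. ?Q \<omega> > (1 + \<epsilon>) * v * (m * n)}"
    proof safe
      fix \<omega> assume *: "sample_var (noise_array \<omega>) m n > n / (real n - 1) * ((1 + \<epsilon>) * v)"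
      have "sample_var (noise_array \<omega>) m n \<le> ?Q \<omega> / (real n - 1) / m"
        unfolding sample_var_eq[OF order_less_le_trans[OF zero_less_numeral mn(2)]] using mn
        by (intro divide_right_mono) (auto intro!: divide_nonneg_nonneg sum_nonneg)
      with * have "n / (real n - 1) * ((1 + \<epsilon>) * v) < ?Q \<omega> / (real n - 1) / m" by linarith
      moreover have "n / (real n - 1) * ((1 + \<epsilon>) * v) = (1 + \<epsilon>) * v * (m * n) / ((real n - 1) * m)"
        using mn by simp
      ultimately have "(1 + \<epsilon>) * v * (m * n) / ((real n - 1) * m) < ?Q \<omega> / ((real n - 1) * m)"
        by (simp only: divide_divide_eq_left)
      moreover have "(real n - 1) * m > 0" using mn by simp
      ultimately show "?Q \<omega> > (1 + \<epsilon>) * v * (m * n)" by (simp only: divide_less_cancel if_True)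
    qed
    hence "prob {\<omega> \<in> space M. sample_var (noise_array \<omega>) m n > n / (real n - 1) * ((1 + \<epsilon>) * v)}
        \<le> prob {\<omega> \<in> space M. ?Q \<omega> > (1 + \<epsilon>) * v * (m * n)}"
      by (rule finite_measure_mono) measurable
    also have "\<dots> \<le> \<eta>"
    proof -
      have "?Q \<omega> = (\<Sum>p\<in>{..<m} \<times> {..<n}. (\<Sum>i\<in>{prod.swap p}. x i \<omega>)\<^sup>2)" for \<omega>
        by (simp add: sum.cartesian_product case_prod_unfold prod.swap_def)
      thus ?thesis
        using m0[rule_format, of "{..<m} \<times> {..<n}" 1 "\<lambda>p. {prod.swap p}"] card
        by (auto simp: disjoint_family_on_def card_cartesian_product)
    qed
    finally show "prob {\<omega> \<in> space M. sample_var (noise_array \<omega>) m n > n / (real n - 1) * ((1 + \<epsilon>) * v)} \<le> \<eta>" .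
  qed
qed

text \<open>The number of repetitions may grow arbitrarily fast with \<open>m\<close>, so the lower bound has to hold
  for all \<open>n\<close> at once. After truncation the fourth moments give failure probabilities that are
  summable in \<open>n\<close>.\<close>

lemma sample_var_lower:
  assumes "v > 0" "\<epsilon> > 0" "\<eta> > 0"
  shows "\<exists>m0. \<forall>m\<ge>m0. \<exists>E\<in>events. prob E \<le> \<eta> \<and>
    (\<forall>\<omega>\<in>space M - E. \<forall>n\<ge>2. (1 - \<epsilon>) * v \<le> sample_var (noise_array \<omega>) m n)"
proof -
  \<comment> \<open>Five losses of size at most \<open>t\<close> add up to \<epsilon> v: one from
    truncation, four from the two events below.\<close>
  define t where "t = \<epsilon> * v / 5"
  have "t > 0" using assms by (simp add: t_def)
  then obtain f b where f [measurable]: "f \<in> borel_measurable borel"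
    and b: "b > 0" "\<And>u. \<bar>f u\<bar> \<le> b" and lip: "\<And>u u'. \<bar>f u - f u'\<bar> \<le> \<bar>u - u'\<bar>"
    and f0: "\<And>i. expectation (\<lambda>\<omega>. f (x i \<omega>)) = 0"
    and f2: "v - t \<le> expectation (\<lambda>\<omega>. (f (x (0, 0) \<omega>))\<^sup>2)"
    by (rule truncation) blast
  let ?s = "expectation (\<lambda>\<omega>. (f (x (0, 0) \<omega>))\<^sup>2)"
  define C where "C = 3 * (b\<^sup>2) ^ 4 / t ^ 4 + 3 * b ^ 4 / t\<^sup>2"
  have "C > 0" using \<open>t > 0\<close> b by (simp add: C_def add_pos_pos)
  define q where "q n = 1 / (real n)\<^sup>2" for n
  have q: "summable q" unfolding q_def using inverse_power_summable[of 2, where 'a = real]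
    by (simp add: inverse_eq_divide power_divide)
  obtain m0 :: nat where m0: "C * suminf q / \<eta> < real m0" using reals_Archimedean2 by blast
  have "\<exists>E\<in>events. prob E \<le> \<eta> \<and>
    (\<forall>\<omega>\<in>space M - E. \<forall>n\<ge>2. (1 - \<epsilon>) * v \<le> sample_var (noise_array \<omega>) m n)" if m: "Suc m0 \<le> m" for m
  proof -
    have m1: "m \<ge> 1" using m by simp
    let ?Q = "\<lambda>n \<omega>. \<Sum>p\<in>{..<n} \<times> {..<m}. (f (x p \<omega>))\<^sup>2"
    let ?S = "\<lambda>n \<omega>. \<Sum>j<m. (\<Sum>p\<in>{..<n} \<times> {j}. f (x p \<omega>))\<^sup>2"
    \<comment> \<open>\<open>E1\<close>: the sum of squares is too small; \<open>E2\<close>: the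
      column sums are too large. The column sums are divided by n afterwards, so \<open>E2\<close>
      may allow a deviation of order m n^2. This makes Chebyshev's bound for it summable in n; for
      \<open>E1\<close> the fourth moment does.\<close>
    define E1 where "E1 n = {\<omega> \<in> space M. ?Q n \<omega> \<le> real (card ({..<n} \<times> {..<m})) * ?s - t * n * m}" for n
    define E2 where "E2 n = {\<omega> \<in> space M. ?S n \<omega> \<ge> real (card {..<m}) * real n * ?s + t * m * (real n)\<^sup>2}" for n
    define A where "A n = (if n < 2 then {} else E1 n \<union> E2 n)" for n
    have [measurable]: "E1 n \<in> events" "E2 n \<in> events" for n
      unfolding E1_def E2_def by measurable
    hence A_sets: "A n \<in> events" for n by (simp add: A_def)
    have "prob (A n) \<le> C / m * q n" for n
    proof (cases "n < 2")
      case False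
      hence n: "n > 0" by simp
      have "prob (E1 n) \<le> 3 * (card ({..<n} \<times> {..<m}))\<^sup>2 * (b\<^sup>2) ^ 4 / (t * n * m) ^ 4"
        unfolding E1_def using \<open>t > 0\<close> n m1 by (intro sum_squares_lower f b) auto
      also have "\<dots> = 3 * (b\<^sup>2) ^ 4 / t ^ 4 * (1 / (real m)\<^sup>2 * q n)"
        using n m1 \<open>t > 0\<close> by (simp add: card_cartesian_product q_def power_mult_distrib field_simps power2_eq_square power4_eq_xxxx)
      also have "\<dots> \<le> 3 * (b\<^sup>2) ^ 4 / t ^ 4 * (1 / real m * q n)"
      proof (intro mult_left_mono mult_right_mono)
        have "real m * 1 \<le> real m * real m" using m1 by (intro mult_left_mono) auto
        thus "1 / (real m)\<^sup>2 \<le> 1 / real m" using m1 by (intro divide_left_mono) (auto simp: power2_eq_square)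
      qed (auto simp: q_def)
      finally have 1: "prob (E1 n) \<le> 3 * (b\<^sup>2) ^ 4 / t ^ 4 * (1 / real m * q n)" .
      have "prob (E2 n) \<le> 3 * b ^ 4 * real (card {..<m}) * (real n)\<^sup>2 / (t * m * (real n)\<^sup>2)\<^sup>2"
        unfolding E2_def using \<open>t > 0\<close> n m1
        by (intro block_sum_squares_upper f b f0) (auto simp: disjoint_family_on_def lessThan_empty_iff)
      also have "\<dots> = 3 * b ^ 4 / t\<^sup>2 * (1 / real m * q n)"
        using n m1 \<open>t > 0\<close> by (simp add: q_def field_simps power2_eq_square power4_eq_xxxx)
      finally have 2: "prob (E2 n) \<le> 3 * b ^ 4 / t\<^sup>2 * (1 / real m * q n)" .
      have "prob (A n) \<le> prob (E1 n) + prob (E2 n)"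
        using False by (simp add: A_def) (rule measure_Un_le; measurable)
      also have "\<dots> \<le> C * (1 / real m * q n)" using 1 2 unfolding C_def distrib_right by (rule add_mono)
      finally show ?thesis by simp
    qed (use \<open>C > 0\<close> in \<open>auto simp: A_def q_def\<close>)
    note le = this
    have sC: "summable (\<lambda>n. C / m * q n)" using q by (rule summable_mult)
    have pA: "summable (\<lambda>n. prob (A n))"
      by (rule summable_comparison_test'[OF sC, of 0]) (use le in simp)
    have "(\<Sum>n. prob (A n)) \<le> (\<Sum>n. C / m * q n)" by (rule suminf_le[OF le pA sC])
    also have "\<dots> = C / m * suminf q" by (rule suminf_mult[OF q])
    finally have pA_le: "(\<Sum>n. prob (A n)) \<le> C / m * suminf q" .
    have "prob (\<Union>n. A n) \<le> (\<Sum>n. prob (A n))"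
      using A_sets pA by (intro finite_measure_subadditive_countably) auto
    also have "\<dots> \<le> C / m * suminf q" by (rule pA_le)
    also have "\<dots> \<le> \<eta>"
    proof -
      have "C * suminf q / \<eta> < real m" using m0 m by linarith
      thus ?thesis using assms m1 by (simp add: field_simps)
    qed
    finally have "prob (\<Union>n. A n) \<le> \<eta>" .
    moreover have "(1 - \<epsilon>) * v \<le> sample_var (noise_array \<omega>) m n"
      if "\<omega> \<in> space M - (\<Union>n. A n)" and n: "n \<ge> 2" for \<omega> n
    proof -
      have "\<omega> \<notin> A n" "\<omega> \<in> space M" using that by auto
      hence "\<omega> \<notin> E1 n" "\<omega> \<notin> E2 n" using n by (auto simp: A_def)
      hence Q: "?Q n \<omega> > real n * real m * ?s - t * n * m" and S: "?S n \<omega> < real m * real n * ?s + t * m * (real n)\<^sup>2"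
        using \<open>\<omega> \<in> space M\<close> by (auto simp: E1_def E2_def card_cartesian_product)
      have Q_eq: "?Q n \<omega> = (\<Sum>j<m. \<Sum>i<n. (f (x (i, j) \<omega>))\<^sup>2)"
      proof -
        have "?Q n \<omega> = (\<Sum>i<n. \<Sum>j<m. (f (x (i, j) \<omega>))\<^sup>2)"
          by (simp add: sum.cartesian_product case_prod_unfold)
        also have "\<dots> = (\<Sum>j<m. \<Sum>i<n. (f (x (i, j) \<omega>))\<^sup>2)" by (rule sum.swap)
        finally show ?thesis .
      qed
      have S_eq: "?S n \<omega> = (\<Sum>j<m. (\<Sum>i<n. f (x (i, j) \<omega>))\<^sup>2)"
        by (simp only: sum_column)
      have "?S n \<omega> / n \<le> real m * ?s + t * m * n"
        using S n by (simp add: divide_le_eq power2_eq_square algebra_simps)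
      hence "real n * real m * ?s - t * n * m - (real m * ?s + t * m * n) \<le> ?Q n \<omega> - ?S n \<omega> / n"
        using Q by linarith
      \<comment> \<open>Passing from n to n - 1 costs a factor of at most 2, as n \<ge> 2.\<close>
      moreover have "real m * (t * (2 * real n)) \<le> real m * (t * (4 * (real n - 1)))"
        using n \<open>t > 0\<close> by (intro mult_left_mono) auto
      ultimately have "(?s - 4 * t) * (real m * (real n - 1)) \<le> ?Q n \<omega> - ?S n \<omega> / n"
        by (simp add: algebra_simps)
      hence "?s - 4 * t \<le> (?Q n \<omega> - ?S n \<omega> / n) / (real n - 1) / m"
        using n m1 by (simp add: le_divide_eq mult.commute mult.left_commute)
      also have "\<dots> = sample_var (\<lambda>i j. f (x (i, j) \<omega>)) m n"
        using n unfolding Q_eq S_eq by (subst sample_var_eq) auto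
      also have "\<dots> \<le> sample_var (noise_array \<omega>) m n"
        by (rule sample_var_mono[OF n lip])
      finally show ?thesis using f2 by (simp add: t_def algebra_simps)
    qed
    moreover have "(\<Union>n. A n) \<in> events" using A_sets by auto
    ultimately show ?thesis by blast
  qed
  thus ?thesis by blast
qed

text \<open>For i < k, the product of \<open>running\<close> at i and at k with x (i, j) depends
  only on repetitions before k. It is therefore independent of x (k, j), which has mean zero, and
  the stopped increments are orthogonal. Their squares have expectation at most \<open>v\<close>, so
  Markov's inequality concludes.\<close>

lemma stopped_increments:
  assumes "t > 0" "p \<le> q"
  shows "prob {\<omega> \<in> space M. (\<Sum>j<m. (\<Sum>i\<in>{p..<q}. running (noise_array \<omega>) m b i * x (i, j) \<omega>)\<^sup>2) \<ge> t}
    \<le> m * (real (q - p) * v) / t"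
proof -
  let ?r = "\<lambda>i \<omega>. running (noise_array \<omega>) m b i"
  have r_m [measurable]: "?r i \<in> borel_measurable M" for i unfolding running_def by measurable
  have int: "integrable M (\<lambda>\<omega>. (?r i \<omega> * x (i, j) \<omega>) * (?r k \<omega> * x (k, j) \<omega>))" for i k j
  proof (rule Bochner_Integration.integrable_bound)
    show "integrable M (\<lambda>\<omega>. (x (i, j) \<omega>)\<^sup>2 + (x (k, j) \<omega>)\<^sup>2)"
      using square_integrable by simp
    have "\<bar>(?r i \<omega> * x (i, j) \<omega>) * (?r k \<omega> * x (k, j) \<omega>)\<bar> \<le> (x (i, j) \<omega>)\<^sup>2 + (x (k, j) \<omega>)\<^sup>2" for \<omega>
    proof -
      have "\<bar>(?r i \<omega> * x (i, j) \<omega>) * (?r k \<omega> * x (k, j) \<omega>)\<bar>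
          = (?r i \<omega> * ?r k \<omega>) * (\<bar>x (i, j) \<omega>\<bar> * \<bar>x (k, j) \<omega>\<bar>)"
        by (simp add: abs_mult running_bounds)
      also have "\<dots> \<le> 1 * (\<bar>x (i, j) \<omega>\<bar> * \<bar>x (k, j) \<omega>\<bar>)"
        by (intro mult_right_mono mult_le_one running_bounds) auto
      also have "\<dots> \<le> (x (i, j) \<omega>)\<^sup>2 + (x (k, j) \<omega>)\<^sup>2"
        using zero_le_power2[of "\<bar>x (i, j) \<omega>\<bar> - \<bar>x (k, j) \<omega>\<bar>"] zero_le_power2[of "x (i, j) \<omega>"]
          zero_le_power2[of "x (k, j) \<omega>"] unfolding power2_diff power2_abs by linarith
      finally show ?thesis .
    qed
    thus "AE \<omega> in M. norm ((?r i \<omega> * x (i, j) \<omega>) * (?r k \<omega> * x (k, j) \<omega>))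
        \<le> norm ((x (i, j) \<omega>)\<^sup>2 + (x (k, j) \<omega>)\<^sup>2)"
      by (intro AE_I2) (auto intro: order_trans[OF _ abs_ge_self])
  qed measurable
  have less: "expectation (\<lambda>\<omega>. (?r i \<omega> * x (i, j) \<omega>) * (?r k \<omega> * x (k, j) \<omega>)) = 0" if "i < k" for i k j
  proof -
    let ?A = "{..<k} \<times> (UNIV :: nat set)"
    \<comment> \<open>The past as a function of the array restricted to repetitions below
      \<open>k\<close>. On that restriction the sample variances up to size \<open>k\<close> are
      unchanged, so independence of disjoint index sets applies.\<close>
    define F where "F y = running (\<lambda>i j. y (i, j)) m b i * running (\<lambda>i j. y (i, j)) m b k * y (i, j)"
      for y :: "nat \<times> nat \<Rightarrow> real"
    have comp: "(\<lambda>y. y (a, c)) \<in> borel_measurable (PiM ?A (\<lambda>_. borel))" if "a < k" for a c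
      using that by (intro measurable_component_singleton) auto
    have sv: "(\<lambda>y. sample_var (\<lambda>i j. y (i, j)) m n) \<in> borel_measurable (PiM ?A (\<lambda>_. borel))"
      if "n \<le> k" for n
      unfolding sample_var_def sample_mean_def using that
      by (intro borel_measurable_divide borel_measurable_sum borel_measurable_power
          borel_measurable_diff borel_measurable_const comp) auto
    have run: "(\<lambda>y. running (\<lambda>i j. y (i, j)) m b l) \<in> borel_measurable (PiM ?A (\<lambda>_. borel))"
      if "l \<le> k" for l
      unfolding running_def
    proof (rule borel_measurable_prod)
      fix n assume "n \<in> {2..l}"
      hence [measurable]: "(\<lambda>y. sample_var (\<lambda>i j. y (i, j)) m n) \<in> borel_measurable (PiM ?A (\<lambda>_. borel))"
        using that by (intro sv) auto
      show "(\<lambda>y. if sample_var (\<lambda>i j. y (i, j)) m n \<le> n * b then 0 else 1 :: real)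
          \<in> borel_measurable (PiM ?A (\<lambda>_. borel))" by measurable
    qed
    have F: "F \<in> borel_measurable (PiM ?A (\<lambda>_. borel))"
      unfolding F_def using that by (intro borel_measurable_times run comp) auto
    have G: "(\<lambda>y. y (k, j)) \<in> borel_measurable (PiM {(k, j)} (\<lambda>_. borel))"
      by (intro measurable_component_singleton) auto
    have "indep_var (PiM ?A (\<lambda>_. borel)) (\<lambda>\<omega>. restrict (\<lambda>i. x i \<omega>) ?A)
        (PiM {(k, j)} (\<lambda>_. borel)) (\<lambda>\<omega>. restrict (\<lambda>i. x i \<omega>) {(k, j)})"
      by (rule indep_var_restrict[OF indep]) auto
    from indep_var_compose[OF this F G]
    have ind: "indep_var borel (\<lambda>\<omega>. F (restrict (\<lambda>i. x i \<omega>) ?A)) borel (x (k, j))"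
      by (simp add: comp_def)
    have sv_eq: "sample_var (\<lambda>i j. restrict (\<lambda>i. x i \<omega>) ?A (i, j)) m n = sample_var (noise_array \<omega>) m n"
      if "n \<le> k" for n \<omega>
      using that by (intro sample_var_cong) auto
    have run_eq: "running (\<lambda>i j. restrict (\<lambda>i. x i \<omega>) ?A (i, j)) m b l = ?r l \<omega>" if "l \<le> k" for l \<omega>
      unfolding running_def
    proof (rule prod.cong[OF refl])
      fix n assume "n \<in> {2..l}"
      hence "n \<le> k" using that by simp
      from sv_eq[OF this] show "(if sample_var (\<lambda>i j. restrict (\<lambda>i. x i \<omega>) ?A (i, j)) m n \<le> n * b then 0 else 1)
          = (if sample_var (noise_array \<omega>) m n \<le> n * b then 0 else 1 :: real)" by (simp only:)
    qed
    have F_eq: "F (restrict (\<lambda>i. x i \<omega>) ?A) = ?r i \<omega> * ?r k \<omega> * x (i, j) \<omega>" for \<omega>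
      unfolding F_def using that by (subst (1 2) run_eq) auto
    have W_int: "integrable M (\<lambda>\<omega>. ?r i \<omega> * ?r k \<omega> * x (i, j) \<omega>)"
    proof (rule Bochner_Integration.integrable_bound[OF x_integrable[of "(i, j)"]])
      have "norm (?r i \<omega> * ?r k \<omega> * x (i, j) \<omega>) \<le> norm (x (i, j) \<omega>)" for \<omega>
      proof -
        have "norm (?r i \<omega> * ?r k \<omega> * x (i, j) \<omega>) = ?r i \<omega> * ?r k \<omega> * \<bar>x (i, j) \<omega>\<bar>"
          by (simp add: abs_mult running_bounds)
        also have "\<dots> \<le> 1 * \<bar>x (i, j) \<omega>\<bar>" by (intro mult_right_mono mult_le_one running_bounds) auto
        finally show ?thesis by simp
      qed
      thus "AE \<omega> in M. norm (?r i \<omega> * ?r k \<omega> * x (i, j) \<omega>) \<le> norm (x (i, j) \<omega>)" by simp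
    qed measurable
    have "expectation (\<lambda>\<omega>. (?r i \<omega> * ?r k \<omega> * x (i, j) \<omega>) * x (k, j) \<omega>) = 0"
      using indep_var_lebesgue_integral[OF ind[unfolded F_eq] W_int x_integrable] mean by simp
    thus ?thesis by (simp add: mult_ac)
  qed
  have neq: "expectation (\<lambda>\<omega>. (?r i \<omega> * x (i, j) \<omega>) * (?r k \<omega> * x (k, j) \<omega>)) = 0" if "i \<noteq> k" for i k j
    using less[of i k j] less[of k i j] that by (cases "i < k") (auto simp: mult.commute)
  let ?D = "\<lambda>j \<omega>. \<Sum>i\<in>{p..<q}. ?r i \<omega> * x (i, j) \<omega>"
  have D: "integrable M (\<lambda>\<omega>. (?D j \<omega>)\<^sup>2)"
    "expectation (\<lambda>\<omega>. (?D j \<omega>)\<^sup>2) = (\<Sum>i\<in>{p..<q}. expectation (\<lambda>\<omega>. (?r i \<omega> * x (i, j) \<omega>)\<^sup>2))" for j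
    by (intro expectation_square_sum int neq; simp)+
  have "expectation (\<lambda>\<omega>. (?r i \<omega> * x (i, j) \<omega>)\<^sup>2) \<le> v" for i j
  proof -
    have "expectation (\<lambda>\<omega>. (?r i \<omega> * x (i, j) \<omega>)\<^sup>2) \<le> expectation (\<lambda>\<omega>. (x (i, j) \<omega>)\<^sup>2)"
    proof (rule integral_mono[OF _ square_integrable])
      show "integrable M (\<lambda>\<omega>. (?r i \<omega> * x (i, j) \<omega>)\<^sup>2)" using int[of i j i] by (simp add: power2_eq_square)
      fix \<omega>
      have "(?r i \<omega>)\<^sup>2 * (x (i, j) \<omega>)\<^sup>2 \<le> 1 * (x (i, j) \<omega>)\<^sup>2"
        by (intro mult_right_mono power_le_one running_bounds) auto
      thus "(?r i \<omega> * x (i, j) \<omega>)\<^sup>2 \<le> (x (i, j) \<omega>)\<^sup>2" by (simp add: power_mult_distrib)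
    qed
    also have "\<dots> = v" by (rule expectation_ident) measurable
    finally show ?thesis .
  qed
  hence "expectation (\<lambda>\<omega>. (?D j \<omega>)\<^sup>2) \<le> real (card {p..<q}) * v" for j
    unfolding D(2) by (intro sum_bounded_above)
  hence "(\<Sum>j<m. expectation (\<lambda>\<omega>. (?D j \<omega>)\<^sup>2)) \<le> real (card {..<m}) * (real (q - p) * v)"
    by (intro sum_bounded_above) simp
  hence ED: "expectation (\<lambda>\<omega>. \<Sum>j<m. (?D j \<omega>)\<^sup>2) \<le> m * (real (q - p) * v)"
    using D(1) by (simp add: Bochner_Integration.integral_sum)
  have "prob {\<omega> \<in> space M. (\<Sum>j<m. (?D j \<omega>)\<^sup>2) \<ge> t} \<le> expectation (\<lambda>\<omega>. \<Sum>j<m. (?D j \<omega>)\<^sup>2) / t"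
    using D(1) assms by (intro integral_Markov_inequality_measure) (auto intro!: AE_I2 sum_nonneg)
  also have "\<dots> \<le> m * (real (q - p) * v) / t" using ED assms by (intro divide_right_mono) auto
  finally show ?thesis .
qed

text \<open>With b = delta^2 c^2 / m, the conclusion says that the averages have squared error at
  most \<tau>^2 b m = (\<tau> delta c)^2. If the variance were known, about T = v / b repetitions
  would be taken. The tolerance \<open>b\<close> is quantified after \<open>m0\<close>, because in
  the application it depends on m without any rate.\<close>

theorem repetitions_suffice:
  assumes "\<tau> > 1" "\<eta> > 0"
  shows "\<exists>m0. \<forall>m\<ge>m0. \<forall>b::real>0. \<exists>G\<in>events. 1 - \<eta> \<le> prob G \<and> (\<forall>\<omega>\<in>G. \<exists>N.
    N = (LEAST n. 2 \<le> n \<and> sample_var (noise_array \<omega>) m n \<le> n * b) \<and> 2 \<le> N \<and>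
    (\<Sum>j<m. (\<Sum>i<N. x (i, j) \<omega>)\<^sup>2) \<le> \<tau>\<^sup>2 * b * m * (real N)\<^sup>2)"
proof (cases "v = 0")
  \<comment> \<open>Without variance the noise vanishes almost surely, and the rule stops at its
    smallest admissible value 2.\<close>
  case True
  have "AE \<omega> in M. x p \<omega> = 0" for p
  proof -
    have "expectation (\<lambda>\<omega>. (x p \<omega>)\<^sup>2) = 0"
      using True expectation_ident[of "\<lambda>u. u\<^sup>2" p] by simp
    hence "AE \<omega> in M. (x p \<omega>)\<^sup>2 = 0"
      by (subst (asm) integral_nonneg_eq_0_iff_AE) (auto intro: square_integrable)
    thus ?thesis by simp
  qed
  hence "AE \<omega> in M. \<forall>p. x p \<omega> = 0" by (simp add: AE_all_countable)
  moreover have "{\<omega> \<in> space M. \<forall>p. x p \<omega> = 0} \<in> events" by measurable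
  ultimately have G: "prob {\<omega> \<in> space M. \<forall>p. x p \<omega> = 0} = 1" by (simp add: prob_Collect_eq_1)
  have "\<exists>N. N = (LEAST n. 2 \<le> n \<and> sample_var (noise_array \<omega>) m n \<le> n * b) \<and> 2 \<le> N \<and>
      (\<Sum>j<m. (\<Sum>i<N. x (i, j) \<omega>)\<^sup>2) \<le> \<tau>\<^sup>2 * b * m * (real N)\<^sup>2"
    if "b > 0" "\<forall>p. x p \<omega> = 0" for \<omega> m and b :: real
  proof -
    have "(LEAST n. 2 \<le> n \<and> sample_var (noise_array \<omega>) m n \<le> n * b) = 2"
      using that by (intro Least_equality) (auto simp: sample_var_def sample_mean_def)
    thus ?thesis using that by simp
  qed
  thus ?thesis using G \<open>{\<omega> \<in> space M. \<forall>p. x p \<omega> = 0} \<in> events\<close> assms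
    by (intro exI allI impI bexI[of _ "{\<omega> \<in> space M. \<forall>p. x p \<omega> = 0}"]) auto
next
  case False
  moreover have "v \<ge> 0" by simp
  ultimately have v: "v > 0" by linarith
  \<comment> \<open>The final factor (1 + \<kappa>)^2 + \<kappa> is at most 1 + 4 \<kappa>, hence at
    most halfway between 1 and \<tau>^2.\<close>
  define \<kappa> where "\<kappa> = min 1 ((\<tau>\<^sup>2 - 1) / 8)"
  have tau2: "\<tau>\<^sup>2 > 1" using assms by (simp add: one_less_power)
  have \<kappa>: "0 < \<kappa>" "\<kappa> \<le> 1" "\<kappa> \<le> (\<tau>\<^sup>2 - 1) / 8" using tau2 by (auto simp: \<kappa>_def min_def)
  define \<eta>' where "\<eta>' = \<eta> / 5"
  have "\<eta>' > 0" using assms by (simp add: \<eta>'_def)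
  \<comment> \<open>Solves (1 + 1 / \<kappa>) h = \<kappa>: the admissible share of the sum over the
    window in \<open>square_add_le\<close>.\<close>
  define h where "h = \<kappa> / (1 + 1 / \<kappa>)"
  have "1 + 1 / \<kappa> > 0" using \<kappa> by (simp add: add_pos_pos)
  hence "h > 0" using \<kappa> by (simp add: h_def)
  \<comment> \<open>The first two entries give \<tau>^2 (1 - \<epsilon>) \<ge> (\<tau>^2 + 1) / 2,
    for \<tau>^2 above and below 10 respectively; the third bounds the failure probability 6
    \<epsilon> / h of the window by \<eta>'.\<close>
  define \<epsilon> where "\<epsilon> = min (1 / 4) (min ((\<tau>\<^sup>2 - 1) / 20) (\<eta>' * h / 6))"
  have \<epsilon>: "0 < \<epsilon>" "\<epsilon> \<le> 1 / 4" "\<epsilon> \<le> (\<tau>\<^sup>2 - 1) / 20" "6 * \<epsilon> \<le> \<eta>' * h"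
    using tau2 \<open>\<eta>' > 0\<close> \<open>h > 0\<close> by (auto simp: \<epsilon>_def min_def)
  have const: "((1 + \<kappa>) * (1 + \<kappa>) + \<kappa>) \<le> \<tau>\<^sup>2 * (1 - \<epsilon>)"
  proof -
    have "\<kappa> * \<kappa> \<le> 1 * \<kappa>" using \<kappa> by (intro mult_right_mono) auto
    hence "(1 + \<kappa>) * (1 + \<kappa>) + \<kappa> \<le> 1 + 4 * \<kappa>" by (simp add: algebra_simps)
    also have "\<dots> \<le> 1 + (\<tau>\<^sup>2 - 1) / 2" using \<kappa> by simp
    also have "\<dots> \<le> \<tau>\<^sup>2 - \<tau>\<^sup>2 * \<epsilon>"
    proof (cases "\<tau>\<^sup>2 \<le> 10")
      case True
      have "\<tau>\<^sup>2 * \<epsilon> \<le> 10 * \<epsilon>" using True \<epsilon> by (intro mult_right_mono) auto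
      moreover have "1 + (u - 1) / 2 \<le> u - w" if "w \<le> 10 * e" "e \<le> (u - 1) / 20" for u w e :: real
        using that by argo
      ultimately show ?thesis using \<epsilon>(3) by blast
    next
      case False
      have "\<tau>\<^sup>2 * \<epsilon> \<le> \<tau>\<^sup>2 * (1 / 4)" using \<epsilon> by (intro mult_left_mono) auto
      moreover have "1 + (u - 1) / 2 \<le> u - w" if "w \<le> u * (1 / 4)" "\<not> u \<le> 10" for u w :: real
        using that by argo
      ultimately show ?thesis using False by blast
    qed
    finally show ?thesis by (simp add: right_diff_distrib)
  qed
  \<comment> \<open>Above \<open>T0\<close> the half-width \<epsilon> T of the window exceeds 2 and
    absorbs the rounding of its endpoints. Up to \<open>T0\<close> the stopping time is at most
    \<open>n1\<close>. This number is fixed before m and b, so a union bound with \<eta>' / n1 for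
    each value is available.\<close>
  define T0 where "T0 = 2 / \<epsilon>"
  define n1 where "n1 = nat \<lceil>4 * T0\<rceil> + 2"
  have n1: "2 \<le> n1" "4 * T0 \<le> n1" unfolding n1_def by linarith+
  obtain mA where mA: "\<And>m. m \<ge> mA \<Longrightarrow> \<exists>E\<in>events. prob E \<le> \<eta>' \<and>
      (\<forall>\<omega>\<in>space M - E. \<forall>n\<ge>2. (1 - \<epsilon>) * v \<le> sample_var (noise_array \<omega>) m n)"
    using sample_var_lower[OF v \<epsilon>(1) \<open>\<eta>' > 0\<close>] by blast
  obtain mB where mB: "\<And>m n. m \<ge> mB \<Longrightarrow> n \<ge> 2 \<Longrightarrow>
      prob {\<omega> \<in> space M. sample_var (noise_array \<omega>) m n > n / (real n - 1) * ((1 + \<epsilon>) * v)} \<le> \<eta>'"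
    using sample_var_upper[OF v \<epsilon>(1) \<open>\<eta>' > 0\<close>] by blast
  obtain mC where mC: "\<And>m n. m \<ge> mC \<Longrightarrow> n > 0 \<Longrightarrow>
      prob {\<omega> \<in> space M. (\<Sum>j<m. (\<Sum>i<n. x (i, j) \<omega>)\<^sup>2) > (1 + \<kappa>) * v * m * n} \<le> \<eta>' / n1"
    using sum_squares_tail[OF v \<kappa>(1), of "\<eta>' / n1"] \<open>\<eta>' > 0\<close> n1 by auto
  have "\<exists>G\<in>events. 1 - \<eta> \<le> prob G \<and> (\<forall>\<omega>\<in>G. \<exists>N.
      N = (LEAST n. 2 \<le> n \<and> sample_var (noise_array \<omega>) m n \<le> n * b) \<and> 2 \<le> N \<and>
      (\<Sum>j<m. (\<Sum>i<N. x (i, j) \<omega>)\<^sup>2) \<le> \<tau>\<^sup>2 * b * m * (real N)\<^sup>2)"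
    if m: "m \<ge> mA" "m \<ge> mB" "m \<ge> mC" "m \<ge> 1" and "b > 0" for m and b :: real
  proof -
    let ?P = "\<lambda>\<omega> n. 2 \<le> n \<and> sample_var (noise_array \<omega>) m n \<le> real n * b"
    let ?S = "\<lambda>n \<omega>. \<Sum>j<m. (\<Sum>i<n. x (i, j) \<omega>)\<^sup>2"
    define N where "N \<omega> = (LEAST n. ?P \<omega> n)" for \<omega>
    define T where "T = v / b"
    have T: "T > 0" "v = T * b" using v \<open>b > 0\<close> by (auto simp: T_def)
    obtain A where A: "A \<in> events" "prob A \<le> \<eta>'"
      "\<And>\<omega> n. \<omega> \<in> space M - A \<Longrightarrow> n \<ge> 2 \<Longrightarrow> (1 - \<epsilon>) * v \<le> sample_var (noise_array \<omega>) m n"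
      using mA[OF m(1)] by blast
    define B where "B n = {\<omega> \<in> space M. sample_var (noise_array \<omega>) m n > n / (real n - 1) * ((1 + \<epsilon>) * v)}" for n
    define C where "C n = {\<omega> \<in> space M. ?S n \<omega> > (1 + \<kappa>) * v * m * n}" for n
    have BC [measurable]: "B n \<in> events" "C n \<in> events" for n
      unfolding B_def C_def by measurable
    \<comment> \<open>Whatever bounds \<open>N\<close> from above also guarantees that the minimum exists.\<close>
    have N: "?P \<omega> (N \<omega>)" "N \<omega> \<le> n" "(1 - \<epsilon>) * T \<le> N \<omega>"
      "\<And>i. running (noise_array \<omega>) m b i = (if i < N \<omega> then 1 else 0)"
      if "\<omega> \<in> space M" "\<omega> \<notin> A" "\<omega> \<notin> B n" "n \<ge> 2" "(1 + \<epsilon>) * T \<le> real n - 1" for \<omega> n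
    proof -
      have "sample_var (noise_array \<omega>) m n \<le> n / (real n - 1) * ((1 + \<epsilon>) * v)"
        using that by (auto simp: B_def)
      also have "\<dots> = n * b * ((1 + \<epsilon>) * T / (real n - 1))" by (simp add: T(2))
      also have "\<dots> \<le> n * b * 1"
        using that \<open>b > 0\<close> by (intro mult_left_mono) (auto simp: divide_le_eq)
      finally have Pn: "?P \<omega> n" using that by simp
      show P: "?P \<omega> (N \<omega>)" unfolding N_def by (rule LeastI[of "?P \<omega>", OF Pn])
      show "N \<omega> \<le> n" unfolding N_def by (rule Least_le[of "?P \<omega>", OF Pn])
      have "(1 - \<epsilon>) * T * b \<le> N \<omega> * b"
        using A(3)[of \<omega> "N \<omega>"] P that by (simp add: T(2) mult.assoc)
      thus "(1 - \<epsilon>) * T \<le> N \<omega>" using \<open>b > 0\<close> by simp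
      show "running (noise_array \<omega>) m b i = (if i < N \<omega> then 1 else 0)" for i
        using P not_less_Least[of _ "?P \<omega>"] unfolding N_def[symmetric] by (intro running_eq) auto
    qed
    \<comment> \<open>Writing v = T b and using (1 - \<epsilon>) T \<le> N exchanges the factor T
      for a second factor N.\<close>
    have conclude: "\<exists>N. N = (LEAST n. ?P \<omega> n) \<and> 2 \<le> N \<and> ?S N \<omega> \<le> \<tau>\<^sup>2 * b * m * (real N)\<^sup>2"
      if "?P \<omega> (N \<omega>)" "(1 - \<epsilon>) * T \<le> N \<omega>"
        "?S (N \<omega>) \<omega> \<le> ((1 + \<kappa>) * (1 + \<kappa>) + \<kappa>) * (v * m * N \<omega>)" for \<omega>
    proof -
      note that(3)
      also have "((1 + \<kappa>) * (1 + \<kappa>) + \<kappa>) * (v * m * N \<omega>) \<le> \<tau>\<^sup>2 * (1 - \<epsilon>) * (v * m * N \<omega>)"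
        using v by (intro mult_right_mono const) auto
      also have "\<dots> = \<tau>\<^sup>2 * b * m * N \<omega> * ((1 - \<epsilon>) * T)" by (simp add: T(2))
      also have "\<dots> \<le> \<tau>\<^sup>2 * b * m * N \<omega> * N \<omega>"
        using that(2) \<open>b > 0\<close> by (intro mult_left_mono) auto
      finally show ?thesis using that(1) by (simp add: N_def power2_eq_square mult.assoc)
    qed
    have \<open>\<exists>Bad\<in>events. prob Bad \<le> \<eta> \<and> (\<forall>\<omega>\<in>space M - Bad. ?P \<omega> (N \<omega>) \<and> (1 - \<epsilon>) * T \<le> N \<omega> \<and>
        ?S (N \<omega>) \<omega> \<le> ((1 + \<kappa>) * (1 + \<kappa>) + \<kappa>) * (v * m * N \<omega>))\<close>
    proof (cases "T \<le> T0")
      case True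
      let ?U = "\<Union>n\<in>{1..n1}. C n"
      let ?Bad = "A \<union> B n1 \<union> ?U"
      have "prob ?U \<le> (\<Sum>n\<in>{1..n1}. prob (C n))"
        by (rule finite_measure_subadditive_finite) auto
      also have "\<dots> \<le> (\<Sum>n\<in>{1..n1}. \<eta>' / n1)"
        unfolding C_def by (intro sum_mono mC m) auto
      also have "\<dots> = \<eta>'" using n1 by simp
      finally have "prob ?U \<le> \<eta>'" .
      moreover have "prob (B n1) \<le> \<eta>'" unfolding B_def using n1 by (intro mB m)
      moreover have "prob ?Bad \<le> prob A + prob (B n1) + prob ?U"
        using A(1) by (intro order_trans[OF measure_Un_le] add_right_mono measure_Un_le) auto
      ultimately have "prob ?Bad \<le> \<eta>" using A(2) \<open>\<eta>' > 0\<close> by (simp add: \<eta>'_def)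
      moreover have "?P \<omega> (N \<omega>) \<and> (1 - \<epsilon>) * T \<le> N \<omega> \<and>
        ?S (N \<omega>) \<omega> \<le> ((1 + \<kappa>) * (1 + \<kappa>) + \<kappa>) * (v * m * N \<omega>)" if "\<omega> \<in> space M - ?Bad" for \<omega>
      proof -
        have "(1 + \<epsilon>) * T \<le> 2 * T" using \<epsilon> T by (intro mult_right_mono) auto
        also have "2 * T \<le> real n1 - 1" using n1 True by linarith
        finally have *: "(1 + \<epsilon>) * T \<le> real n1 - 1" .
        have "\<omega> \<in> space M" "\<omega> \<notin> A" "\<omega> \<notin> B n1" using that by auto
        note N' = N[OF this n1(1) *]
        hence "N \<omega> \<in> {1..n1}" by auto
        hence "\<omega> \<notin> C (N \<omega>)" using that by auto
        hence "?S (N \<omega>) \<omega> \<le> (1 + \<kappa>) * (v * m * N \<omega>)"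
          using that by (simp add: C_def mult.assoc)
        also have "\<dots> \<le> ((1 + \<kappa>) * (1 + \<kappa>) + \<kappa>) * (v * m * N \<omega>)"
          using v \<kappa> by (intro mult_right_mono) (auto simp: algebra_simps)
        finally show ?thesis using N' by blast
      qed
      moreover have "?Bad \<in> events" using A(1) by auto
      ultimately show ?thesis by blast
    next
      case False
      \<comment> \<open>The endpoints of the window. The extra 1 in \<open>q\<close> pays for the
        factor n / (n - 1) in the upper bound on the sample variance.\<close>
      define p where "p = nat \<lceil>(1 - \<epsilon>) * T\<rceil>"
      define q where "q = nat \<lceil>(1 + \<epsilon>) * T\<rceil> + 1"
      have eT: "2 < \<epsilon> * T" using False \<epsilon> by (simp add: T0_def field_simps)
      have pT: "0 < (1 - \<epsilon>) * T" "(1 - \<epsilon>) * T \<le> (1 + \<epsilon>) * T"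
        using \<epsilon> T by (auto intro: mult_right_mono)
      have p: "(1 - \<epsilon>) * T \<le> p" "p > 0" unfolding p_def using pT by linarith+
      have q: "(1 + \<epsilon>) * T \<le> real q - 1" "real q \<le> (1 + \<epsilon>) * T + 2" unfolding q_def using pT by linarith+
      have q2: "q \<ge> 2" using q pT unfolding q_def by linarith
      have "p \<le> q" unfolding p_def q_def using pT by linarith
      have pq: "real (q - p) \<le> 3 * \<epsilon> * T"
        using p q eT \<open>p \<le> q\<close> by (simp add: algebra_simps)
      have Tp: "T \<le> 2 * p"
      proof -
        have "1 / 2 * T \<le> (1 - \<epsilon>) * T" using \<epsilon> T by (intro mult_right_mono) auto
        thus ?thesis using p by linarith
      qed
      let ?D = "\<lambda>j \<omega>. \<Sum>i\<in>{p..<q}. running (noise_array \<omega>) m b i * x (i, j) \<omega>"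
      define t where "t = h * (v * m * p)"
      have "t > 0" using \<open>h > 0\<close> v m p by (simp add: t_def)
      define F where "F = {\<omega> \<in> space M. (\<Sum>j<m. (?D j \<omega>)\<^sup>2) \<ge> t}"
      have F [measurable]: "F \<in> events" unfolding F_def running_def by measurable
      have "prob F \<le> m * (real (q - p) * v) / t"
        unfolding F_def by (rule stopped_increments) (use \<open>t > 0\<close> \<open>p \<le> q\<close> in auto)
      also have "\<dots> \<le> m * ((6 * \<epsilon> * p) * v) / t"
      proof -
        note pq
        also have "3 * \<epsilon> * T \<le> 3 * \<epsilon> * (2 * real p)" using Tp \<epsilon> by (intro mult_left_mono) auto
        also have "\<dots> = 6 * \<epsilon> * p" by simp
        finally have "real (q - p) \<le> 6 * \<epsilon> * p" .
        thus ?thesis using \<open>t > 0\<close> v by (intro divide_right_mono mult_left_mono mult_right_mono) auto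
      qed
      also have "\<dots> = 6 * \<epsilon> / h" using v m p by (simp add: t_def)
      also have "\<dots> \<le> \<eta>'" using \<epsilon>(4) \<open>h > 0\<close> by (simp add: divide_le_eq)
      finally have "prob F \<le> \<eta>'" .
      let ?Bad = "A \<union> B q \<union> C p \<union> F"
      have "prob ?Bad \<le> prob A + prob (B q) + prob (C p) + prob F"
        using A(1) by (intro order_trans[OF measure_Un_le] add_right_mono measure_Un_le) auto
      moreover have "prob (B q) \<le> \<eta>'" unfolding B_def using q2 by (intro mB m)
      moreover have "prob (C p) \<le> \<eta>'"
      proof -
        have "prob (C p) \<le> \<eta>' / n1" unfolding C_def using p by (intro mC m)
        also have "\<dots> \<le> \<eta>' / 1" using n1 \<open>\<eta>' > 0\<close> by (intro divide_left_mono) auto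
        finally show ?thesis by simp
      qed
      ultimately have "prob ?Bad \<le> \<eta>" using A(2) \<open>prob F \<le> \<eta>'\<close> \<open>\<eta>' > 0\<close> by (simp add: \<eta>'_def)
      moreover have "?P \<omega> (N \<omega>) \<and> (1 - \<epsilon>) * T \<le> N \<omega> \<and>
        ?S (N \<omega>) \<omega> \<le> ((1 + \<kappa>) * (1 + \<kappa>) + \<kappa>) * (v * m * N \<omega>)" if "\<omega> \<in> space M - ?Bad" for \<omega>
      proof -
        have "\<omega> \<in> space M" "\<omega> \<notin> A" "\<omega> \<notin> B q" using that by auto
        note N' = N[OF this q2 q(1)]
        have "p \<le> N \<omega>" using N'(3) unfolding p_def by linarith
        \<comment> \<open>As p \<le> N \<le> q, the indicator cuts the sum over the fixed window off
          at the random N.\<close>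
        have split: "(\<Sum>i<N \<omega>. x (i, j) \<omega>) = (\<Sum>i<p. x (i, j) \<omega>) + ?D j \<omega>" for j
        proof -
          have "?D j \<omega> = (\<Sum>i\<in>{p..<N \<omega>}. x (i, j) \<omega>)"
            using N'(2) by (intro sum.mono_neutral_cong_right) (auto simp: N'(4))
          thus ?thesis using \<open>p \<le> N \<omega>\<close>
            by (simp add: lessThan_atLeast0 sum.atLeastLessThan_concat)
        qed
        have "?S (N \<omega>) \<omega> \<le> (\<Sum>j<m. (1 + \<kappa>) * (\<Sum>i<p. x (i, j) \<omega>)\<^sup>2 + (1 + 1 / \<kappa>) * (?D j \<omega>)\<^sup>2)"
          unfolding split by (intro sum_mono square_add_le \<kappa>)
        also have "\<dots> = (1 + \<kappa>) * ?S p \<omega> + (1 + 1 / \<kappa>) * (\<Sum>j<m. (?D j \<omega>)\<^sup>2)"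
          by (simp add: sum.distrib sum_distrib_left)
        also have "\<dots> \<le> (1 + \<kappa>) * ((1 + \<kappa>) * (v * m * p)) + (1 + 1 / \<kappa>) * t"
          using that \<kappa> \<open>1 + 1 / \<kappa> > 0\<close> by (intro add_mono mult_left_mono) (auto simp: C_def F_def mult.assoc)
        also have "(1 + 1 / \<kappa>) * t = \<kappa> * (v * m * p)"
        proof -
          have cancel: "c * (a / c * d) = a * d" if "c > 0" for a c d :: real using that by simp
          show ?thesis unfolding t_def h_def by (rule cancel) fact
        qed
        also have "(1 + \<kappa>) * ((1 + \<kappa>) * (v * m * p)) + \<kappa> * (v * m * p)
            = ((1 + \<kappa>) * (1 + \<kappa>) + \<kappa>) * (v * m * p)" by (simp add: algebra_simps)
        also have "\<dots> \<le> ((1 + \<kappa>) * (1 + \<kappa>) + \<kappa>) * (v * m * N \<omega>)"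
          using \<open>p \<le> N \<omega>\<close> v \<kappa> by (intro mult_left_mono) auto
        finally show ?thesis using N' by blast
      qed
      moreover have "?Bad \<in> events" using A(1) by auto
      ultimately show ?thesis by blast
    qed
    then obtain Bad where Bad: "Bad \<in> events" "prob Bad \<le> \<eta>"
      "\<And>\<omega>. \<omega> \<in> space M - Bad \<Longrightarrow> ?P \<omega> (N \<omega>) \<and> (1 - \<epsilon>) * T \<le> N \<omega> \<and>
        ?S (N \<omega>) \<omega> \<le> ((1 + \<kappa>) * (1 + \<kappa>) + \<kappa>) * (v * m * N \<omega>)" by blast
    show ?thesis
    proof (intro bexI conjI ballI)
      show "1 - \<eta> \<le> prob (space M - Bad)" using Bad by (simp add: prob_compl)
    qed (use Bad conclude in auto)
  qed
  thus ?thesis by (intro exI[of _ "max 1 (max mA (max mB mC))"]) simp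
qed

end

section \<open>Discretised measurements\<close>

lemma meas_op_scaleR: "meas_op \<eta> m (r *\<^sub>R y) j = r * meas_op \<eta> m y j"
  by (simp add: meas_op_def)

lemma meas_op_sum: "meas_op \<eta> m (\<Sum>l\<in>L. f l) j = (\<Sum>l\<in>L. meas_op \<eta> m (f l) j)"
  by (simp add: meas_op_def inner_sum_right)

lemma meas_adj_add_scaled:
  "meas_adj \<eta> m (\<lambda>j. u j + r * h j) = meas_adj \<eta> m u + r *\<^sub>R meas_adj \<eta> m h"
  by (simp add: meas_adj_def scaleR_add_left sum.distrib scaleR_sum_right)

lemma quadratic_nonneg_imp_linear_zero:
  fixes a b :: real
  assumes "\<And>t. 0 \<le> 2 * t * a + t\<^sup>2 * b"
  shows "a = 0"
proof (rule ccontr)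
  assume "a \<noteq> 0"
  define s where "s = \<bar>b\<bar> + 1"
  have s: "s > 0" "b \<le> s" by (auto simp: s_def)
  have "(- a / s)\<^sup>2 * b \<le> (- a / s)\<^sup>2 * s" using s by (intro mult_left_mono) auto
  also have "\<dots> = a\<^sup>2 / s" using s by (simp add: power2_eq_square)
  finally have "2 * (- a / s) * a + (- a / s)\<^sup>2 * b \<le> - (a\<^sup>2 / s)" by (simp add: power2_eq_square)
  moreover have "a\<^sup>2 / s > 0" using s \<open>a \<noteq> 0\<close> by simp
  ultimately show False using assms[of "- a / s"] by linarith
qed

text \<open>The minimum of the Rayleigh quotient is attained at an eigenvector of \<open>P\<^sub>m P\<^sub>m\<^sup>*\<close>, so that the
  smallest singular value bounds \<open>P\<^sub>m\<^sup>*\<close> from below.\<close>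

lemma singular_value_lower_bound:
  assumes "1 \<le> m" "0 \<le> c" and sing: "\<And>\<sigma>. \<sigma> \<in> meas_singular_values \<eta> m \<Longrightarrow> c \<le> \<sigma>"
    and u: "u \<in> euclid m"
  shows "c\<^sup>2 * (\<Sum>j<m. (u j)\<^sup>2) \<le> (norm (meas_adj \<eta> m u))\<^sup>2"
proof -
  \<comment> \<open>A cube of R^m inside the function space, with all coordinates from m on fixed at
    0; it is compact by Tychonoff's theorem and contains the unit sphere.\<close>
  define C :: "(nat \<Rightarrow> real) set" where "C = PiE UNIV (\<lambda>j. if j < m then {-1..1} else {0})"
  define S where "S = C \<inter> {u. (\<Sum>j<m. (u j)\<^sup>2) = 1}"
  have "compactin (product_topology (\<lambda>_. euclidean) UNIV) C"
    unfolding C_def compactin_PiE by auto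
  hence "compact C" by (simp add: euclidean_product_topology)
  moreover have "closed {u :: nat \<Rightarrow> real. (\<Sum>j<m. (u j)\<^sup>2) = 1}"
    by (intro closed_Collect_eq continuous_intros continuous_on_product_coordinates)
  ultimately have S: "compact S" unfolding S_def by (rule compact_Int_closed)
  have "(\<lambda>j. if j = 0 then 1 else 0) \<in> S"
    using assms(1) by (auto simp: S_def C_def if_distrib[of "\<lambda>x. x\<^sup>2"] cong: if_cong)
  hence "S \<noteq> {}" by blast
  have cont: "continuous_on S (\<lambda>u. (norm (meas_adj \<eta> m u))\<^sup>2)"
    unfolding meas_adj_def
    by (intro continuous_intros continuous_on_subset[OF continuous_on_product_coordinates]) auto
  obtain u0 where u0: "u0 \<in> S"
    and min: "\<And>u. u \<in> S \<Longrightarrow> (norm (meas_adj \<eta> m u0))\<^sup>2 \<le> (norm (meas_adj \<eta> m u))\<^sup>2"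
    using continuous_attains_inf[OF S \<open>S \<noteq> {}\<close> cont] by blast
  define l where "l = (norm (meas_adj \<eta> m u0))\<^sup>2"
  have u0E: "u0 \<in> euclid m" and u01: "(\<Sum>j<m. (u0 j)\<^sup>2) = 1"
  proof -
    have "u0 \<in> C" using u0 by (simp add: S_def)
    from PiE_mem[OF this[unfolded C_def] UNIV_I] have "u0 j = 0" if "m \<le> j" for j
      using that by (metis not_less singletonD)
    thus "u0 \<in> euclid m" unfolding euclid_def by blast
    show "(\<Sum>j<m. (u0 j)\<^sup>2) = 1" using u0 by (simp add: S_def)
  qed
  have rayleigh: "l * (\<Sum>j<m. (w j)\<^sup>2) \<le> (norm (meas_adj \<eta> m w))\<^sup>2" if w: "w \<in> euclid m" for w
  proof (cases "(\<Sum>j<m. (w j)\<^sup>2) = 0")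
    case False
    define s where "s = sqrt (\<Sum>j<m. (w j)\<^sup>2)"
    have s2: "s\<^sup>2 = (\<Sum>j<m. (w j)\<^sup>2)" unfolding s_def by (simp add: sum_nonneg)
    have "s > 0" using False by (simp add: s_def sum_nonneg less_le)
    have "\<bar>w j\<bar> \<le> s" if "j < m" for j
    proof -
      have "(w j)\<^sup>2 \<le> (\<Sum>j<m. (w j)\<^sup>2)" using that by (intro member_le_sum) auto
      thus ?thesis unfolding s_def by (intro real_le_rsqrt) simp
    qed
    hence bound: "\<bar>w j / s\<bar> \<le> 1" if "j < m" for j using that \<open>s > 0\<close> by simp
    have "(\<lambda>j. w j / s) \<in> C"
      unfolding C_def
    proof (rule PiE_I)
      fix j show "w j / s \<in> (if j < m then {-1..1} else {0})"
        using bound[of j] w by (auto simp: euclid_def simp del: abs_divide)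
    qed simp
    moreover have "(\<Sum>j<m. (w j / s)\<^sup>2) = 1"
      using \<open>s > 0\<close> by (simp add: power_divide s2[symmetric] flip: sum_divide_distrib)
    ultimately have "l \<le> (norm (meas_adj \<eta> m (\<lambda>j. w j / s)))\<^sup>2"
      unfolding l_def by (intro min) (simp add: S_def)
    also have "meas_adj \<eta> m (\<lambda>j. w j / s) = (1 / s) *\<^sub>R meas_adj \<eta> m w"
      by (simp add: meas_adj_def scaleR_sum_right)
    also have "(norm \<dots>)\<^sup>2 = (norm (meas_adj \<eta> m w))\<^sup>2 / s\<^sup>2" by (simp add: power_divide)
    finally show ?thesis using \<open>s > 0\<close> by (simp add: field_simps s2[symmetric])
  qed simp
  have eigen: "meas_op \<eta> m (meas_adj \<eta> m u0) j = l * u0 j" for j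
  proof (cases "j < m")
    case True
    define h where "h i = (if i = j then 1 else 0 :: real)" for i
    have h: "meas_adj \<eta> m h = \<eta> j"
      using True by (simp add: meas_adj_def h_def if_distrib[of "\<lambda>r. r *\<^sub>R _"] cong: if_cong)
    \<comment> \<open>Perturbing the minimiser in coordinate j: the first-order term has to vanish,
      and this is the j-th entry of the eigenvalue equation.\<close>
    have "0 \<le> 2 * t * (meas_adj \<eta> m u0 \<bullet> \<eta> j - l * u0 j) + t\<^sup>2 * ((norm (\<eta> j))\<^sup>2 - l)" for t
    proof -
      have "(\<lambda>i. u0 i + t * h i) \<in> euclid m" using u0E True by (auto simp: euclid_def h_def)
      from rayleigh[OF this]
      have "l * (\<Sum>i<m. (u0 i + t * h i)\<^sup>2) \<le> (norm (meas_adj \<eta> m u0 + t *\<^sub>R \<eta> j))\<^sup>2"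
        by (simp add: meas_adj_add_scaled h)
      also have "\<dots> = l + 2 * t * (meas_adj \<eta> m u0 \<bullet> \<eta> j) + t\<^sup>2 * (norm (\<eta> j))\<^sup>2"
        unfolding norm_power2_add by (simp add: l_def power_mult_distrib)
      also have "(\<Sum>i<m. (u0 i + t * h i)\<^sup>2) = (\<Sum>i<m. (u0 i)\<^sup>2 + (if i = j then 2 * t * u0 j + t\<^sup>2 else 0))"
        by (intro sum.cong refl) (simp add: h_def power2_sum)
      also have "\<dots> = 1 + 2 * t * u0 j + t\<^sup>2" using True by (simp add: sum.distrib u01)
      finally show ?thesis by (simp add: algebra_simps)
    qed
    from quadratic_nonneg_imp_linear_zero[OF this] show ?thesis
      using True by (simp add: meas_op_def inner_commute)
  qed (use u0E in \<open>auto simp: meas_op_def euclid_def\<close>)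
  have "u0 \<noteq> (\<lambda>_. 0)" using u01 by auto
  moreover have "l \<ge> 0" by (simp add: l_def)
  ultimately have "sqrt l \<in> meas_singular_values \<eta> m"
    unfolding meas_singular_values_def using u0E eigen by (auto simp: fun_eq_iff)
  from power_mono[OF sing[OF this] assms(2), of 2] have "c\<^sup>2 \<le> l" using \<open>l \<ge> 0\<close> by simp
  hence "c\<^sup>2 * (\<Sum>j<m. (u j)\<^sup>2) \<le> l * (\<Sum>j<m. (u j)\<^sup>2)" by (intro mult_right_mono sum_nonneg) auto
  also have "\<dots> \<le> (norm (meas_adj \<eta> m u))\<^sup>2" by (rule rayleigh[OF u])
  finally show ?thesis .
qed

text \<open>The vector \<open>meas_adj \<eta> m u\<close> fits the data exactly, so the minimisers
  are the exact solutions. They differ from it by elements of the kernel of the measurement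
  operator, which is orthogonal to the range of \<open>meas_adj\<close>; Pythagoras makes it the
  unique one of least norm.\<close>

lemma meas_pinv_eqI:
  assumes "\<And>j. j < m \<Longrightarrow> meas_op \<eta> m (meas_adj \<eta> m u) j = v j"
  shows "meas_pinv \<eta> m v = meas_adj \<eta> m u"
proof -
  let ?f = "\<lambda>y. L2_set (\<lambda>j. meas_op \<eta> m y j - v j) {..<m}"
  let ?y0 = "meas_adj \<eta> m u"
  have "?f ?y0 = 0" using assms by (simp add: L2_set_def)
  hence sol: "is_arg_min ?f (\<lambda>_. True) y \<longleftrightarrow> (\<forall>j<m. meas_op \<eta> m y j = v j)" for y
  proof -
    have "?f y \<ge> 0" by (rule L2_set_nonneg)
    hence "is_arg_min ?f (\<lambda>_. True) y \<longleftrightarrow> ?f y = 0"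
      using \<open>?f ?y0 = 0\<close> unfolding is_arg_min_def
      by (metis L2_set_nonneg antisym_conv2 linorder_not_less)
    thus ?thesis by (auto simp: L2_set_eq_0_iff)
  qed
  have pyth: "(norm y)\<^sup>2 = (norm ?y0)\<^sup>2 + (norm (y - ?y0))\<^sup>2" if "\<forall>j<m. meas_op \<eta> m y j = v j" for y
  proof -
    have "(y - ?y0) \<bullet> meas_adj \<eta> m u = (\<Sum>j<m. meas_op \<eta> m (y - ?y0) j * u j)"
      by (rule meas_adj_adjoint[symmetric])
    also have "\<dots> = 0"
    proof (rule sum.neutral, rule ballI)
      fix j assume "j \<in> {..<m}"
      hence "meas_op \<eta> m y j = meas_op \<eta> m ?y0 j" using that assms by simp
      moreover have "meas_op \<eta> m (y - ?y0) j = meas_op \<eta> m y j - meas_op \<eta> m ?y0 j"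
        by (simp add: meas_op_def inner_diff_right)
      ultimately show "meas_op \<eta> m (y - ?y0) j * u j = 0" by simp
    qed
    finally have "?y0 \<bullet> (y - ?y0) = 0" by (simp add: inner_commute)
    thus ?thesis using norm_power2_add[of ?y0 "y - ?y0"] by simp
  qed
  let ?Q = "is_arg_min ?f (\<lambda>_. True)"
  have le: "norm ?y0 \<le> norm y" if "?Q y" for y
  proof (rule power2_le_imp_le)
    show "(norm ?y0)\<^sup>2 \<le> (norm y)\<^sup>2" using pyth[of y] that unfolding sol by simp
  qed simp
  have "is_arg_min norm ?Q (meas_pinv \<eta> m v)"
    unfolding meas_pinv_def arg_min_def
    by (rule someI[of _ ?y0]) (use le assms in \<open>auto simp: is_arg_min_def[of norm] not_less sol\<close>)
  hence y: "?Q (meas_pinv \<eta> m v)" and "\<not> norm ?y0 < norm (meas_pinv \<eta> m v)"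
    using assms by (auto simp: is_arg_min_def[of norm] sol)
  hence "(norm (meas_pinv \<eta> m v))\<^sup>2 \<le> (norm ?y0)\<^sup>2" by (intro power_mono) auto
  with pyth[of "meas_pinv \<eta> m v"] y have "(norm (meas_pinv \<eta> m v - ?y0))\<^sup>2 \<le> 0" unfolding sol by simp
  thus ?thesis by simp
qed

section \<open>Pseudoinverse of the measurement operator\<close>

context
  fixes \<eta> :: "nat \<Rightarrow> 'b::real_inner" and m :: nat
  assumes bij: "bij_betw (\<lambda>u. meas_op \<eta> m (meas_adj \<eta> m u)) (euclid m) (euclid m)"
begin

lemma gram_solvable: "\<exists>u\<in>euclid m. \<forall>j<m. meas_op \<eta> m (meas_adj \<eta> m u) j = v j"
proof -
  have "(\<lambda>j. if j < m then v j else 0) \<in> euclid m" by (simp add: euclid_def)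
  then obtain u where "u \<in> euclid m" "meas_op \<eta> m (meas_adj \<eta> m u) = (\<lambda>j. if j < m then v j else 0)"
    using bij_betw_imp_surj_on[OF bij] by (metis (no_types, lifting) imageE)
  thus ?thesis by (intro bexI[of _ u]) simp_all
qed

text \<open>With y = \<open>meas_adj \<eta> m u\<close> the pseudoinverse of v, |y|^2 is the inner
  product of v and u, hence at most |v| |u|; and c |u| \<le> |y| by the bound on the singular
  values.\<close>

lemma norm_meas_pinv_le:
  assumes "1 \<le> m" "0 < c" "\<And>\<sigma>. \<sigma> \<in> meas_singular_values \<eta> m \<Longrightarrow> c \<le> \<sigma>"
  shows "(norm (meas_pinv \<eta> m v))\<^sup>2 \<le> (\<Sum>j<m. (v j)\<^sup>2) / c\<^sup>2"
proof -
  obtain u where u: "u \<in> euclid m" "\<And>j. j < m \<Longrightarrow> meas_op \<eta> m (meas_adj \<eta> m u) j = v j"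
    using gram_solvable by blast
  define y where "y = meas_adj \<eta> m u"
  have pinv: "meas_pinv \<eta> m v = y" unfolding y_def by (rule meas_pinv_eqI) (rule u)
  define U V where "U = L2_set u {..<m}" and "V = L2_set v {..<m}"
  have UV: "U\<^sup>2 = (\<Sum>j<m. (u j)\<^sup>2)" "V\<^sup>2 = (\<Sum>j<m. (v j)\<^sup>2)" "U \<ge> 0" "V \<ge> 0"
    by (simp_all add: U_def V_def L2_set_def sum_nonneg)
  have "(norm y)\<^sup>2 = (\<Sum>j<m. meas_op \<eta> m y j * u j)"
    unfolding power2_norm_eq_inner using meas_adj_adjoint[of \<eta> m y u] by (simp add: y_def)
  also have "\<dots> = (\<Sum>j<m. v j * u j)" using u(2) by (intro sum.cong) (auto simp: y_def)
  also have "\<dots> \<le> V * U"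
    unfolding U_def V_def
    by (rule order_trans[OF sum_mono L2_set_mult_ineq]) (simp add: abs_mult[symmetric])
  finally have 1: "(norm y)\<^sup>2 \<le> V * U" .
  have "(c * U)\<^sup>2 \<le> (norm y)\<^sup>2"
    using singular_value_lower_bound[OF assms(1) less_imp_le[OF assms(2)] assms(3) u(1)]
    by (simp add: power_mult_distrib UV y_def)
  hence 2: "c * U \<le> norm y" by (rule power2_le_imp_le) simp
  have "c * norm y \<le> V"
  proof (cases "y = 0")
    case False
    have "norm y * (c * norm y) = c * (norm y)\<^sup>2" by (simp add: power2_eq_square)
    also have "\<dots> \<le> c * (V * U)" using 1 assms(2) by (intro mult_left_mono) auto
    also have "\<dots> = V * (c * U)" by simp
    also have "\<dots> \<le> V * norm y" using 2 UV by (intro mult_left_mono) auto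
    finally show ?thesis using False by (simp add: mult.commute[of V])
  qed (use UV in simp)
  hence "(c * norm y)\<^sup>2 \<le> V\<^sup>2" using assms(2) by (intro power_mono) auto
  thus ?thesis using assms(2) by (simp add: pinv UV power_mult_distrib field_simps)
qed

text \<open>Linearity in coordinates. It yields additivity and turns the random reconstruction into
  a finite combination of fixed vectors, on which measurability rests.\<close>

lemma meas_pinv_expansion:
  "meas_pinv \<eta> m v = (\<Sum>l<m. v l *\<^sub>R meas_pinv \<eta> m (\<lambda>j. if j = l then 1 else 0))"
proof -
  obtain U where U: "\<And>l j. j < m \<Longrightarrow> meas_op \<eta> m (meas_adj \<eta> m (U l)) j = (if j = l then 1 else 0)"
    using gram_solvable[of "\<lambda>j. if j = _ then 1 else 0"] by metis
  have adj: "meas_adj \<eta> m (\<lambda>k. \<Sum>l<m. v l * U l k) = (\<Sum>l<m. v l *\<^sub>R meas_adj \<eta> m (U l))"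
    unfolding meas_adj_def scaleR_sum_left scaleR_sum_right by (subst sum.swap) simp
  have "meas_pinv \<eta> m v = meas_adj \<eta> m (\<lambda>k. \<Sum>l<m. v l * U l k)"
  proof (rule meas_pinv_eqI)
    fix j assume "j < m"
    have "meas_op \<eta> m (meas_adj \<eta> m (\<lambda>k. \<Sum>l<m. v l * U l k)) j = (\<Sum>l<m. if j = l then v l else 0)"
      unfolding adj meas_op_sum meas_op_scaleR U[OF \<open>j < m\<close>] by (intro sum.cong) auto
    thus "meas_op \<eta> m (meas_adj \<eta> m (\<lambda>k. \<Sum>l<m. v l * U l k)) j = v j"
      using \<open>j < m\<close> by simp
  qed
  moreover have "meas_pinv \<eta> m (\<lambda>j. if j = l then 1 else 0) = meas_adj \<eta> m (U l)" for l
    by (rule meas_pinv_eqI) (rule U)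
  ultimately show ?thesis by (simp add: adj)
qed

lemma meas_pinv_add:
  assumes "\<And>j. j < m \<Longrightarrow> v j = a j + b j"
  shows "meas_pinv \<eta> m v = meas_pinv \<eta> m a + meas_pinv \<eta> m b"
  by (subst (1 2 3) meas_pinv_expansion) (simp add: assms scaleR_add_left sum.distrib)

end

text \<open>A dense range has trivial orthogonal complement, so the domain is the range itself, and
  injectivity determines the preimage.\<close>

lemma mp_inverse_eq:
  fixes K :: "'x::real_inner \<Rightarrow> 'y::real_inner"
  assumes K: "bounded_linear K" "inj K" and dense: "closure (range K) = UNIV" and y: "y \<in> mp_domain K"
  shows "K (mp_inverse K y) = y"
proof -
  interpret K: bounded_linear K by fact
  have perp: "z = 0" if "z \<in> (range K)\<^sup>\<bottom>" for z
  proof -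
    have "range K \<subseteq> {u. u \<bullet> z = 0}" using that by (auto simp: orthogonal_comp_def orthogonal_def)
    hence "closure (range K) \<subseteq> {u. u \<bullet> z = 0}"
      by (rule closure_minimal) (intro closed_Collect_eq continuous_intros)
    hence "z \<in> {u. u \<bullet> z = 0}" unfolding dense by blast
    thus ?thesis by simp
  qed
  have "K u = 0 \<longleftrightarrow> u = 0" for u using inj_eq[OF K(2), of u 0] by (simp add: K.zero)
  hence ker: "K -` {0} = {0}" by auto
  obtain x v where "y = K x + v" "v \<in> (range K)\<^sup>\<bottom>" using y by (auto simp: mp_domain_def)
  hence x: "y = K x" using perp by simp
  have "mp_inverse K y = x" unfolding mp_inverse_def ker
  proof (rule the_equality)
    show "x \<in> {0}\<^sup>\<bottom> \<and> y - K x \<in> (range K)\<^sup>\<bottom>" by (simp add: x orthogonal_comp_def orthogonal_def)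
    fix x' assume "x' \<in> {0}\<^sup>\<bottom> \<and> y - K x' \<in> (range K)\<^sup>\<bottom>"
    hence "K x = K x'" using perp x by force
    thus "x' = x" using K(2) by (simp add: inj_eq)
  qed
  thus ?thesis by (simp add: x)
qed

text \<open>The Hilbert spaces need not be separable, so vector-valued measurability is avoided by expanding
  the norm of a finite linear combination.\<close>

lemma norm_linear_combination_measurable:
  fixes z :: "'l \<Rightarrow> 'b::real_inner"
  assumes [measurable]: "\<And>l. l \<in> L \<Longrightarrow> g l \<in> borel_measurable M"
  shows "(\<lambda>\<omega>. norm ((\<Sum>l\<in>L. g l \<omega> *\<^sub>R z l) - a)) \<in> borel_measurable M"
proof -
  have "norm ((\<Sum>l\<in>L. g l \<omega> *\<^sub>R z l) - a) = sqrt ((\<Sum>l\<in>L. \<Sum>k\<in>L. g l \<omega> * (g k \<omega> * (z l \<bullet> z k)))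
      - (\<Sum>l\<in>L. g l \<omega> * (z l \<bullet> a)) - (\<Sum>l\<in>L. g l \<omega> * (a \<bullet> z l)) + a \<bullet> a)" for \<omega>
  proof -
    let ?S = "\<Sum>l\<in>L. g l \<omega> *\<^sub>R z l"
    have "?S \<bullet> ?S = (\<Sum>l\<in>L. \<Sum>k\<in>L. g l \<omega> * (g k \<omega> * (z l \<bullet> z k)))"
      unfolding inner_sum_left unfolding inner_sum_right unfolding inner_scaleR_left
      unfolding inner_scaleR_right ..
    moreover have "?S \<bullet> a = (\<Sum>l\<in>L. g l \<omega> * (z l \<bullet> a))" "a \<bullet> ?S = (\<Sum>l\<in>L. g l \<omega> * (a \<bullet> z l))"
      by (simp_all add: inner_sum_left inner_sum_right)
    ultimately show ?thesis
      unfolding norm_eq_sqrt_inner inner_diff_left inner_diff_right by (simp add: algebra_simps)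
  qed
  thus ?thesis by simp
qed

text \<open>The exact data do not vary with the repetition and drop out of the sample variance.
  Solving the inequality for it identifies the tolerance of
  \<open>repetitions_suffice\<close>.\<close>

lemma num_repetitions_shift:
  assumes "1 \<le> m" "c > 0"
  shows "num_repetitions (\<lambda>i j. a j + Y i j) m c d
    = (LEAST n. 2 \<le> n \<and> sample_var Y m n \<le> n * (d\<^sup>2 * c\<^sup>2 / m))"
proof -
  have "(2 \<le> n \<and> real m * sample_var (\<lambda>i j. a j + Y i j) m n / (real n * c\<^sup>2) \<le> d\<^sup>2)
      \<longleftrightarrow> (2 \<le> n \<and> sample_var Y m n \<le> n * (d\<^sup>2 * c\<^sup>2 / m))" for n
    using assms by (auto simp: sample_var_shift field_simps)
  thus ?thesis by (simp add: num_repetitions_def)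
qed

theorem corollary1p2:
  fixes K :: "'x::{real_inner, complete_space} \<Rightarrow> 'y::{real_inner, complete_space}"
    and \<eta> :: "nat \<Rightarrow> 'y" and yhat :: 'y
    and M :: "'w measure" and noise :: "nat \<Rightarrow> nat \<Rightarrow> 'w \<Rightarrow> real"
    and c C \<delta>disc :: "nat \<Rightarrow> real" and \<tau> q :: real
    and Y :: "nat \<Rightarrow> nat \<Rightarrow> 'w \<Rightarrow> real" and N :: "nat \<Rightarrow> 'w \<Rightarrow> nat"
    and Z :: "nat \<Rightarrow> 'w \<Rightarrow> 'y" and \<alpha> :: "nat \<Rightarrow> 'w \<Rightarrow> real"
  assumes infinite_dim_X: "\<not> (\<exists>B. finite B \<and> span B = (UNIV :: 'x set))"
    and infinite_dim_Y: "\<not> (\<exists>B. finite B \<and> span B = (UNIV :: 'y set))"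
    and K_compact: "compact_operator K"
    and K_inj: "inj K"
    and K_dense: "closure (range K) = UNIV"
    and eta_norm: "\<And>i j. norm (\<eta> i) = norm (\<eta> j)"
    and PP_bij: "\<And>m. 1 \<le> m \<Longrightarrow>
          bij_betw (\<lambda>u. meas_op \<eta> m (meas_adj \<eta> m u)) (euclid m) (euclid m)"
    and eta_complete: "complete_discretisation \<eta>"
    and eta_well_conditioned: "well_conditioned \<eta>"
    and c_pos: "\<And>m. 1 \<le> m \<Longrightarrow> 0 < c m"
    and singular_bounds: "\<And>m \<sigma>. 1 \<le> m \<Longrightarrow> \<sigma> \<in> meas_singular_values \<eta> m \<Longrightarrow> c m \<le> \<sigma> \<and> \<sigma> \<le> C m"
    and cond_bounded: "limsup (\<lambda>m. ereal (C m / c m)) < \<infinity>"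
    and prob: "prob_space M"
    and noise_indep: "prob_space.indep_vars M (\<lambda>_. borel) (\<lambda>(i, j). noise i j) UNIV"
    and noise_ident: "\<And>i j. distr M borel (noise i j) = distr M borel (noise 0 0)"
    and noise_integrable: "\<And>i j. integrable M (noise i j)"
    and noise_mean: "\<And>i j. prob_space.expectation M (noise i j) = 0"
    and noise_var: "\<And>i j. integrable M (\<lambda>\<omega>. (noise i j \<omega>)\<^sup>2)"
    and yhat_dom: "yhat \<in> mp_domain K"
    and delta_pos: "\<And>m. 1 \<le> m \<Longrightarrow> 0 < \<delta>disc m"
    and delta_tendsto: "\<delta>disc \<longlonglongrightarrow> 0"
    and delta_bound: "\<And>m. 1 \<le> m \<Longrightarrow> norm (yhat - meas_pinv \<eta> m (meas_op \<eta> m yhat)) \<le> \<delta>disc m"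
    and tau: "1 < \<tau>" and q: "0 < q" "q < 1"
    and Y_eq: "\<And>i j \<omega>. Y i j \<omega> = \<eta> j \<bullet> yhat + noise i j \<omega>"
    and N_eq: "\<And>m \<omega>. N m \<omega> = num_repetitions (\<lambda>i j. Y i j \<omega>) m (c m) (\<delta>disc m)"
    and Z_eq: "\<And>m \<omega>. Z m \<omega> = meas_pinv \<eta> m (sample_mean (\<lambda>i j. Y i j \<omega>) (N m \<omega>))"
    and alpha_eq: "\<And>m \<omega>. \<alpha> m \<omega> = discrepancy_alpha K \<tau> q (\<delta>disc m) (Z m \<omega>)"
  shows "(\<forall>\<epsilon>>0. (\<lambda>m. measure M {\<omega> \<in> space M.
            norm (tikhonov K (\<alpha> m \<omega>) (Z m \<omega>) - mp_inverse K yhat) \<ge> \<epsilon>}) \<longlonglongrightarrow> 0)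
    \<and> (\<forall>\<nu>. 0 < \<nu> \<and> \<nu> \<le> 1 \<longrightarrow> (\<exists>L'. \<forall>\<rho>>0.
            (\<exists>w. norm w \<le> \<rho> \<and> mp_inverse K yhat = operator_powr (adjoint K \<circ> K) (\<nu> / 2) w) \<longrightarrow>
            (\<lambda>m. measure M {\<omega> \<in> space M.
               norm (tikhonov K (\<alpha> m \<omega>) (Z m \<omega>) - mp_inverse K yhat)
                 \<le> L' * \<rho> powr (1 / (\<nu> + 1)) * \<delta>disc m powr (\<nu> / (\<nu> + 1))}) \<longlonglongrightarrow> 1))"
proof -
  interpret prob_space M by fact
  have K: "bounded_linear K" by (rule compact_operator_bounded_linear[OF K_compact])
  interpret K: bounded_linear K by (rule K)
  define xhat where "xhat = mp_inverse K yhat"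
  have Kx: "K xhat = yhat" unfolding xhat_def by (rule mp_inverse_eq[OF K K_inj K_dense yhat_dom])
  interpret centred_iid M "\<lambda>(i, j). noise i j"
  proof
    show "indep_vars (\<lambda>_. borel) (\<lambda>(i, j). noise i j) UNIV" by (rule noise_indep)
    show "distr M borel (case p of (i, j) \<Rightarrow> noise i j) = distr M borel (case (0, 0) of (i, j) \<Rightarrow> noise i j)" for p
      using noise_ident by (cases p) auto
    show "integrable M (\<lambda>\<omega>. ((case p of (i, j) \<Rightarrow> noise i j) \<omega>)\<^sup>2)" for p
      using noise_var by (cases p) auto
    show "expectation (case p of (i, j) \<Rightarrow> noise i j) = 0" for p
      using noise_mean by (cases p) auto
  qed
  have noise_m [measurable]: "noise i j \<in> borel_measurable M" for i j
    using x_measurable[of "(i, j)"] by simp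
  define err where "err m \<omega> = norm (tikhonov K (\<alpha> m \<omega>) (Z m \<omega>) - xhat)" for m \<omega>

  \<comment> \<open>The sets in the conclusion have to be events. Both random choices, the number of
    repetitions and the exponent of q, take values in the natural numbers, so it is enough to treat
    each fixed value and compose countably.\<close>
  have err_measurable: "err m \<in> borel_measurable M" if m: "1 \<le> m" for m
  proof -
    have Y_m [measurable]: "(\<lambda>\<omega>. Y i j \<omega>) \<in> borel_measurable M" for i j unfolding Y_eq by measurable
    have N_m: "N m \<in> measurable M (count_space UNIV)"
      unfolding N_eq num_repetitions_def sample_var_def sample_mean_def by measurable
    define g where "g j \<omega> = sample_mean (\<lambda>i j. Y i j \<omega>) (N m \<omega>) j" for j \<omega>
    have g [measurable]: "g j \<in> borel_measurable M" for j
      unfolding g_def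
      by (rule measurable_compose_countable[OF _ N_m]) (simp add: sample_mean_def)
    define z where "z l = meas_pinv \<eta> m (\<lambda>j. if j = l then 1 else 0)" for l
    have Z: "Z m \<omega> = (\<Sum>l<m. g l \<omega> *\<^sub>R z l)" for \<omega>
      unfolding Z_eq g_def z_def by (rule meas_pinv_expansion[OF PP_bij[OF m]])
    have tik: "tikhonov K a (Z m \<omega>) = (\<Sum>l<m. g l \<omega> *\<^sub>R tikhonov K a (z l))" if "a > 0" for a \<omega>
      unfolding Z using tikhonov_linear[OF K that] by (simp add: linear_sum linear_scale)
    have "q ^ k > 0" for k using q by simp
    note tik_q = tik[OF this]
    define \<kappa> where "\<kappa> \<omega> = (LEAST k. norm (K (tikhonov K (q ^ k) (Z m \<omega>)) - Z m \<omega>) \<le> 2 * \<tau> * \<delta>disc m)" for \<omega>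
    have "(\<lambda>\<omega>. norm (K (tikhonov K (q ^ k) (Z m \<omega>)) - Z m \<omega>)) \<in> borel_measurable M" for k
    proof -
      have "K (tikhonov K (q ^ k) (Z m \<omega>)) - Z m \<omega>
          = (\<Sum>l<m. g l \<omega> *\<^sub>R (K (tikhonov K (q ^ k) (z l)) - z l)) - 0" for \<omega>
        unfolding tik_q K.sum K.scaleR by (simp add: Z scaleR_diff_right sum_subtractf)
      thus ?thesis by (simp only:) (rule norm_linear_combination_measurable, measurable)
    qed
    note [measurable] = this
    have \<kappa>: "\<kappa> \<in> measurable M (count_space UNIV)" unfolding \<kappa>_def by measurable
    have "(\<lambda>\<omega>. norm (tikhonov K (q ^ \<kappa> \<omega>) (Z m \<omega>) - xhat)) \<in> borel_measurable M"
    proof (rule measurable_compose_countable[OF _ \<kappa>])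
      show "(\<lambda>\<omega>. norm (tikhonov K (q ^ k) (Z m \<omega>) - xhat)) \<in> borel_measurable M" for k
        unfolding tik_q by (rule norm_linear_combination_measurable) measurable
    qed
    thus ?thesis unfolding err_def alpha_eq discrepancy_alpha_def \<kappa>_def .
  qed

  have good: "\<exists>m0\<ge>1. \<forall>m\<ge>m0. \<exists>G\<in>events. 1 - r \<le> prob G \<and> (\<forall>\<omega>\<in>G. norm (Z m \<omega> - K xhat) \<le> (1 + \<tau>) * \<delta>disc m)"
    if r: "r > 0" for r
  proof -
    obtain m0 where m0: "\<And>m (b::real). m \<ge> m0 \<Longrightarrow> b > 0 \<Longrightarrow> \<exists>G\<in>events. 1 - r \<le> prob G \<and> (\<forall>\<omega>\<in>G. \<exists>N.
      N = (LEAST n. 2 \<le> n \<and> sample_var (\<lambda>i j. noise i j \<omega>) m n \<le> n * b) \<and> 2 \<le> N \<and>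
      (\<Sum>j<m. (\<Sum>i<N. noise i j \<omega>)\<^sup>2) \<le> \<tau>\<^sup>2 * b * m * (real N)\<^sup>2)"
      using repetitions_suffice[OF tau r] by auto
    have "\<exists>G\<in>events. 1 - r \<le> prob G \<and> (\<forall>\<omega>\<in>G. norm (Z m \<omega> - K xhat) \<le> (1 + \<tau>) * \<delta>disc m)"
      if m: "m \<ge> max 1 m0" for m
    proof -
      have m1: "1 \<le> m" using m by simp
      define b where "b = (\<delta>disc m)\<^sup>2 * (c m)\<^sup>2 / m"
      have d: "\<delta>disc m > 0" and c: "c m > 0" using delta_pos[OF m1] c_pos[OF m1] .
      have "b > 0" using d c m1 by (simp add: b_def)
      then obtain G where G: "G \<in> events" "1 - r \<le> prob G" "\<And>\<omega>. \<omega> \<in> G \<Longrightarrow> \<exists>N.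
          N = (LEAST n. 2 \<le> n \<and> sample_var (\<lambda>i j. noise i j \<omega>) m n \<le> n * b) \<and> 2 \<le> N \<and>
          (\<Sum>j<m. (\<Sum>i<N. noise i j \<omega>)\<^sup>2) \<le> \<tau>\<^sup>2 * b * m * (real N)\<^sup>2"
        using m0[of m b] m by auto
      have "norm (Z m \<omega> - K xhat) \<le> (1 + \<tau>) * \<delta>disc m" if "\<omega> \<in> G" for \<omega>
      proof -
        have "N m \<omega> = (LEAST n. 2 \<le> n \<and> sample_var (\<lambda>i j. noise i j \<omega>) m n \<le> n * b)"
          unfolding N_eq Y_eq b_def by (rule num_repetitions_shift[OF m1 c])
        with G(3)[OF that] have N: "2 \<le> N m \<omega>"
          "(\<Sum>j<m. (\<Sum>i<N m \<omega>. noise i j \<omega>)\<^sup>2) \<le> \<tau>\<^sup>2 * b * m * (real (N m \<omega>))\<^sup>2" by auto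
        define a where "a j = (\<Sum>i<N m \<omega>. noise i j \<omega>) / N m \<omega>" for j
        have "sample_mean (\<lambda>i j. Y i j \<omega>) (N m \<omega>) j = meas_op \<eta> m yhat j + a j" if "j < m" for j
          using N(1) that by (simp add: sample_mean_def Y_eq meas_op_def a_def sum.distrib add_divide_distrib)
        hence Z: "Z m \<omega> = meas_pinv \<eta> m (meas_op \<eta> m yhat) + meas_pinv \<eta> m a"
          unfolding Z_eq by (rule meas_pinv_add[OF PP_bij[OF m1]])
        have "(norm (meas_pinv \<eta> m a))\<^sup>2 \<le> (\<Sum>j<m. (a j)\<^sup>2) / (c m)\<^sup>2"
          using singular_bounds[OF m1] by (intro norm_meas_pinv_le PP_bij m1 c) auto
        also have "(\<Sum>j<m. (a j)\<^sup>2) = (\<Sum>j<m. (\<Sum>i<N m \<omega>. noise i j \<omega>)\<^sup>2) / (real (N m \<omega>))\<^sup>2"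
          unfolding a_def power_divide sum_divide_distrib[symmetric] ..
        also have "\<dots> / (c m)\<^sup>2 \<le> (\<tau>\<^sup>2 * b * m * (real (N m \<omega>))\<^sup>2) / (real (N m \<omega>))\<^sup>2 / (c m)\<^sup>2"
          using N(2) by (intro divide_right_mono) auto
        \<comment> \<open>The squared number of repetitions and c^2 cancel, since b * m = delta^2
          c^2.\<close>
        also have "\<dots> = (\<tau> * \<delta>disc m)\<^sup>2"
          using N(1) c m1 by (simp add: b_def power_mult_distrib)
        finally have "norm (meas_pinv \<eta> m a) \<le> \<tau> * \<delta>disc m"
          by (rule power2_le_imp_le) (use tau d in simp)
        moreover have "Z m \<omega> - K xhat = meas_pinv \<eta> m a - (yhat - meas_pinv \<eta> m (meas_op \<eta> m yhat))"
          by (simp add: Z Kx)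
        ultimately show ?thesis
          using delta_bound[OF m1] norm_triangle_ineq4[of "meas_pinv \<eta> m a" "yhat - meas_pinv \<eta> m (meas_op \<eta> m yhat)"]
          by (simp add: distrib_right)
      qed
      with G(1,2) show ?thesis by blast
    qed
    thus ?thesis by (intro exI[of _ "max 1 m0"]) auto
  qed

  \<comment> \<open>Transfers a deterministic implication to probabilities: any condition on the
    error that the noise bound forces for large m holds with probability tending to 1. Both
    conclusions are instances.\<close>
  have prob_tendsto_1: "(\<lambda>m. prob {\<omega> \<in> space M. P m (err m \<omega>)}) \<longlonglongrightarrow> 1"
    if P: "\<And>m. 1 \<le> m \<Longrightarrow> {\<omega> \<in> space M. P m (err m \<omega>)} \<in> events"
      and ev: "\<forall>\<^sub>F m in sequentially. \<forall>\<omega>. norm (Z m \<omega> - K xhat) \<le> (1 + \<tau>) * \<delta>disc m \<longrightarrow> P m (err m \<omega>)"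
    for P :: "nat \<Rightarrow> real \<Rightarrow> bool"
  proof (rule order_tendstoI)
    fix a :: real assume "a < 1"
    then obtain m0 where m0: "m0 \<ge> 1" "\<And>m. m \<ge> m0 \<Longrightarrow> \<exists>G\<in>events. 1 - (1 - a) / 2 \<le> prob G \<and>
        (\<forall>\<omega>\<in>G. norm (Z m \<omega> - K xhat) \<le> (1 + \<tau>) * \<delta>disc m)"
      using good[of "(1 - a) / 2"] by auto
    show "\<forall>\<^sub>F m in sequentially. a < prob {\<omega> \<in> space M. P m (err m \<omega>)}"
      using ev eventually_ge_at_top[of m0]
    proof eventually_elim
      case (elim m)
      then obtain G where G: "G \<in> events" "1 - (1 - a) / 2 \<le> prob G"
        "\<forall>\<omega>\<in>G. norm (Z m \<omega> - K xhat) \<le> (1 + \<tau>) * \<delta>disc m" using m0(2) by blast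
      have "G \<subseteq> {\<omega> \<in> space M. P m (err m \<omega>)}"
        using elim(1) G sets.sets_into_space[OF G(1)] by auto
      hence "prob G \<le> prob {\<omega> \<in> space M. P m (err m \<omega>)}"
        using elim(2) m0(1) by (intro finite_measure_mono P) auto
      thus ?case using G(2) \<open>a < 1\<close> by (simp add: field_simps)
    qed
  next
    fix a :: real assume "1 < a"
    thus "\<forall>\<^sub>F m in sequentially. prob {\<omega> \<in> space M. P m (err m \<omega>)} < a"
      by (intro always_eventually allI) (rule order_le_less_trans[OF prob_le_1])
  qed
  have eventually_delta: "\<forall>\<^sub>F m in sequentially. 0 < \<delta>disc m \<and> \<delta>disc m < e" if "e > 0" for e
    using order_tendstoD(2)[OF delta_tendsto that] eventually_ge_at_top[of 1]
    by eventually_elim (auto intro: delta_pos)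

  have "(\<lambda>m. prob {\<omega> \<in> space M. err m \<omega> \<ge> \<epsilon>}) \<longlonglongrightarrow> 0" if \<epsilon>: "\<epsilon> > 0" for \<epsilon>
  proof -
    obtain d0 where d0: "d0 > 0" "\<And>d z. 0 < d \<Longrightarrow> d < d0 \<Longrightarrow> norm (z - K xhat) \<le> (1 + \<tau>) * d \<Longrightarrow>
        norm (tikhonov K (discrepancy_alpha K \<tau> q d z) z - xhat) < \<epsilon>"
      using tikhonov_discrepancy_converges[OF K K_inj tau q \<epsilon>] by blast
    have meas: "{\<omega> \<in> space M. err m \<omega> < \<epsilon>} \<in> events" if "1 \<le> m" for m
      using err_measurable[OF that] by measurable
    have "(\<lambda>m. prob {\<omega> \<in> space M. err m \<omega> < \<epsilon>}) \<longlonglongrightarrow> 1"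
    proof (rule prob_tendsto_1[OF meas])
      show "\<forall>\<^sub>F m in sequentially. \<forall>\<omega>. norm (Z m \<omega> - K xhat) \<le> (1 + \<tau>) * \<delta>disc m \<longrightarrow> err m \<omega> < \<epsilon>"
        using eventually_delta[OF d0(1)]
        by eventually_elim (auto simp: err_def alpha_eq intro!: d0(2))
    qed
    hence "(\<lambda>m. 1 - prob {\<omega> \<in> space M. err m \<omega> < \<epsilon>}) \<longlonglongrightarrow> 1 - 1" by (intro tendsto_intros)
    moreover have "\<forall>\<^sub>F m in sequentially. 1 - prob {\<omega> \<in> space M. err m \<omega> < \<epsilon>} = prob {\<omega> \<in> space M. err m \<omega> \<ge> \<epsilon>}"
      using eventually_ge_at_top[of 1]
    proof eventually_elim
      case (elim m)
      have "{\<omega> \<in> space M. err m \<omega> \<ge> \<epsilon>} = space M - {\<omega> \<in> space M. err m \<omega> < \<epsilon>}" by auto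
      thus ?case using prob_compl[OF meas[OF elim]] by simp
    qed
    ultimately show ?thesis by (simp add: tendsto_cong)
  qed
  moreover have "\<exists>L'. \<forall>\<rho>>0. (\<exists>w. norm w \<le> \<rho> \<and> xhat = operator_powr (adjoint K \<circ> K) (\<nu> / 2) w) \<longrightarrow>
      (\<lambda>m. prob {\<omega> \<in> space M. err m \<omega> \<le> L' * \<rho> powr (1 / (\<nu> + 1)) * \<delta>disc m powr (\<nu> / (\<nu> + 1))}) \<longlonglongrightarrow> 1"
    if \<nu>: "0 < \<nu>" "\<nu> \<le> 1" for \<nu>
  proof -
    from tikhonov_discrepancy_rate[OF K tau q \<nu>] obtain L where
      L: "\<forall>\<rho>>0. \<forall>w x. norm w \<le> \<rho> \<longrightarrow> x = operator_powr (adjoint K \<circ> K) (\<nu> / 2) w \<longrightarrow>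
        (\<forall>d z. 0 < d \<longrightarrow> d \<le> \<rho> \<longrightarrow> norm (z - K x) \<le> (1 + \<tau>) * d \<longrightarrow>
        norm (tikhonov K (discrepancy_alpha K \<tau> q d z) z - x)
          \<le> L * \<rho> powr (1 / (\<nu> + 1)) * d powr (\<nu> / (\<nu> + 1)))" ..
    show ?thesis
    proof (intro exI allI impI, elim exE conjE)
      fix \<rho> w assume \<rho>: "\<rho> > 0" "norm w \<le> \<rho>" "xhat = operator_powr (adjoint K \<circ> K) (\<nu> / 2) w"
      show "(\<lambda>m. prob {\<omega> \<in> space M. err m \<omega> \<le> L * \<rho> powr (1 / (\<nu> + 1)) * \<delta>disc m powr (\<nu> / (\<nu> + 1))}) \<longlonglongrightarrow> 1"
      proof (rule prob_tendsto_1)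
        show "{\<omega> \<in> space M. err m \<omega> \<le> L * \<rho> powr (1 / (\<nu> + 1)) * \<delta>disc m powr (\<nu> / (\<nu> + 1))} \<in> events"
          if "1 \<le> m" for m using err_measurable[OF that] by measurable
        \<comment> \<open>The deterministic rate asks for noise levels up to \<rho>, which holds
          from some m on because they tend to 0.\<close>
        show "\<forall>\<^sub>F m in sequentially. \<forall>\<omega>. norm (Z m \<omega> - K xhat) \<le> (1 + \<tau>) * \<delta>disc m \<longrightarrow>
            err m \<omega> \<le> L * \<rho> powr (1 / (\<nu> + 1)) * \<delta>disc m powr (\<nu> / (\<nu> + 1))"
          using eventually_delta[OF \<rho>(1)]
          by eventually_elim (auto simp: err_def alpha_eq intro!: L[rule_format, OF \<rho>])
      qed
    qed
  qed
  ultimately show ?thesis unfolding err_def xhat_def by blast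
qed

end
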